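(* Let $T$ be a finite rack with rack rank $N$. If two link diagrams $D$ and $D'$ are ambient isotopic and have writhe vectors congruent modulo $N$, then $|\mathrm{Hom}(FR(D),T)|=|\mathrm{Hom}(FR(D'),T)|$.
   Context: Racks. A rack is a set $R$ with a binary operation $\triangleright:R\times R\to R$ such that (i) for every $x\in R$ the map $f_x:R\to R$, $f_x(y)=y\triangleright x$, is invertible, with inverse written $f_x^{-1}(y)=y\triangleright^{-1}x$; and (ii) $(x\triangleright y)\triangleright z=(x\triangleright z)\triangleright(y\triangleright z)$ for all $x,y,z\in R$. A rack homomorphism is a map preserving $\triangleright$ (and $\triangleright^{-1}$). Rack rank. For $x$ in a rack $T$ set $x^{\triangleright 1}=x\triangleright x$ and $x^{\triangleright(k+1)}=x^{\triangleright k}\triangleright x^{\triangleright k}$. The rack rank $N(x)$ of $x$ is the least positive integer $N$ with $x^{\triangleright N}=x$ (it is $\infty$ if there is none; it is finite when $T$ is finite). The rack rank of $T$ is $N(T)=\mathrm{lcm}\{N(x)\mid x\in T\}$. Diagrams. "Link diagram" means oriented blackboard-framed virtual or classical link diagram. A virtual link diagram is an oriented link diagram in the plane which, besides classical crossings, may have virtual crossings (with no over/under information); a classical diagram is one with no virtual crossings. Links have ordered components. Two diagrams are ambient isotopic if they are related (respecting orientations and the ordering of components) by planar isotopy, the Reidemeister moves I, II, III and, in the virtual case, the virtual moves, which are summarized by the detour move: any strand having only virtual crossings may be replaced by any other strand with the same endpoints having only virtual crossings. The writhe of a component $C_i$ is $w(C_i)=\sum_{x\in S_i}\mathrm{sign}(x)$,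 where $S_i$ is the set of classical crossings where $C_i$ crosses itself and $\mathrm{sign}(x)=\pm1$ is the usual crossing sign. The writhe vector of a diagram with $n$ components is $\mathbf{w}=(w(C_1),\dots,w(C_n))\in\mathbb{Z}^n$. Vectors $\mathbf{v},\mathbf{w}\in\mathbb{Z}^n$ are congruent modulo $N$ if $v_i\equiv w_i \bmod N$ for all $i$. Fundamental rack. An arc of a diagram is a portion of a component running from one classical undercrossing to the next, passing through classical overcrossings and all virtual crossings without interruption (a component with no undercrossings is a single arc). $FR(D)$ is the rack presented by one generator for each arc of $D$ and one relation for each classical crossing (virtual crossings are ignored): if the overcrossing arc is $x$, and, looking in the positive direction of the overcrossing strand, the underarc on the right is $y$ and the underarc on the left is $z$, then $z=y\triangleright x$. $\mathrm{Hom}(FR(D),T)$ is the set of rack homomorphisms $FR(D)\to T$; equivalently, the set of colorings of the arcs of $D$ by elements of $T$ satisfying the crossing relation at every classical crossing. *)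

theory Defs
  imports "HOL-Analysis.Analysis" "HOL-Number_Theory.Cong"
begin

section \<open>Racks\<close>

record 'a rack =
  carrier :: "'a set"
  act :: "'a \<Rightarrow> 'a \<Rightarrow> 'a" (infixl "\<triangleright>\<index>" 70)

locale rack =
  fixes R (structure)
  assumes act_closed: "\<lbrakk>x \<in> carrier R; y \<in> carrier R\<rbrakk> \<Longrightarrow> x \<triangleright> y \<in> carrier R"
    and act_bij: "x \<in> carrier R \<Longrightarrow> bij_betw (\<lambda>y. y \<triangleright> x) (carrier R) (carrier R)"
    and act_dist: "\<lbrakk>x \<in> carrier R; y \<in> carrier R; z \<in> carrier R\<rbrakk>
      \<Longrightarrow> (x \<triangleright> y) \<triangleright> z = (x \<triangleright> z) \<triangleright> (y \<triangleright> z)"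

definition inv_act :: "('a, 'm) rack_scheme \<Rightarrow> 'a \<Rightarrow> 'a \<Rightarrow> 'a" where
  "inv_act R y x = the_inv_into (carrier R) (\<lambda>z. act R z x) y"

text \<open>Homomorphisms are extensional functions, so that they can be counted.\<close>

definition rack_hom :: "('a, 'm) rack_scheme \<Rightarrow> ('b, 'n) rack_scheme \<Rightarrow> ('a \<Rightarrow> 'b) set" where
  "rack_hom R S = {h \<in> carrier R \<rightarrow>\<^sub>E carrier S. \<forall>x\<in>carrier R. \<forall>y\<in>carrier R.
     h (act R x y) = act S (h x) (h y) \<and> h (inv_act R x y) = inv_act S (h x) (h y)}"

text \<open>
  The value \<open>rack_power R x k\<close> is the \<open>k\<close>-th rack power of \<open>x\<close>, where \<open>rack_power R x 0 = x\<close>.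
  Infinite rank is encoded as \<open>0\<close>, which is also the least common multiple of an unbounded set.
\<close>

definition rack_power :: "('a, 'm) rack_scheme \<Rightarrow> 'a \<Rightarrow> nat \<Rightarrow> 'a" where
  "rack_power R x k = ((\<lambda>y. act R y y) ^^ k) x"

definition elem_rank :: "('a, 'm) rack_scheme \<Rightarrow> 'a \<Rightarrow> nat" where
  "elem_rank R x =
     (if \<exists>k>0. rack_power R x k = x then LEAST k. k > 0 \<and> rack_power R x k = x else 0)"

definition rack_rank :: "('a, 'm) rack_scheme \<Rightarrow> nat" where
  "rack_rank R = Lcm (elem_rank R ` carrier R)"

subsection \<open>Racks given by generators and relations\<close>

datatype (gens: 'g) rack_term =
    Gen 'g
  | Act "'g rack_term" "'g rack_term"
  | InvAct "'g rack_term" "'g rack_term"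

definition terms_over :: "'g set \<Rightarrow> 'g rack_term set" where
  "terms_over G = {t. gens t \<subseteq> G}"

inductive_set presented_cong ::
    "'g set \<Rightarrow> ('g rack_term \<times> 'g rack_term) set \<Rightarrow> ('g rack_term \<times> 'g rack_term) set"
  for G :: "'g set" and Rel :: "('g rack_term \<times> 'g rack_term) set" where
  rel: "(s, t) \<in> Rel \<Longrightarrow> (s, t) \<in> presented_cong G Rel"
| refl: "t \<in> terms_over G \<Longrightarrow> (t, t) \<in> presented_cong G Rel"
| sym: "(s, t) \<in> presented_cong G Rel \<Longrightarrow> (t, s) \<in> presented_cong G Rel"
| trans: "\<lbrakk>(s, t) \<in> presented_cong G Rel; (t, u) \<in> presented_cong G Rel\<rbrakk>
    \<Longrightarrow> (s, u) \<in> presented_cong G Rel"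
| act: "\<lbrakk>(s, s') \<in> presented_cong G Rel; (t, t') \<in> presented_cong G Rel\<rbrakk>
    \<Longrightarrow> (Act s t, Act s' t') \<in> presented_cong G Rel"
| inv_act: "\<lbrakk>(s, s') \<in> presented_cong G Rel; (t, t') \<in> presented_cong G Rel\<rbrakk>
    \<Longrightarrow> (InvAct s t, InvAct s' t') \<in> presented_cong G Rel"
| inv_act_act: "\<lbrakk>s \<in> terms_over G; t \<in> terms_over G\<rbrakk>
    \<Longrightarrow> (InvAct (Act s t) t, s) \<in> presented_cong G Rel"
| act_inv_act: "\<lbrakk>s \<in> terms_over G; t \<in> terms_over G\<rbrakk>
    \<Longrightarrow> (Act (InvAct s t) t, s) \<in> presented_cong G Rel"
| dist: "\<lbrakk>s \<in> terms_over G; t \<in> terms_over G; u \<in> terms_over G\<rbrakk>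
    \<Longrightarrow> (Act (Act s t) u, Act (Act s u) (Act t u)) \<in> presented_cong G Rel"

definition presented_rack ::
    "'g set \<Rightarrow> ('g rack_term \<times> 'g rack_term) set \<Rightarrow> 'g rack_term set rack" where
  "presented_rack G Rel = \<lparr>
     carrier = terms_over G // presented_cong G Rel,
     act = (\<lambda>A B. \<Union>s\<in>A. \<Union>t\<in>B. presented_cong G Rel `` {Act s t})\<rparr>"


section \<open>Link diagrams\<close>

text \<open>
  The plane is \<open>complex\<close>. A diagram with \<open>n\<close> ordered components is a generic immersion of \<open>n\<close>
  oriented circles: the \<open>i\<close>-th component is a regular \<open>C\<^sup>1\<close> curve of period 1, and its points are
  addressed by pairs \<open>(i, t)\<close> with \<open>0 \<le> t < 1\<close>. The set \<open>classical\<close> consists of the pairs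
  \<open>(p, q)\<close> such that the strand at \<open>p\<close> crosses over the strand at \<open>q\<close>; all double points not
  listed there are virtual crossings.
\<close>

type_synonym param = "nat \<times> real"

record diagram =
  curves :: "(real \<Rightarrow> complex) list"
  classical :: "(param \<times> param) set"

definition ncomps :: "diagram \<Rightarrow> nat" where
  "ncomps D = length (curves D)"

definition params :: "diagram \<Rightarrow> param set" where
  "params D = {..<ncomps D} \<times> {0..<1}"

definition pos :: "diagram \<Rightarrow> param \<Rightarrow> complex" where
  "pos D p = (curves D ! fst p) (snd p)"

definition vel :: "diagram \<Rightarrow> param \<Rightarrow> complex" where
  "vel D p = vector_derivative (curves D ! fst p) (at (snd p))"

definition double_points :: "diagram \<Rightarrow> (param \<times> param) set" where
  "double_points D = {(p, q) \<in> params D \<times> params D. p \<noteq> q \<and> pos D p = pos D q}"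

text \<open>The determinant of the real \<open>2 \<times> 2\<close> matrix with columns \<open>u\<close>, \<open>v\<close>.\<close>

definition cdet :: "complex \<Rightarrow> complex \<Rightarrow> real" where
  "cdet u v = Re u * Im v - Im u * Re v"

definition regular_closed_curve :: "(real \<Rightarrow> complex) \<Rightarrow> bool" where
  "regular_closed_curve c \<longleftrightarrow>
     c C1_differentiable_on UNIV \<and> (\<forall>t. c (t + 1) = c t) \<and> (\<forall>t. vector_derivative c (at t) \<noteq> 0)"

definition link_diagram :: "diagram \<Rightarrow> bool" where
  "link_diagram D \<longleftrightarrow>
     (\<forall>c\<in>set (curves D). regular_closed_curve c) \<and>
     finite (double_points D) \<and>
     (\<forall>(p, q)\<in>double_points D. cdet (vel D p) (vel D q) \<noteq> 0) \<and>
     (\<forall>p q r. (p, q) \<in> double_points D \<and> (p, r) \<in> double_points D \<longrightarrow> q = r) \<and>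
     classical D \<subseteq> double_points D \<and>
     (\<forall>(p, q)\<in>classical D. (q, p) \<notin> classical D)"

text \<open>
  A crossing is positive if the over direction followed by the under direction is a positively
  oriented frame, that is, if the understrand passes from the right to the left of the overstrand.
\<close>

definition crossing_sign :: "diagram \<Rightarrow> param \<times> param \<Rightarrow> int" where
  "crossing_sign D x = (if cdet (vel D (fst x)) (vel D (snd x)) > 0 then 1 else - 1)"

definition writhe :: "diagram \<Rightarrow> nat \<Rightarrow> int" where
  "writhe D i = (\<Sum>x \<in> {x \<in> classical D. fst (fst x) = i \<and> fst (snd x) = i}. crossing_sign D x)"


section \<open>The fundamental rack\<close>

text \<open>
  An arc is represented by the set of parameters of its interior points. The argument \<open>t\<close> of
  \<open>arc_of D i t\<close> ranges over all reals, \<open>frac t\<close> being the corresponding parameter.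
\<close>

definition under_params :: "diagram \<Rightarrow> param set" where
  "under_params D = snd ` classical D"

definition arc_of :: "diagram \<Rightarrow> nat \<Rightarrow> real \<Rightarrow> param set" where
  "arc_of D i t = {(i, frac s) | s. \<forall>u\<in>closed_segment t s. (i, frac u) \<notin> under_params D}"

definition arcs :: "diagram \<Rightarrow> param set set" where
  "arcs D = {arc_of D i t | i t. (i, t) \<in> params D - under_params D}"

definition arc_before :: "diagram \<Rightarrow> param \<Rightarrow> param set" where
  "arc_before D q = (THE A. \<forall>\<^sub>F s in at_left (snd q). arc_of D (fst q) s = A)"

definition arc_after :: "diagram \<Rightarrow> param \<Rightarrow> param set" where
  "arc_after D q = (THE A. \<forall>\<^sub>F s in at_right (snd q). arc_of D (fst q) s = A)"

definition over_arc :: "diagram \<Rightarrow> param \<times> param \<Rightarrow> param set" where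
  "over_arc D x = arc_of D (fst (fst x)) (snd (fst x))"

definition right_arc :: "diagram \<Rightarrow> param \<times> param \<Rightarrow> param set" where
  "right_arc D x = (if crossing_sign D x = 1 then arc_before D (snd x) else arc_after D (snd x))"

definition left_arc :: "diagram \<Rightarrow> param \<times> param \<Rightarrow> param set" where
  "left_arc D x = (if crossing_sign D x = 1 then arc_after D (snd x) else arc_before D (snd x))"

definition fundamental_rack :: "diagram \<Rightarrow> param set rack_term set rack" where
  "fundamental_rack D = presented_rack (arcs D)
     {(Gen (left_arc D x), Act (Gen (right_arc D x)) (Gen (over_arc D x))) | x. x \<in> classical D}"


section \<open>Ambient isotopy\<close>

subsection \<open>Planar isotopy\<close>

definition plane_isotopy :: "(real \<Rightarrow> complex \<Rightarrow> complex) \<Rightarrow> bool" where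
  "plane_isotopy H \<longleftrightarrow>
     H 0 = id \<and>
     (\<forall>t\<in>{0..1}. bij (H t)) \<and>
     continuous_on ({0..1} \<times> UNIV) (\<lambda>(t, z). H t z) \<and>
     (\<exists>H' :: real \<Rightarrow> complex \<Rightarrow> complex \<Rightarrow>\<^sub>L complex.
        continuous_on ({0..1} \<times> UNIV) (\<lambda>(t, z). H' t z) \<and>
        (\<forall>t\<in>{0..1}. \<forall>z. (H t has_derivative blinfun_apply (H' t z)) (at z) \<and>
           bij (blinfun_apply (H' t z))))"

definition reparametrization :: "(real \<Rightarrow> real) \<Rightarrow> bool" where
  "reparametrization \<phi> \<longleftrightarrow>
     \<phi> C1_differentiable_on UNIV \<and> (\<forall>t. \<phi> (t + 1) = \<phi> t + 1) \<and>
     (\<forall>t. vector_derivative \<phi> (at t) > 0)"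

definition planar_isotopic :: "diagram \<Rightarrow> diagram \<Rightarrow> bool" where
  "planar_isotopic D D' \<longleftrightarrow> ncomps D = ncomps D' \<and>
     (\<exists>H \<phi>. plane_isotopy H \<and>
        (\<forall>i<ncomps D. reparametrization (\<phi> i) \<and>
           (\<forall>t. (curves D' ! i) t = H 1 ((curves D ! i) (\<phi> i t)))) \<and>
        classical D = map_prod (\<lambda>(i, t). (i, frac (\<phi> i t))) (\<lambda>(i, t). (i, frac (\<phi> i t))) ` classical D')"

subsection \<open>Reidemeister moves\<close>

text \<open>
  Since planar isotopy includes reparametrization and moves discs freely, the Reidemeister moves
  are normalized: they take place in the open unit disc, the diagrams agree as parametrized curves
  outside, and the parameter 0 of each component lies outside. A triple \<open>(i, a, b)\<close> stands for
  the strand of the \<open>i\<close>-th component with parameters between \<open>a\<close> and \<open>b\<close>, and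
  \<open>disc_strands D S\<close> says that \<open>S\<close> lists the strands in which \<open>D\<close> meets the disc.
\<close>

type_synonym strand = "nat \<times> real \<times> real"

fun open_strand :: "strand \<Rightarrow> param set" where
  "open_strand (i, a, b) = {i} \<times> {a<..<b}"

fun closed_strand :: "strand \<Rightarrow> param set" where
  "closed_strand (i, a, b) = {i} \<times> {a..b}"

fun strand_in :: "diagram \<Rightarrow> strand \<Rightarrow> bool" where
  "strand_in D (i, a, b) \<longleftrightarrow> i < ncomps D \<and> 0 < a \<and> a < b \<and> b < 1"

definition disc_strands :: "diagram \<Rightarrow> strand list \<Rightarrow> bool" where
  "disc_strands D S \<longleftrightarrow>
     (\<forall>s\<in>set S. strand_in D s) \<and>
     sorted_wrt (\<lambda>s s'. closed_strand s \<inter> closed_strand s' = {}) S \<and>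
     {p \<in> params D. norm (pos D p) < 1} = (\<Union>s\<in>set S. open_strand s) \<and>
     (\<forall>(p, q)\<in>double_points D. norm (pos D p) \<noteq> 1)"

definition inner_double_points :: "diagram \<Rightarrow> (param \<times> param) set" where
  "inner_double_points D = {(p, q) \<in> double_points D. norm (pos D p) < 1}"

definition agree_outside_disc :: "diagram \<Rightarrow> diagram \<Rightarrow> bool" where
  "agree_outside_disc D D' \<longleftrightarrow> ncomps D = ncomps D' \<and>
     (\<forall>p\<in>params D. norm (pos D p) < 1 \<longleftrightarrow> norm (pos D' p) < 1) \<and>
     (\<forall>p\<in>params D. norm (pos D p) \<ge> 1 \<longrightarrow> pos D p = pos D' p) \<and>
     {(p, q) \<in> classical D. norm (pos D p) \<ge> 1} = {(p, q) \<in> classical D'. norm (pos D' p) \<ge> 1}"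

text \<open>
  Move I: a strand without crossings is replaced by a strand whose only crossing is one
  self-crossing. All signs, rotation directions and over/under choices of the kink are included.
\<close>

definition reidemeister1 :: "diagram \<Rightarrow> diagram \<Rightarrow> bool" where
  "reidemeister1 D D' \<longleftrightarrow> agree_outside_disc D D' \<and>
     (\<exists>s. disc_strands D [s] \<and>
        inner_double_points D = {} \<and>
        (\<exists>p q. (p, q) \<in> classical D' \<and> inner_double_points D' = {(p, q), (q, p)}))"

text \<open>
  In moves II and III the highest strand runs along the real diameter of the disc, before and
  after the move.
\<close>

definition along_diameter :: "diagram \<Rightarrow> strand \<Rightarrow> bool" where
  "along_diameter D s \<longleftrightarrow> (\<forall>p\<in>open_strand s. Im (pos D p) = 0)"

definition reidemeister2 :: "diagram \<Rightarrow> diagram \<Rightarrow> bool" where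
  "reidemeister2 D D' \<longleftrightarrow> agree_outside_disc D D' \<and>
     (\<exists>over under. disc_strands D [over, under] \<and>
        along_diameter D over \<and> along_diameter D' over \<and>
        inner_double_points D = {} \<and>
        (\<exists>p p' q q'. {p, p'} \<subseteq> open_strand over \<and> {q, q'} \<subseteq> open_strand under \<and> p \<noteq> p' \<and>
           {(p, q), (p', q')} \<subseteq> classical D' \<and>
           inner_double_points D' = {(p, q), (q, p), (p', q'), (q', p')}))"

text \<open>
  In move III the three strands cross pairwise exactly once, and the crossing of the middle
  strand with the lowest one passes from one side of the highest strand to the other.
  In \<open>triangle D hi mid lo m l\<close>, this crossing is at the parameter \<open>m\<close> of the middle strand
  and \<open>l\<close> of the lowest one.
\<close>

definition triangle ::
    "diagram \<Rightarrow> strand \<Rightarrow> strand \<Rightarrow> strand \<Rightarrow> param \<Rightarrow> param \<Rightarrow> bool" where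
  "triangle D hi mid lo m l \<longleftrightarrow>
     disc_strands D [hi, mid, lo] \<and> along_diameter D hi \<and>
     m \<in> open_strand mid \<and> l \<in> open_strand lo \<and>
     (\<exists>p p' m' l'. {p, p'} \<subseteq> open_strand hi \<and> m' \<in> open_strand mid \<and> l' \<in> open_strand lo \<and>
        {(p, m'), (p', l'), (m, l)} \<subseteq> classical D \<and>
        inner_double_points D = {(p, m'), (m', p), (p', l'), (l', p'), (m, l), (l, m)})"

definition reidemeister3 :: "diagram \<Rightarrow> diagram \<Rightarrow> bool" where
  "reidemeister3 D D' \<longleftrightarrow> agree_outside_disc D D' \<and>
     (\<exists>hi mid lo.
        (\<exists>m l. triangle D hi mid lo m l \<and> Im (pos D m) < 0) \<and>
        (\<exists>m l. triangle D' hi mid lo m l \<and> Im (pos D' m) > 0))"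

subsection \<open>The detour move\<close>

text \<open>
  All crossings on the replaced strand \<open>s\<close> are virtual in both diagrams, because no parameter of
  \<open>s\<close> occurs in their common set of classical crossings.
\<close>

definition detour :: "diagram \<Rightarrow> diagram \<Rightarrow> bool" where
  "detour D D' \<longleftrightarrow> ncomps D = ncomps D' \<and> classical D = classical D' \<and>
     (\<exists>s. strand_in D s \<and>
        (\<forall>p\<in>params D - open_strand s. pos D p = pos D' p) \<and>
        (\<forall>(p, q)\<in>classical D. p \<notin> closed_strand s \<and> q \<notin> closed_strand s))"

subsection \<open>The equivalence relation\<close>

definition diagram_move :: "diagram \<Rightarrow> diagram \<Rightarrow> bool" where
  "diagram_move D D' \<longleftrightarrow> link_diagram D \<and> link_diagram D' \<and>
     (planar_isotopic D D' \<or> reidemeister1 D D' \<or> reidemeister2 D D' \<or> reidemeister3 D D' \<or>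
      detour D D')"

text \<open>
  Classical diagrams are the diagrams without virtual crossings. An isotopy between two of them
  through classical diagrams is a special case of the following relation.
\<close>

definition ambient_isotopic :: "diagram \<Rightarrow> diagram \<Rightarrow> bool" where
  "ambient_isotopic = equivclp diagram_move"

end

(*
  The operation x |-> x |> x is an automorphism of the rack T which does not affect the action of
  elements, and its N-th power is the identity. Hence one can count colorings that are twisted by
  k_i times this operation when one passes once around component i; this number depends only on k
  modulo N. A kink of sign e shifts the twist of its component by e, so the number of colorings
  with twist m + w(D), as a function of m, is invariant under all moves, move I included. At
  m = -w(D) it is the number of ordinary colorings of D, and for D' it is the number of colorings
  with twist w(D') - w(D), which is zero modulo N.

  Moves II and III replace the crossings inside a disc; a coloring of the outside extends in at
  most one way. That the crossing of the two lower strands keeps its sign in move III is seen from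
  the winding number around 0 of the difference of the two strands.
*)
theory Submission
  imports Defs "HOL-Complex_Analysis.Winding_Numbers"
begin

section \<open>Racks\<close>

text \<open>The diagrams between D and D' may have arbitrary writhes, so the number of ordinary
  colorings varies along the isotopy; hence a count that makes sense at every stage, with one fixed
  m. Colorings live on parameters rather than arcs, since arcs merge and split under a move, while
  in moves II and III a function on parameters changes only on the strands inside the disc. Lifting
  to the real line makes parameter 0 an ordinary point, so that reparametrization need not keep
  track of where the twist sits. A kink does not fit the extension argument of moves II and III: its
  strand crosses itself, so no order by height determines its colors, and the twist changes. It is
  treated by a bijection that twists all colors behind the undercrossing. Geometry enters only
  through signs and orders of crossings. Crossings with the highest strand are read off from strand
  end points on the circle, which both diagrams share. The crossing of the two lower strands has no
  such straight line of reference, whence the winding number.\<close>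

definition signed_act :: "('a, 'm) rack_scheme \<Rightarrow> int \<Rightarrow> 'a \<Rightarrow> 'a \<Rightarrow> 'a" where
  "signed_act R e y x = (if e = 1 then act R y x else inv_act R y x)"

text \<open>Reducing the exponent modulo the rank yields a natural number, so negative twists need
  no inverse operation. In a finite rack the rank is positive and the reduction does not change the
  power.\<close>

definition twist :: "('a, 'm) rack_scheme \<Rightarrow> int \<Rightarrow> 'a \<Rightarrow> 'a" where
  "twist R k x = rack_power R x (nat (k mod int (rack_rank R)))"

context rack
begin

lemma act_inv_act:
  assumes "y \<in> carrier R" "x \<in> carrier R"
  shows "inv_act R y x \<triangleright> x = y"
  unfolding inv_act_def using f_the_inv_into_f_bij_betw[OF act_bij[OF assms(2)], of y] assms(1) by simp

lemma inv_act_act: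
  assumes "y \<in> carrier R" "x \<in> carrier R"
  shows "inv_act R (y \<triangleright> x) x = y"
  unfolding inv_act_def using the_inv_into_f_f[OF bij_betw_imp_inj_on[OF act_bij[OF assms(2)]]] assms(1)
      by simp

lemma inv_act_closed:
  assumes "y \<in> carrier R" "x \<in> carrier R"
  shows "inv_act R y x \<in> carrier R"
  unfolding inv_act_def
  using bij_betwE[OF bij_betw_the_inv_into[OF act_bij[OF assms(2)]]] assms(1) by simp

lemma act_cancel:
  "\<lbrakk>y \<in> carrier R; z \<in> carrier R; x \<in> carrier R\<rbrakk>
      \<Longrightarrow> y \<triangleright> x = z \<triangleright> x \<longleftrightarrow> y = z"
  using inv_act_act by metis

lemma inv_act_eqI:
  "\<lbrakk>y \<in> carrier R; z \<in> carrier R; x \<in> carrier R; z \<triangleright> x = y\<rbrakk>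
      \<Longrightarrow> inv_act R y x = z"
  using inv_act_act by metis

lemma inv_act_act_dist:
  assumes "x \<in> carrier R" "y \<in> carrier R" "z \<in> carrier R"
  shows "inv_act R (x \<triangleright> y) z = inv_act R x z \<triangleright> inv_act R y z"
  using assms by (intro inv_act_eqI) (auto simp: act_dist act_closed inv_act_closed act_inv_act)

lemma act_inv_act_dist:
  assumes "x \<in> carrier R" "y \<in> carrier R" "z \<in> carrier R"
  shows "inv_act R x y \<triangleright> z = inv_act R (x \<triangleright> z) (y \<triangleright> z)"
  using assms by (intro inv_act_eqI[symmetric])
      (auto simp: act_dist[symmetric] act_closed inv_act_closed act_inv_act)

lemma inv_act_inv_act_dist:
  assumes "x \<in> carrier R" "y \<in> carrier R" "z \<in> carrier R"
  shows "inv_act R (inv_act R x y) z = inv_act R (inv_act R x z) (inv_act R y z)"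
  using assms
  by (intro inv_act_eqI[symmetric]) (auto simp: inv_act_act_dist[symmetric] inv_act_closed act_inv_act)

lemma signed_act_closed:
  "\<lbrakk>y \<in> carrier R; x \<in> carrier R\<rbrakk>
      \<Longrightarrow> signed_act R e y x \<in> carrier R"
  by (simp add: signed_act_def act_closed inv_act_closed)

text \<open>Right translations are automorphisms, and so are their inverses. With \<open>d\<close>
  and \<open>e\<close> as signs of two crossings, this is the algebra behind move III.\<close>

lemma signed_act_dist:
  assumes "x \<in> carrier R" "y \<in> carrier R" "z \<in> carrier R"
  shows "signed_act R e (signed_act R d x y) z = signed_act R d (signed_act R e x z) (signed_act R e y z)"
  using assms
  by (simp add: signed_act_def act_dist inv_act_act_dist act_inv_act_dist inv_act_inv_act_dist)

lemma signed_act_cancel: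
  assumes "y \<in> carrier R" "x \<in> carrier R" "d = 1 \<longleftrightarrow> e \<noteq> 1"
  shows "signed_act R d (signed_act R e y x) x = y"
  using assms by (auto simp: signed_act_def act_inv_act inv_act_act)

text \<open>Self-distributivity for the preimage of \<open>y\<close> under translation by
  \<open>x\<close>, acted on twice by \<open>x\<close>. It is the reason why twisting an overstrand
  changes no crossing relation.\<close>

lemma act_square:
  assumes "y \<in> carrier R" "x \<in> carrier R"
  shows "y \<triangleright> (x \<triangleright> x) = y \<triangleright> x"
proof -
  have "(inv_act R y x \<triangleright> x) \<triangleright> x
      = (inv_act R y x \<triangleright> x) \<triangleright> (x \<triangleright> x)"
    using assms by (intro act_dist) (auto simp: inv_act_closed)
  then show ?thesis using assms by (simp add: act_inv_act)
qed

lemma inv_act_square: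
  assumes "y \<in> carrier R" "x \<in> carrier R"
  shows "inv_act R y (x \<triangleright> x) = inv_act R y x"
  using assms by (intro inv_act_eqI) (auto simp: act_square act_closed inv_act_closed act_inv_act)

lemma rack_power_0 [simp]: "rack_power R x 0 = x"
  by (simp add: rack_power_def)

lemma rack_power_Suc: "rack_power R x (Suc n) = rack_power R x n \<triangleright> rack_power R x n"
  by (simp add: rack_power_def)

lemma rack_power_add: "rack_power R x (m + n) = rack_power R (rack_power R x n) m"
  by (simp add: rack_power_def funpow_add)

lemma rack_power_closed: "x \<in> carrier R \<Longrightarrow> rack_power R x n \<in> carrier R"
  by (induction n) (auto simp: rack_power_Suc act_closed)

lemma signed_act_rack_power:
  "\<lbrakk>y \<in> carrier R; x \<in> carrier R\<rbrakk>
      \<Longrightarrow> signed_act R e y (rack_power R x n) = signed_act R e y x"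
  by (induction n)
    (auto simp: rack_power_Suc signed_act_def act_square inv_act_square rack_power_closed)

lemma rack_power_signed_act:
  "\<lbrakk>y \<in> carrier R; x \<in> carrier R\<rbrakk>
    \<Longrightarrow> rack_power R (signed_act R e y x) n = signed_act R e (rack_power R y n) x"
proof (induction n)
  case (Suc n)
  then show ?case
    using signed_act_dist[of "rack_power R y n" "rack_power R y n" x e 1]
    by (simp add: rack_power_Suc rack_power_closed) (simp add: signed_act_def)
qed simp

text \<open>Equal squares give equal actions by \<open>act_square\<close>; hence \<open>y
  \<triangleright> x = y \<triangleright> y = x \<triangleright> x\<close>, and translation by
  \<open>x\<close> can be cancelled.\<close>

lemma inj_on_square: "inj_on (\<lambda>y. y \<triangleright> y) (carrier R)"
proof
  fix x y assume xy: "x \<in> carrier R" "y \<in> carrier R" "x \<triangleright> x = y \<triangleright> y"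
  then have "x \<triangleright> x = y \<triangleright> x" by (metis act_square)
  with xy show "x = y" by (metis act_cancel)
qed

end

section \<open>Finite racks: positivity of the rank and integer twists\<close>

locale finite_rack = rack R for R :: "('a, 'm) rack_scheme" (structure) +
  assumes finite_carrier: "finite (carrier R)"
begin

text \<open>In a finite carrier two powers of \<open>x\<close> coincide. Since every power map is
  injective, the initial segment can be cancelled, so the sequence of powers returns to
  \<open>x\<close> itself.\<close>

lemma elem_rank:
  assumes x: "x \<in> carrier R"
  shows "elem_rank R x > 0" and "rack_power R x (elem_rank R x) = x"
proof -
  have "\<not> inj (\<lambda>n. rack_power R x n)"
  proof
    assume "inj (\<lambda>n. rack_power R x n)"
    then have "infinite (range (\<lambda>n. rack_power R x n))" using finite_imageD infinite_UNIV_nat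
        by blast
    moreover have "range (\<lambda>n. rack_power R x n) \<subseteq> carrier R" using x
        by (auto simp: rack_power_closed)
    ultimately show False using finite_carrier finite_subset by blast
  qed
  then obtain m n where mn: "m < n" "rack_power R x m = rack_power R x n"
    unfolding inj_def by (metis linorder_neqE_nat)
  have inj: "inj_on (\<lambda>y. rack_power R y k) (carrier R)" for k
  proof (induction k)
    case (Suc k)
    have "inj_on ((\<lambda>y. y \<triangleright> y) \<circ> (\<lambda>y. rack_power R y k)) (carrier R)"
      using Suc inj_on_square rack_power_closed
      by (intro comp_inj_on) (auto intro: inj_on_subset)
    then show ?case by (simp add: rack_power_Suc o_def)
  qed (simp add: inj_on_def)
  have "rack_power R (rack_power R x (n - m)) m = rack_power R x m"
    using mn by (simp add: rack_power_add[symmetric])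
  then have "rack_power R x (n - m) = x"
    using inj[of m] x by (auto simp: inj_on_def rack_power_closed)
  then have ex: "\<exists>k>0. rack_power R x k = x" using mn(1) by (intro exI[of _ "n - m"]) auto
  then have "elem_rank R x = (LEAST k. k > 0 \<and> rack_power R x k = x)" by (auto simp: elem_rank_def)
  with LeastI_ex[OF ex] show "elem_rank R x > 0" "rack_power R x (elem_rank R x) = x" by auto
qed

lemma rack_rank_pos: "rack_rank R > 0"
proof -
  have "0 \<notin> elem_rank R ` carrier R" using elem_rank(1) by force
  then show ?thesis using finite_carrier by (simp add: rack_rank_def Lcm_0_iff flip: neq0_conv)
qed

lemma rack_power_rank:
  assumes "x \<in> carrier R"
  shows "rack_power R x (rack_rank R) = x"
proof -
  have "elem_rank R x dvd rack_rank R" using assms by (auto simp: rack_rank_def)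
  then have "rack_rank R mod elem_rank R x = 0" by auto
  then show ?thesis
    using funpow_mod_eq[where f = "\<lambda>y. y \<triangleright> y" and n = "elem_rank R x" and x = x
        and m = "rack_rank R"]
      elem_rank(2)[OF assms] by (simp add: rack_power_def)
qed

lemma rack_power_mod:
  "x \<in> carrier R \<Longrightarrow> rack_power R x (n mod rack_rank R) = rack_power R x n"
  using funpow_mod_eq[where f = "\<lambda>y. y \<triangleright> y" and n = "rack_rank R" and x = x
      and m = n]
    rack_power_rank by (simp add: rack_power_def)

lemma twist_of_nat: "x \<in> carrier R \<Longrightarrow> twist R (int n) x = rack_power R x n"
  by (simp add: twist_def nat_mod_distrib rack_power_mod)

lemma twist_closed: "x \<in> carrier R \<Longrightarrow> twist R k x \<in> carrier R"
  by (simp add: twist_def rack_power_closed)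

lemma twist_0: "x \<in> carrier R \<Longrightarrow> twist R 0 x = x"
  using twist_of_nat[of x 0] by simp

lemma twist_1: "x \<in> carrier R \<Longrightarrow> twist R 1 x = x \<triangleright> x"
  using twist_of_nat[of x 1] by (simp add: rack_power_def)

lemma twist_cong: "[k = l] (mod int (rack_rank R)) \<Longrightarrow> twist R k x = twist R l x"
  by (simp add: twist_def cong_def)

lemma twist_add:
  assumes "x \<in> carrier R"
  shows "twist R (k + l) x = twist R k (twist R l x)"
proof -
  let ?N = "int (rack_rank R)"
  have pos: "?N > 0" using rack_rank_pos by simp
  \<comment> \<open>Modulo the positive rank every integer is congruent to a natural number, which
    reduces additivity to that of iterates.\<close>
  obtain m n where mn: "[k = int m] (mod ?N)" "[l = int n] (mod ?N)"
    using pos by (metis cong_mod_right cong_refl nat_0_le pos_mod_sign)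
  have "twist R (k + l) x = twist R (int (m + n)) x"
    using mn by (intro twist_cong) (auto intro: cong_add)
  also have "\<dots> = rack_power R (rack_power R x n) m"
    unfolding twist_of_nat[OF assms] by (rule rack_power_add)
  also have "\<dots> = twist R k (twist R l x)"
    using assms by (simp add: twist_cong[OF mn(1)] twist_cong[OF mn(2)] twist_of_nat rack_power_closed)
  finally show ?thesis .
qed

lemma twist_cancel:
  assumes "x \<in> carrier R"
  shows "twist R (- k) (twist R k x) = x" "twist R k (twist R (- k) x) = x"
  using twist_add[OF assms, of "- k" k] twist_add[OF assms, of k "- k"] assms by (simp_all add: twist_0)

lemma signed_act_twist:
  "\<lbrakk>y \<in> carrier R; x \<in> carrier R\<rbrakk>
      \<Longrightarrow> signed_act R e y (twist R k x) = signed_act R e y x"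
  by (simp add: twist_def signed_act_rack_power)

lemma twist_signed_act:
  "\<lbrakk>y \<in> carrier R; x \<in> carrier R\<rbrakk>
      \<Longrightarrow> twist R k (signed_act R e y x) = signed_act R e (twist R k y) x"
  by (simp add: twist_def rack_power_signed_act)

lemma signed_act_self:
  assumes "y \<in> carrier R" "e = 1 \<or> e = - 1"
  shows "signed_act R e y y = twist R e y"
proof (cases "e = 1")
  case False
  \<comment> \<open>\<open>u\<close> is the root of \<open>y\<close> under squaring and acts as
    \<open>y\<close> does, so undoing the action of \<open>y\<close> on
    \<open>y = u \<triangleright> u\<close> returns \<open>u\<close>.\<close>
  define u where "u = twist R (- 1) y"
  have u: "u \<in> carrier R" "y = u \<triangleright> u"
    using assms(1) twist_cancel(2)[OF assms(1), of 1] twist_1[of u] by (auto simp: u_def twist_closed)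
  have "inv_act R y y = inv_act R y (u \<triangleright> u)" using u by simp
  also have "\<dots> = inv_act R y u" using inv_act_square u(1) assms(1) by blast
  also have "\<dots> = u" using u by (intro inv_act_eqI) (auto simp: act_closed)
  finally show ?thesis using False assms by (simp add: signed_act_def u_def)
qed (use assms in \<open>simp add: signed_act_def twist_1\<close>)

text \<open>This is the kink whose overcrossing comes after its undercrossing, so that the outgoing
  color \<open>z\<close> is also the acting one. Undoing the crossing expresses \<open>y\<close> as
  \<open>z\<close> acted on by itself with sign \<open>- e\<close>, which is a twist of
  \<open>z\<close>.\<close>

lemma signed_act_fixed:
  assumes "y \<in> carrier R" "z \<in> carrier R" "e = 1 \<or> e = - 1" "z = signed_act R e y z"
  shows "z = twist R e y"
proof -
  have "y = signed_act R (- e) z z"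
    using assms signed_act_cancel[of y z "- e" e] by auto
  also have "\<dots> = twist R (- e) z" using assms by (intro signed_act_self) auto
  finally show ?thesis using twist_cancel(2)[OF assms(2)] by simp
qed

end

section \<open>Homomorphisms from a presented rack\<close>

primrec term_eval :: "('a, 'm) rack_scheme \<Rightarrow> ('g \<Rightarrow> 'a) \<Rightarrow> 'g rack_term \<Rightarrow> 'a" where
  "term_eval R g (Gen a) = g a"
| "term_eval R g (Act s t) = act R (term_eval R g s) (term_eval R g t)"
| "term_eval R g (InvAct s t) = inv_act R (term_eval R g s) (term_eval R g t)"

lemma terms_over_simps [simp]:
  "Gen a \<in> terms_over G \<longleftrightarrow> a \<in> G"
  "Act s t \<in> terms_over G \<longleftrightarrow> s \<in> terms_over G \<and> t \<in> terms_over G"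
  "InvAct s t \<in> terms_over G \<longleftrightarrow> s \<in> terms_over G \<and> t \<in> terms_over G"
  by (auto simp: terms_over_def)

locale presentation =
  fixes G :: "'g set" and Rel :: "('g rack_term \<times> 'g rack_term) set"
  assumes relators: "Rel \<subseteq> terms_over G \<times> terms_over G"
begin

abbreviation P where "P \<equiv> presented_rack G Rel"
abbreviation cls where "cls t \<equiv> presented_cong G Rel `` {t}"

lemma presented_cong_terms:
  "(s, t) \<in> presented_cong G Rel \<Longrightarrow> s \<in> terms_over G \<and> t \<in> terms_over G"
  by (induction rule: presented_cong.induct) (use relators in auto)

lemma equiv_presented_cong: "equiv (terms_over G) (presented_cong G Rel)"
  by (rule equivI)
    (auto simp: refl_on_def sym_def trans_def dest: presented_cong_terms
      intro: presented_cong.refl presented_cong.sym presented_cong.trans)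

lemma cls_eq_iff:
  "\<lbrakk>s \<in> terms_over G; t \<in> terms_over G\<rbrakk> \<Longrightarrow> cls s = cls t
      \<longleftrightarrow> (s, t) \<in> presented_cong G Rel"
  using eq_equiv_class_iff[OF equiv_presented_cong] .

lemma carrier_P: "carrier P = cls ` terms_over G"
  by (auto simp: presented_rack_def quotient_def)

lemma act_cls:
  assumes "s \<in> terms_over G" "t \<in> terms_over G"
  shows "act P (cls s) (cls t) = cls (Act s t)"
proof -
  have "cls (Act s' t') = cls (Act s t)" if "s' \<in> cls s" "t' \<in> cls t" for s' t'
  proof -
    have "(s', s) \<in> presented_cong G Rel" "(t', t) \<in> presented_cong G Rel"
      using that by (auto intro: presented_cong.sym)
    then have "(Act s' t', Act s t) \<in> presented_cong G Rel" by (rule presented_cong.act)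
    then show ?thesis using cls_eq_iff presented_cong_terms by blast
  qed
  then have "act P (cls s) (cls t) = (\<Union>s'\<in>cls s. \<Union>t'\<in>cls t. cls (Act s t))"
    unfolding presented_rack_def rack.simps by (intro SUP_cong) simp_all
  moreover have "s \<in> cls s" "t \<in> cls t" using assms by (auto intro: presented_cong.refl)
  ultimately show ?thesis by (metis SUP_const empty_iff)
qed

text \<open>\<open>inv_act\<close> is the set-theoretic inverse of a translation, so injectivity of
  the translation on classes has to be shown; it follows by applying \<open>InvAct\<close> with
  \<open>t\<close> to both sides inside the congruence.\<close>

lemma inv_act_cls:
  assumes "s \<in> terms_over G" "t \<in> terms_over G"
  shows "inv_act P (cls s) (cls t) = cls (InvAct s t)"
  unfolding inv_act_def
proof (rule the_inv_into_f_eq)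
  show "inj_on (\<lambda>z. act P z (cls t)) (carrier P)"
  proof (rule inj_onI)
    fix A B assume "A \<in> carrier P" "B \<in> carrier P" and eq: "act P A (cls t) = act P B (cls t)"
    then obtain a b where ab: "a \<in> terms_over G" "b \<in> terms_over G" "A = cls a" "B = cls b"
      unfolding carrier_P by auto
    then have "(Act a t, Act b t) \<in> presented_cong G Rel"
      using eq assms by (simp add: act_cls cls_eq_iff)
    then have "(InvAct (Act a t) t, InvAct (Act b t) t) \<in> presented_cong G Rel"
      using assms by (intro presented_cong.inv_act presented_cong.refl)
    then have "(a, b) \<in> presented_cong G Rel"
      by (rule presented_cong.trans[OF presented_cong.sym[OF presented_cong.inv_act_act[OF ab(1) assms(2)]]
            presented_cong.trans[OF _ presented_cong.inv_act_act[OF ab(2) assms(2)]]])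
    then show "A = B" using ab by (simp add: cls_eq_iff)
  qed
  show "act P (cls (InvAct s t)) (cls t) = cls s"
    using assms by (simp add: act_cls cls_eq_iff presented_cong.act_inv_act)
  show "cls (InvAct s t) \<in> carrier P" using assms unfolding carrier_P by (intro imageI) simp
qed

text \<open>The universal property of a presentation: a homomorphism is evaluation of terms at the
  images of the generators, and evaluation descends to the quotient exactly when the relators are
  satisfied.\<close>

lemma bij_betw_rack_hom:
  assumes "rack R"
  shows "bij_betw (\<lambda>h. \<lambda>a\<in>G. h (cls (Gen a))) (rack_hom P R)
    {g \<in> G \<rightarrow>\<^sub>E carrier R. \<forall>(s, t)\<in>Rel. term_eval R g s = term_eval R g t}"
    (is "bij_betw ?F _ ?S")
proof -
  interpret rack R by fact
  have eval: "h (cls t) = term_eval R (?F h) t" if h: "h \<in> rack_hom P R" and "t \<in> terms_over G"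
      for h t
    using that(2)
  proof (induction t)
    case (Act s t)
    then have "h (act P (cls s) (cls t)) = act R (h (cls s)) (h (cls t))"
      using h unfolding rack_hom_def carrier_P by fastforce
    with Act show ?case by (simp add: act_cls)
  next
    case (InvAct s t)
    then have "h (inv_act P (cls s) (cls t)) = inv_act R (h (cls s)) (h (cls t))"
      using h unfolding rack_hom_def carrier_P by fastforce
    with InvAct show ?case by (simp add: inv_act_cls)
  qed simp
  have "inj_on ?F (rack_hom P R)"
  proof
    fix h h' assume h: "h \<in> rack_hom P R" "h' \<in> rack_hom P R" and eq: "?F h = ?F h'"
    have "h A = h' A" if "A \<in> carrier P" for A
      using that eval[OF h(1)] eval[OF h(2)] eq unfolding carrier_P by fastforce
    moreover have "h \<in> carrier P \<rightarrow>\<^sub>E carrier R"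
        "h' \<in> carrier P \<rightarrow>\<^sub>E carrier R"
      using h by (simp_all add: rack_hom_def)
    ultimately show "h = h'" by (metis PiE_ext)
  qed
  moreover have "?F ` rack_hom P R = ?S"
  proof (intro equalityI subsetI)
    fix g assume "g \<in> ?F ` rack_hom P R"
    then obtain h where h: "h \<in> rack_hom P R" "g = ?F h" by auto
    have "term_eval R g s = term_eval R g t" if "(s, t) \<in> Rel" for s t
    proof -
      have st: "s \<in> terms_over G" "t \<in> terms_over G" using that relators by auto
      have "cls s = cls t" using that st by (simp add: cls_eq_iff presented_cong.rel)
      then show ?thesis using eval[OF h(1) st(1)] eval[OF h(1) st(2)] h(2) by simp
    qed
    moreover have "g \<in> G \<rightarrow>\<^sub>E carrier R" using h by (auto simp: rack_hom_def carrier_P)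
    ultimately show "g \<in> ?S" by auto
  next
    fix g assume g: "g \<in> ?S"
    have closed: "term_eval R g t \<in> carrier R" if "t \<in> terms_over G" for t
      using that by (induction t) (use g in \<open>auto simp: act_closed inv_act_closed\<close>)
    \<comment> \<open>Each rule of the congruence is a relator, which \<open>g\<close> satisfies, or
      a closure rule or identity that holds in every rack.\<close>
    have cong: "term_eval R g s = term_eval R g t" if "(s, t) \<in> presented_cong G Rel" for s t
      using that
      by (induction rule: presented_cong.induct)
        (use g in \<open>auto simp: closed inv_act_act act_inv_act act_dist dest: presented_cong_terms\<close>)
    define h where "h = (\<lambda>A\<in>carrier P. term_eval R g (SOME t. t \<in> A))"
    have h: "h (cls t) = term_eval R g t" if t: "t \<in> terms_over G" for t
    proof -
      have "t \<in> cls t" using t by (auto intro: presented_cong.refl)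
      then have "(SOME t'. t' \<in> cls t) \<in> cls t" by (rule someI)
      then show ?thesis using t cong[of t] by (auto simp: h_def carrier_P)
    qed
    have "h \<in> rack_hom P R"
      unfolding rack_hom_def
      by (auto simp: carrier_P h act_cls inv_act_cls closed) (simp add: h_def carrier_P)
    moreover have "?F h = g" using g h by (auto simp: fun_eq_iff PiE_def extensional_def)
    ultimately show "g \<in> ?F ` rack_hom P R" by blast
  qed
  ultimately show ?thesis by (simp add: bij_betw_def)
qed

end

section \<open>Twisted colorings\<close>

text \<open>Induction along a real interval, suited to step functions: a point decides the germ on
  its right, and a germ on the left decides its end point. The infimum of the failures would satisfy
  \<open>P\<close> by \<open>left\<close>, and then so would the points just beyond it by
  \<open>right\<close>.\<close>

lemma real_interval_induct:
  fixes s t :: real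
  assumes "P s" "s \<le> t"
    and right: "\<And>u. \<lbrakk>s \<le> u; u < t; P u\<rbrakk>
        \<Longrightarrow> eventually P (at_right u)"
    and left: "\<And>u. \<lbrakk>s < u; u \<le> t; eventually P (at_left u)\<rbrakk> \<Longrightarrow> P u"
  shows "P t"
proof (rule ccontr)
  assume "\<not> P t"
  define B where "B = {u \<in> {s..t}. \<not> P u}"
  define c where "c = Inf B"
  have B: "t \<in> B" "bdd_below B" using \<open>\<not> P t\<close> assms(2) by (auto simp: B_def)
  have c: "s \<le> c" "c \<le> t" using B by (auto simp: c_def B_def intro: cInf_lower cInf_greatest)
  have less: "P u" if "s \<le> u" "u < c" for u
    using that c cInf_lower[OF _ B(2), of u] by (force simp: B_def c_def)
  have "P c"
  proof (cases "c = s")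
    case False
    then have "eventually P (at_left c)" using c less by (intro eventually_at_leftI[of s]) auto
    then show ?thesis using False c by (intro left) auto
  qed (use assms in simp)
  then have "c < t" using c \<open>\<not> P t\<close> by (cases "c = t") auto
  then obtain d where d: "d > c" "\<And>u. \<lbrakk>c < u; u < d\<rbrakk> \<Longrightarrow> P u"
    using right[OF c(1) _ \<open>P c\<close>] unfolding eventually_at_right_field by auto
  have "d \<le> c" unfolding c_def
  proof (rule cInf_greatest)
    fix u assume "u \<in> B"
    then have "s \<le> u" "\<not> P u" by (auto simp: B_def)
    then show "d \<le> u" using less d(2) \<open>P c\<close> by (metis linorder_neqE_linordered_idom not_le)
  qed (use B in auto)
  then show False using d(1) by simp
qed

text \<open>This is \<open>params D\<close> as a function of the number of components alone, so that
  colorings depend only on a set of crossings with signs and not on curves.\<close>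

definition base :: "nat \<Rightarrow> param set" where
  "base n = {..<n} \<times> {0..<1}"

text \<open>
  A twisted coloring is kept on the parameters; \<open>lift\<close> extends it to the universal covers of the
  components, passing once around component \<open>i\<close> applying \<open>k i\<close> times the operation \<open>x \<mapsto> x \<triangleright> x\<close>.
\<close>

definition lift :: "('a, 'm) rack_scheme \<Rightarrow> (nat \<Rightarrow> int) \<Rightarrow> (param \<Rightarrow> 'a) \<Rightarrow> nat \<Rightarrow> real \<Rightarrow> 'a" where
  "lift R k g i t = twist R (k i * \<lfloor>t\<rfloor>) (g (i, frac t))"

text \<open>Right continuity fixes the convention that the value at an undercrossing is the color of
  the outgoing arc.\<close>

definition right_ok :: "(nat \<Rightarrow> real \<Rightarrow> 'a) \<Rightarrow> nat \<Rightarrow> real \<Rightarrow> bool" where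
  "right_ok f i t \<longleftrightarrow> (\<forall>\<^sub>F s in at_right t. f i s = f i t)"

text \<open>The crossings are looked up at \<open>frac t\<close>, so the condition makes sense on
  the whole real line. The overcrossing \<open>p\<close> is taken in the base period; any other lift
  would differ by a twist, which acts in the same way.\<close>

definition left_ok ::
    "('a, 'm) rack_scheme \<Rightarrow> (param \<times> param) set \<Rightarrow> (param \<times> param \<Rightarrow> int) \<Rightarrow> (nat \<Rightarrow> real \<Rightarrow> 'a)
      \<Rightarrow> nat \<Rightarrow> real \<Rightarrow> bool" where
  "left_ok R X sg f i t \<longleftrightarrow>
     ((i, frac t) \<notin> snd ` X \<longrightarrow>
         (\<forall>\<^sub>F s in at_left t. f i t = f i s)) \<and>
     (\<forall>p. (p, (i, frac t)) \<in> X \<longrightarrow>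
       (\<forall>\<^sub>F s in at_left t. f i t = signed_act R (sg (p, (i, frac t))) (f i s) (f (fst p)
           (snd p))))"

text \<open>One period of conditions suffices, and \<open>k\<close> enters at \<open>t = 0\<close>,
  where the left germ lies in the previous period. Extensionality makes the set countable by
  \<open>card\<close>.\<close>

definition colorings ::
    "('a, 'm) rack_scheme \<Rightarrow> nat \<Rightarrow> (param \<times> param) set \<Rightarrow> (param \<times> param \<Rightarrow> int) \<Rightarrow> (nat \<Rightarrow> int)
      \<Rightarrow> (param \<Rightarrow> 'a) set" where
  "colorings R n X sg k = {g \<in> base n \<rightarrow>\<^sub>E carrier R.
     \<forall>i<n. \<forall>t\<in>{0..<1}. right_ok (lift R k g) i t \<and> left_ok R X sg
         (lift R k g) i t}"

lemma left_ok_const: "\<lbrakk>left_ok R X sg f i t; (i, frac t) \<notin> snd ` X\<rbrakk>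
    \<Longrightarrow> \<forall>\<^sub>F s in at_left t. f i t = f i s"
  by (simp add: left_ok_def)

lemma left_ok_jump:
  "\<lbrakk>left_ok R X sg f i t; (p, (i, frac t)) \<in> X\<rbrakk>
    \<Longrightarrow> \<forall>\<^sub>F s in at_left t. f i t = signed_act R (sg (p, (i, frac t)))
        (f i s) (f (fst p) (snd p))"
  unfolding left_ok_def by blast

lemma frac_id: "0 \<le> t \<Longrightarrow> t < 1 \<Longrightarrow> frac (t::real) = t"
  by (simp add: frac_eq)

lemma floor_id: "0 \<le> t \<Longrightarrow> t < 1 \<Longrightarrow> \<lfloor>t::real\<rfloor> = 0"
  by (simp add: floor_eq_iff)

lemma frac_add_of_int: "frac (t + of_int m) = frac (t::real)"
  by (simp add: frac_def)

lemma eventually_at_left_shift: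
  "eventually P (at_left ((t::real) + d))
      \<longleftrightarrow> (\<forall>\<^sub>F s in at_left t. P (s + d))"
  using filtermap_at_left_shift[of "- d" t] eventually_filtermap[of P "\<lambda>x. x + d" "at_left t"]
      by simp

lemma eventually_at_right_shift:
  "eventually P (at_right ((t::real) + d))
      \<longleftrightarrow> (\<forall>\<^sub>F s in at_right t. P (s + d))"
  using filtermap_at_right_shift[of "- d" t] eventually_filtermap[of P "\<lambda>x. x + d" "at_right t"]
      by simp

context finite_rack
begin

lemma lift_base: "\<lbrakk>g (i, t) \<in> carrier R; 0 \<le> t; t < 1\<rbrakk>
    \<Longrightarrow> lift R k g i t = g (i, t)"
  by (simp add: lift_def frac_id floor_id twist_0)

lemma lift_closed: "\<lbrakk>g \<in> base n \<rightarrow> carrier R; i < n\<rbrakk>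
    \<Longrightarrow> lift R k g i t \<in> carrier R"
  unfolding lift_def by (intro twist_closed) (auto simp: base_def frac_lt_1)

lemma lift_add_of_int:
  assumes "g \<in> base n \<rightarrow> carrier R" "i < n"
  shows "lift R k g i (t + of_int m) = twist R (k i * m) (lift R k g i t)"
proof -
  have "g (i, frac t) \<in> carrier R" using assms by (auto simp: base_def frac_lt_1)
  then show ?thesis
    by (simp add: lift_def frac_add_of_int algebra_simps flip: twist_add)
qed

lemma colorings_PiE: "g \<in> colorings R n X sg k
    \<Longrightarrow> g \<in> base n \<rightarrow>\<^sub>E carrier R"
  by (simp add: colorings_def)

lemma colorings_Pi: "g \<in> colorings R n X sg k \<Longrightarrow> g \<in> base n \<rightarrow> carrier R"
  by (auto simp: colorings_def)

lemma colorings_closed: "\<lbrakk>g \<in> colorings R n X sg k; p \<in> base n\<rbrakk>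
    \<Longrightarrow> g p \<in> carrier R"
  by (auto simp: colorings_def)

lemma lift_coloring:
  "\<lbrakk>g \<in> base n \<rightarrow> carrier R; i < n; 0 \<le> t; t < 1\<rbrakk>
      \<Longrightarrow> lift R k g i t = g (i, t)"
  by (rule lift_base) (auto simp: base_def)

lemma lift_point: "\<lbrakk>g \<in> base n \<rightarrow> carrier R; p \<in> base n\<rbrakk>
    \<Longrightarrow> lift R k g (fst p) (snd p) = g p"
  using lift_coloring[of g n "fst p" "snd p" k] by (auto simp: base_def)

text \<open>A shift by \<open>m\<close> periods applies the same twist to both sides of each
  condition; twists are injective, commute with the action of overstrands, and do not affect what
  the overstrand does.\<close>

lemma ok_shift:
  assumes g: "g \<in> base n \<rightarrow> carrier R" and "i < n" and X:
      "X \<subseteq> base n \<times> base n"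
  shows "right_ok (lift R k g) i (t + of_int m) \<longleftrightarrow> right_ok (lift R k g) i t"
    and "left_ok R X sg (lift R k g) i (t + of_int m) \<longleftrightarrow> left_ok R X sg (lift R k g) i t"
proof -
  have eq: "twist R l x = twist R l y \<longleftrightarrow> x = y" if "x \<in> carrier R"
      "y \<in> carrier R" for l x y
    using that by (metis twist_cancel(1))
  note closed = lift_closed[OF g \<open>i < n\<close>]
  show "right_ok (lift R k g) i (t + of_int m) \<longleftrightarrow> right_ok (lift R k g) i t"
    by (simp add: right_ok_def eventually_at_right_shift lift_add_of_int[OF g \<open>i < n\<close>] eq closed)
  have "lift R k g (fst p) (snd p) \<in> carrier R" if "(p, q) \<in> X" for p q
    using that X lift_closed[OF g] by (auto simp: base_def)
  then show "left_ok R X sg (lift R k g) i (t + of_int m)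
      \<longleftrightarrow> left_ok R X sg (lift R k g) i t"
    by (auto simp: left_ok_def eventually_at_left_shift lift_add_of_int[OF g \<open>i < n\<close>] eq closed
        frac_add_of_int signed_act_closed simp flip: twist_signed_act)
qed

lemma colorings_ok:
  assumes "g \<in> colorings R n X sg k" "i < n" "X \<subseteq> base n \<times> base n"
  shows "right_ok (lift R k g) i t" "left_ok R X sg (lift R k g) i t"
proof -
  have "frac t \<in> {0..<1}" by (auto simp: frac_lt_1)
  then have "right_ok (lift R k g) i (frac t)" "left_ok R X sg (lift R k g) i (frac t)"
    using assms by (auto simp: colorings_def)
  moreover have "t = frac t + of_int \<lfloor>t\<rfloor>" by (simp add: frac_def)
  ultimately show "right_ok (lift R k g) i t" "left_ok R X sg (lift R k g) i t"
    using ok_shift[OF colorings_Pi[OF assms(1)] assms(2,3)] by metis+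
qed

lemma coloring_const:
  assumes g: "g \<in> colorings R n X sg k" "i < n" "X \<subseteq> base n \<times> base n"
    and "s \<le> t" "\<And>u. \<lbrakk>s < u; u \<le> t\<rbrakk>
        \<Longrightarrow> (i, frac u) \<notin> snd ` X"
  shows "lift R k g i t = lift R k g i s"
proof (rule real_interval_induct[where P = "\<lambda>u. lift R k g i u = lift R k g i s"])
  show "\<forall>\<^sub>F v in at_right u. lift R k g i v = lift R k g i s" if
      "lift R k g i u = lift R k g i s" for u
    using colorings_ok(1)[OF g, of u] that by (simp add: right_ok_def)
  show "lift R k g i u = lift R k g i s"
    if "s < u" "u \<le> t" "\<forall>\<^sub>F v in at_left u. lift R k g i v = lift R k g i s" for u
  proof -
    have "\<forall>\<^sub>F v in at_left u. lift R k g i u = lift R k g i v"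
      using left_ok_const[OF colorings_ok(2)[OF g]] assms(5)[OF that(1,2)] by simp
    with that(3) have "\<forall>\<^sub>F v in at_left u. lift R k g i u = lift R k g i s"
        by eventually_elim simp
    then show ?thesis by simp
  qed
qed (use assms in auto)

lemma coloring_jump:
  assumes g: "g \<in> colorings R n X sg k" "i < n" "X \<subseteq> base n \<times> base n"
    and "s < t" "\<And>u. \<lbrakk>s < u; u < t\<rbrakk> \<Longrightarrow> (i, frac u) \<notin> snd ` X"
    and pq: "(p, (i, frac t)) \<in> X"
  shows "lift R k g i t = signed_act R (sg (p, (i, frac t))) (lift R k g i s) (g p)"
proof -
  have "p \<in> base n" using pq g(3) by auto
  then have p: "lift R k g (fst p) (snd p) = g p" using lift_point[OF colorings_Pi[OF g(1)]] by simp
  have "\<forall>\<^sub>F v in at_left t. lift R k g i t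
      = signed_act R (sg (p, (i, frac t))) (lift R k g i v) (lift R k g (fst p) (snd p))"
    by (rule left_ok_jump[OF colorings_ok(2)[OF g] pq])
  moreover have "\<forall>\<^sub>F v in at_left t. lift R k g i v = lift R k g i s"
    using assms(4,5) by (intro eventually_at_leftI[of s] coloring_const[OF g]) auto
  ultimately have "\<forall>\<^sub>F v in at_left t. lift R k g i t
      = signed_act R (sg (p, (i, frac t))) (lift R k g i s) (g p)" by eventually_elim (simp add: p)
  then show ?thesis by simp
qed

text \<open>Colors propagate forward: at each undercrossing the outgoing color is a function of the
  incoming color and the color above. Real induction turns this into uniqueness.\<close>

lemma coloring_unique:
  assumes g: "g \<in> colorings R n X sg k" and h: "h \<in> colorings R n X sg k"
    and i: "i < n" and X: "X \<subseteq> base n \<times> base n"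
    and "s \<le> t" "lift R k g i s = lift R k h i s"
    and over: "\<And>u p. \<lbrakk>s < u; u \<le> t; (p, (i, frac u)) \<in> X\<rbrakk>
        \<Longrightarrow> g p = h p"
  shows "lift R k g i t = lift R k h i t"
proof (rule real_interval_induct[where P = "\<lambda>u. lift R k g i u = lift R k h i u" and s = s
    and t = t])
  show "\<forall>\<^sub>F v in at_right u. lift R k g i v = lift R k h i v" if
      "lift R k g i u = lift R k h i u" for u
  proof -
    have "\<forall>\<^sub>F v in at_right u. lift R k g i v = lift R k g i u"
        "\<forall>\<^sub>F v in at_right u. lift R k h i v = lift R k h i u"
      using colorings_ok(1)[OF g i X] colorings_ok(1)[OF h i X] by (auto simp: right_ok_def)
    then show ?thesis by eventually_elim (use that in simp)
  qed
  show "lift R k g i u = lift R k h i u"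
    if u: "s < u" "u \<le> t" and ev: "\<forall>\<^sub>F v in at_left u. lift R k g i v
        = lift R k h i v" for u
  proof (cases "(i, frac u) \<in> snd ` X")
    case True
    then obtain p where p: "(p, (i, frac u)) \<in> X" by auto
    then have "p \<in> base n" using X by auto
    then have eq: "lift R k g (fst p) (snd p) = lift R k h (fst p) (snd p)"
      using lift_point[OF colorings_Pi[OF g]] lift_point[OF colorings_Pi[OF h]] over[OF u p] by simp
    have "\<forall>\<^sub>F v in at_left u. lift R k g i u
        = signed_act R (sg (p, (i, frac u))) (lift R k g i v) (lift R k g (fst p) (snd p))"
      "\<forall>\<^sub>F v in at_left u. lift R k h i u
        = signed_act R (sg (p, (i, frac u))) (lift R k h i v) (lift R k h (fst p) (snd p))"
      using left_ok_jump[OF colorings_ok(2)[OF g i X] p] left_ok_jump[OF colorings_ok(2)[OF h i X] p]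
      by simp_all
    with ev have "\<forall>\<^sub>F v in at_left u. lift R k g i u = lift R k h i u"
      by eventually_elim (simp add: eq)
    then show ?thesis by simp
  next
    case False
    then have "\<forall>\<^sub>F v in at_left u. lift R k g i u = lift R k g i v"
        "\<forall>\<^sub>F v in at_left u. lift R k h i u = lift R k h i v"
      using left_ok_const[OF colorings_ok(2)[OF g i X]] left_ok_const[OF colorings_ok(2)[OF h i X]]
      by simp_all
    with ev have "\<forall>\<^sub>F v in at_left u. lift R k g i u = lift R k h i u" by eventually_elim simp
    then show ?thesis by simp
  qed
qed (use assms in auto)

text \<open>The lift uses only twists by multiples of \<open>k i\<close>, and a twist depends on its
  exponent modulo the rank. Through this lemma the congruence of the writhe vectors enters.\<close>

lemma colorings_cong:
  assumes "\<And>x. x \<in> X \<Longrightarrow> sg x = sg' x"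
      "\<And>i. i < n \<Longrightarrow> [k i = k' i] (mod int (rack_rank R))"
    and X: "X \<subseteq> base n \<times> base n"
  shows "colorings R n X sg k = colorings R n X sg' k'"
proof -
  have lift: "lift R k g i = lift R k' g i" if "i < n" for g i
  proof
    fix t :: real
    have "[k i * \<lfloor>t\<rfloor> = k' i * \<lfloor>t\<rfloor>] (mod int (rack_rank R))"
      using assms(2)[OF that] by (rule cong_scalar_right)
    then show "lift R k g i t = lift R k' g i t" unfolding lift_def by (rule twist_cong)
  qed
  have over: "lift R k g (fst p) = lift R k' g (fst p)" if "(p, q) \<in> X" for g p q
    using that X by (intro lift) (auto simp: base_def)
  have "right_ok (lift R k g) i t \<and> left_ok R X sg (lift R k g) i t \<longleftrightarrow>
      right_ok (lift R k' g) i t \<and> left_ok R X sg' (lift R k' g) i t" if "i < n" for g i and t :: real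
    unfolding right_ok_def left_ok_def lift[OF that] using assms(1) over by (auto cong: conj_cong)
  then show ?thesis unfolding colorings_def by auto
qed

end

section \<open>Replacing the part of a diagram inside a disc\<close>

lemma eventually_at_left_avoid:
  assumes t: "(i, t) \<in> base n" and s: "0 < a" "a < b" "b < 1" and out:
      "\<not> (i = j \<and> a < t \<and> t \<le> b)"
  shows "\<forall>\<^sub>F u in at_left t. (i, frac u) \<notin> open_strand (j, a, b)"
proof (cases "i = j")
  case True
  have t: "0 \<le> t" "t < 1" using t by (auto simp: base_def)
  consider "t = 0" | "0 < t" "t \<le> a" | "b < t" using out True t by force
  then show ?thesis
  proof cases
    case 1
    \<comment> \<open>To the left of 0 the parameter wraps round to \<open>u + 1\<close>, which lies
      beyond \<open>b\<close> once \<open>u > b - 1\<close>.\<close>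
    have "(i, frac u) \<notin> open_strand (j, a, b)" if "u \<in> {max (-1) (b - 1)<..<0}" for u
    proof -
      have "\<lfloor>u\<rfloor> = - 1" using that by (auto simp: floor_eq_iff)
      then show ?thesis using that by (simp add: frac_def)
    qed
    then show ?thesis using s 1 by (intro eventually_at_leftI[of "max (-1) (b - 1)"]) auto
  next
    case 2
    then show ?thesis using t by (intro eventually_at_leftI[of 0]) (auto simp: frac_id)
  next
    case 3
    then show ?thesis using t by (intro eventually_at_leftI[of "max b 0"])
        (use s in \<open>auto simp: frac_id\<close>)
  qed
qed simp

lemma eventually_at_right_avoid:
  assumes t: "(i, t) \<in> base n" and out: "\<not> (i = j \<and> a \<le> t \<and> t < b)"
  shows "\<forall>\<^sub>F u in at_right t. (i, frac u) \<notin> open_strand (j, a, b)"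
proof (cases "i = j")
  case True
  have t: "0 \<le> t" "t < 1" using t by (auto simp: base_def)
  consider "t < a" | "b \<le> t" using out True by force
  then show ?thesis
  proof cases
    case 1
    then show ?thesis using t by (intro eventually_at_rightI[of _ "min a 1"]) (auto simp: frac_id)
  next
    case 2
    then show ?thesis using t by (intro eventually_at_rightI[of _ 1]) (auto simp: frac_id)
  qed
qed simp

text \<open>The half-open intervals select the germs that lie in the strand: the right germ at
  \<open>a\<close> and the left germ at \<open>b\<close> belong to it, whereas the other two germs
  at the ends belong to the outside.\<close>

definition strand_ok ::
    "('a, 'm) rack_scheme \<Rightarrow> (param \<times> param) set \<Rightarrow> (param \<times> param \<Rightarrow> int) \<Rightarrow> (nat \<Rightarrow> real \<Rightarrow> 'a)
      \<Rightarrow> strand \<Rightarrow> bool" where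
  "strand_ok R X sg f s \<longleftrightarrow> (case s of (j, a, b) \<Rightarrow>
     (\<forall>t\<in>{a..<b}. right_ok f j t) \<and> (\<forall>t\<in>{a<..b}. left_ok R X sg f j t))"

text \<open>
  The crossings \<open>Y\<close> lie outside the disc and \<open>S\<close> consists of the strands inside it. A filling
  adds crossings between points of the strands.
\<close>

locale tangle = finite_rack R for R :: "('a, 'm) rack_scheme" (structure) +
  fixes n :: nat and k :: "nat \<Rightarrow> int" and S :: "strand set"
    and Y :: "(param \<times> param) set" and sgY :: "param \<times> param \<Rightarrow> int"
  assumes finite_S: "finite S"
    and strands: "(j, a, b) \<in> S \<Longrightarrow> j < n \<and> 0 < a \<and> a < b \<and> b < 1"
    and disjoint: "\<lbrakk>s \<in> S; s' \<in> S; s \<noteq> s'\<rbrakk>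
        \<Longrightarrow> closed_strand s \<inter> closed_strand s' = {}"
    and Y_base: "Y \<subseteq> base n \<times> base n"
    and Y_out: "\<lbrakk>(p, q) \<in> Y; s \<in> S\<rbrakk> \<Longrightarrow> p \<notin> closed_strand s
        \<and> q \<notin> closed_strand s"
begin

definition inside :: "param set" where
  "inside = \<Union> (open_strand ` S)"

definition filling :: "(param \<times> param) set \<Rightarrow> (param \<times> param \<Rightarrow> int) \<Rightarrow> bool" where
  "filling I sg \<longleftrightarrow> I \<subseteq> inside \<times> inside
      \<and> (\<forall>x\<in>Y. sg x = sgY x)"

lemma open_subset_closed: "open_strand s \<subseteq> closed_strand s"
  by (cases s) auto

lemma inside_base: "inside \<subseteq> base n"
proof
  fix p assume "p \<in> inside"
  then obtain j a b where s: "(j, a, b) \<in> S" "p \<in> open_strand (j, a, b)" by (auto simp: inside_def)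
  then show "p \<in> base n" using strands[OF s(1)] by (auto simp: base_def)
qed

lemma filling_base: "filling I sg \<Longrightarrow> Y \<union> I \<subseteq> base n \<times> base n"
  using Y_base inside_base by (auto simp: filling_def)

lemma Y_not_inside: "(p, q) \<in> Y \<Longrightarrow> p \<notin> inside \<and> q \<notin> inside"
  unfolding inside_def using Y_out open_subset_closed by blast

lemma strand_end:
  assumes "s \<in> S" "p \<in> closed_strand s" "p \<notin> open_strand s"
  shows "p \<notin> inside"
proof
  assume "p \<in> inside"
  then obtain s' where s': "s' \<in> S" "p \<in> open_strand s'" by (auto simp: inside_def)
  then have "p \<in> closed_strand s'" using open_subset_closed by blast
  moreover have "s \<noteq> s'" using s' assms(3) by auto
  ultimately show False using disjoint[OF assms(1) s'(1)] assms(2) by blast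
qed

lemma strand_under:
  assumes "filling I sg" "(j, a, b) \<in> S" "a \<le> t" "t \<le> b"
  shows "(p, (j, t)) \<in> Y \<union> I \<longleftrightarrow> (p, (j, t)) \<in> I"
  using Y_out[OF _ assms(2), of p "(j, t)"] assms by auto

lemma strand_end_under:
  assumes "filling I sg" "(j, a, b) \<in> S" "t = a \<or> t = b"
  shows "(j, t) \<notin> snd ` (Y \<union> I)"
proof -
  have "(j, t) \<notin> inside" using assms(2,3) strands[OF assms(2)]
      by (intro strand_end[OF assms(2)]) auto
  then have "(p, (j, t)) \<notin> I" for p using assms(1) by (auto simp: filling_def)
  moreover have "(p, (j, t)) \<in> Y \<union> I \<longleftrightarrow> (p, (j, t)) \<in> I" for p
    using assms strands[OF assms(2)] by (intro strand_under) auto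
  ultimately show ?thesis by force
qed

text \<open>Gluing: a germ either lies in a strand, where \<open>ok\<close> applies, or avoids the
  finitely many strands. In the second case \<open>h\<close> and \<open>g\<close> have the same
  germ, and the crossings of \<open>Y\<close> have both points outside and the same sign in both
  fillings, so the conditions are inherited from \<open>g\<close>.\<close>

lemma filling_coloring:
  assumes I: "filling I sg" and I': "filling I' sg'"
    and g: "g \<in> colorings R n (Y \<union> I) sg k"
    and h: "h \<in> base n \<rightarrow>\<^sub>E carrier R" and out:
        "\<And>p. p \<in> base n \<Longrightarrow> p \<notin> inside \<Longrightarrow> h p = g p"
    and ok: "\<And>s. s \<in> S \<Longrightarrow> strand_ok R (Y \<union> I') sg' (lift R k h) s"
  shows "h \<in> colorings R n (Y \<union> I') sg' k"
  unfolding colorings_def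
proof (intro CollectI conjI h allI impI ballI)
  note X = filling_base[OF I] and X' = filling_base[OF I']
  have hPi: "h \<in> base n \<rightarrow> carrier R" using h by auto
  have lift_eq: "lift R k h i t = lift R k g i t" if "i < n" "(i, frac t) \<notin> inside" for i t
    using out[of "(i, frac t)"] that by (simp add: lift_def base_def frac_lt_1)
  fix i and t :: real
  assume i: "i < n" and t: "t \<in> {0..<1}"
  have b: "(i, t) \<in> base n" using i t by (simp add: base_def)
  show "right_ok (lift R k h) i t"
  proof (cases "\<exists>a b. (i, a, b) \<in> S \<and> a \<le> t \<and> t < b")
    case True
    then show ?thesis using ok by (fastforce simp: strand_ok_def)
  next
    case False
    then have "\<forall>s\<in>S. \<forall>\<^sub>F u in at_right t. (i, frac u) \<notin> open_strand s"
      using eventually_at_right_avoid[OF b] by fastforce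
    then have "\<forall>\<^sub>F u in at_right t. (i, frac u) \<notin> inside"
      unfolding inside_def using finite_S by (simp add: eventually_ball_finite)
    then have ev: "\<forall>\<^sub>F u in at_right t. lift R k h i u = lift R k g i u"
      by eventually_elim (simp add: lift_eq i)
    have "(i, t) \<notin> inside"
    proof
      assume "(i, t) \<in> inside"
      then obtain a b where "(i, a, b) \<in> S" "a < t" "t < b" by (auto simp: inside_def)
      with False show False by (meson less_imp_le)
    qed
    then have eq: "lift R k h i t = lift R k g i t" using t by (simp add: lift_eq i frac_id)
    have "\<forall>\<^sub>F u in at_right t. lift R k g i u = lift R k g i t"
      using colorings_ok(1)[OF g i X] by (simp add: right_ok_def)
    with ev show ?thesis unfolding right_ok_def eq by eventually_elim simp
  qed
  show "left_ok R (Y \<union> I') sg' (lift R k h) i t"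
  proof (cases "\<exists>a b. (i, a, b) \<in> S \<and> a < t \<and> t \<le> b")
    case True
    then show ?thesis using ok by (fastforce simp: strand_ok_def)
  next
    case False
    then have "\<forall>s\<in>S. \<forall>\<^sub>F u in at_left t. (i, frac u) \<notin> open_strand s"
      using eventually_at_left_avoid[OF b] strands by fastforce
    then have "\<forall>\<^sub>F u in at_left t. (i, frac u) \<notin> inside"
      unfolding inside_def using finite_S by (simp add: eventually_ball_finite)
    then have ev: "\<forall>\<^sub>F u in at_left t. lift R k h i u = lift R k g i u"
      by eventually_elim (simp add: lift_eq i)
    have notin: "(i, t) \<notin> inside"
    proof
      assume "(i, t) \<in> inside"
      then obtain a b where "(i, a, b) \<in> S" "a < t" "t < b" by (auto simp: inside_def)
      with False show False by (meson less_imp_le)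
    qed
    then have eq: "lift R k h i t = lift R k g i t" using t by (simp add: lift_eq i frac_id)
    have under: "(p, (i, frac t)) \<in> Y \<union> J \<longleftrightarrow> (p, (i, frac t)) \<in> Y" if
        "filling J sgJ" for p J sgJ
      using that notin t by (auto simp: filling_def frac_id)
    show ?thesis unfolding left_ok_def
    proof (intro conjI impI allI)
      assume "(i, frac t) \<notin> snd ` (Y \<union> I')"
      then have "(i, frac t) \<notin> snd ` (Y \<union> I)" using under[OF I] by force
      then have "\<forall>\<^sub>F u in at_left t. lift R k g i t = lift R k g i u"
        by (rule left_ok_const[OF colorings_ok(2)[OF g i X]])
      with ev show "\<forall>\<^sub>F u in at_left t. lift R k h i t = lift R k h i u"
        by eventually_elim (simp add: eq)
    next
      fix p assume "(p, (i, frac t)) \<in> Y \<union> I'"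
      then have p: "(p, (i, frac t)) \<in> Y" using under[OF I'] by simp
      then have "p \<in> base n" "p \<notin> inside" using Y_base Y_not_inside by auto
      then have hp: "lift R k h (fst p) (snd p) = lift R k g (fst p) (snd p)"
        using lift_point[OF hPi] lift_point[OF colorings_Pi[OF g]] out by simp
      have sg: "sg' (p, (i, frac t)) = sg (p, (i, frac t))" using p I I' by (simp add: filling_def)
      have "\<forall>\<^sub>F s in at_left t. lift R k g i t
          = signed_act R (sg (p, (i, frac t))) (lift R k g i s) (lift R k g (fst p) (snd p))"
        using p by (intro left_ok_jump[OF colorings_ok(2)[OF g i X]]) simp
      with ev show "\<forall>\<^sub>F s in at_left t. lift R k h i t
          = signed_act R (sg' (p, (i, frac t))) (lift R k h i s) (lift R k h (fst p) (snd p))"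
        unfolding sg hp eq by eventually_elim simp
    qed
  qed
qed

text \<open>Three plateaus separated by \<open>v\<close> and \<open>w\<close> cover every strand met
  in moves II and III. A breakpoint may fail to be an undercrossing, provided that the color does
  not change there.\<close>

lemma strand_ok_step:
  assumes I: "filling I sg" and s: "(j, a, b) \<in> S" and h: "h \<in> base n \<rightarrow> carrier R"
    and v: "a < v" "v < w" "w < b"
    and step: "\<And>t. \<lbrakk>a \<le> t; t \<le> b\<rbrakk> \<Longrightarrow> h (j, t)
        = (if t < v then x else if t < w then y else z)"
    and other: "\<And>p t. \<lbrakk>(p, (j, t)) \<in> I; a < t; t < b\<rbrakk> \<Longrightarrow> t
        = v \<or> t = w"
    and v_jump: "\<And>p. (p, (j, v)) \<in> I \<Longrightarrow> y = signed_act R (sg (p, (j, v))) x (h p)"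
    and v_const: "(j, v) \<notin> snd ` I \<Longrightarrow> y = x"
    and w_jump: "\<And>p. (p, (j, w)) \<in> I \<Longrightarrow> z = signed_act R (sg (p, (j, w))) y (h p)"
    and w_const: "(j, w) \<notin> snd ` I \<Longrightarrow> z = y"
  shows "strand_ok R (Y \<union> I) sg (lift R k h) (j, a, b)"
proof -
  have j: "j < n" "0 < a" "a < b" "b < 1" using strands[OF s] by auto
  have lift: "lift R k h j t = (if t < v then x else if t < w then y else z)" if "a \<le> t" "t \<le> b"
      for t
    using that j step[OF that] by (simp add: lift_coloring[OF h])
  have "right_ok (lift R k h) j t" if t: "a \<le> t" "t < b" for t
  proof -
    have "t < (if t < v then v else if t < w then w else b)" using t by auto
    then show ?thesis unfolding right_ok_def
      by (rule eventually_at_rightI[rotated]) (use t v in \<open>auto simp: lift split: if_splits\<close>)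
  qed
  moreover have "left_ok R (Y \<union> I) sg (lift R k h) j t" if t: "a < t" "t \<le> b" for t
  proof -
    have ft: "frac t = t" using t j by (simp add: frac_id)
    \<comment> \<open>\<open>c\<close> is the last breakpoint strictly before \<open>t\<close>, so
      the color is constant between \<open>c\<close> and \<open>t\<close>.\<close>
    define c where "c = (if t \<le> v then a else if t \<le> w then v else w)"
    have c: "c < t" using t by (auto simp: c_def)
    have under: "(p, (j, t)) \<in> Y \<union> I \<longleftrightarrow> (p, (j, t)) \<in> I" for p
      using t by (intro strand_under[OF I s]) auto
    then have under': "(j, t) \<in> snd ` (Y \<union> I) \<longleftrightarrow> (j, t) \<in> snd ` I"
        by force
    have left: "\<forall>\<^sub>F u in at_left t. lift R k h j u
        = (if t \<le> v then x else if t \<le> w then y else z)"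
      using c by (intro eventually_at_leftI[of c])
          (use t v in \<open>auto simp: lift c_def split: if_splits\<close>)
    show ?thesis unfolding left_ok_def ft
    proof (intro conjI impI allI)
      assume "(j, t) \<notin> snd ` (Y \<union> I)"
      then have "(j, t) \<notin> snd ` I" by (simp add: under')
      then have eq: "lift R k h j t = (if t \<le> v then x else if t \<le> w then y else z)"
        using v_const w_const t v by (auto simp: lift)
      from left show "\<forall>\<^sub>F u in at_left t. lift R k h j t = lift R k h j u"
        unfolding eq by eventually_elim simp
    next
      fix p assume "(p, (j, t)) \<in> Y \<union> I"
      then have p: "(p, (j, t)) \<in> I" by (simp only: under)
      \<comment> \<open>The crossings of a filling lie in open strands, so the end point
        \<open>b\<close> carries none.\<close>
      then have "(j, t) \<noteq> (j, b)" using strand_end_under[OF I s, of b] by force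
      then have tvw: "t = v \<or> t = w" using t by (intro other[OF p]) auto
      have "p \<in> base n" using p filling_base[OF I] by auto
      then have hp: "lift R k h (fst p) (snd p) = h p" by (rule lift_point[OF h])
      have eq: "lift R k h j t = signed_act R (sg (p, (j, t))) (if t \<le> v then x else if t \<le> w then y else z) (h p)"
        using tvw by (elim disjE) (use v_jump[of p] w_jump[of p] p v in \<open>simp_all add: lift\<close>)
      from left show "\<forall>\<^sub>F u in at_left t. lift R k h j t
          = signed_act R (sg (p, (j, t))) (lift R k h j u) (lift R k h (fst p) (snd p))"
        unfolding hp eq by eventually_elim simp
    qed
  qed
  ultimately show ?thesis by (auto simp: strand_ok_def)
qed

lemma strand_const:
  assumes I: "filling I sg" and s: "(j, a, b) \<in> S" and g: "g \<in> colorings R n (Y \<union> I) sg k"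
    and "a \<le> t" "t \<le> u" "u \<le> b" and "\<And>v. \<lbrakk>t < v; v \<le> u\<rbrakk>
        \<Longrightarrow> (j, v) \<notin> snd ` I"
  shows "g (j, u) = g (j, t)"
proof -
  have j: "j < n" "0 < a" "b < 1" using strands[OF s] by auto
  have "lift R k g j u = lift R k g j t"
  proof (rule coloring_const[OF g j(1) filling_base[OF I] assms(5)])
    fix v assume v: "t < v" "v \<le> u"
    then have "(p, (j, v)) \<in> Y \<union> I \<longleftrightarrow> (p, (j, v)) \<in> I" for p
      using assms by (intro strand_under[OF I s]) auto
    moreover have "frac v = v" using v assms j by (intro frac_id) auto
    ultimately show "(j, frac v) \<notin> snd ` (Y \<union> I)" using assms(7)[OF v] by force
  qed
  then show ?thesis using assms j by (simp add: lift_coloring[OF colorings_Pi[OF g]])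
qed

lemma strand_jump:
  assumes I: "filling I sg" and s: "(j, a, b) \<in> S" and g: "g \<in> colorings R n (Y \<union> I) sg k"
    and "a \<le> t" "t < u" "u \<le> b" and "\<And>v. \<lbrakk>t < v; v < u\<rbrakk>
        \<Longrightarrow> (j, v) \<notin> snd ` I"
    and p: "(p, (j, u)) \<in> I"
  shows "g (j, u) = signed_act R (sg (p, (j, u))) (g (j, t)) (g p)"
proof -
  have j: "j < n" "0 < a" "b < 1" using strands[OF s] by auto
  have u: "frac u = u" using assms j by (intro frac_id) auto
  have "lift R k g j u = signed_act R (sg (p, (j, frac u))) (lift R k g j t) (g p)"
  proof (rule coloring_jump[OF g j(1) filling_base[OF I] assms(5)])
    fix v assume v: "t < v" "v < u"
    then have "(p, (j, v)) \<in> Y \<union> I \<longleftrightarrow> (p, (j, v)) \<in> I" for p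
      using assms by (intro strand_under[OF I s]) auto
    moreover have "frac v = v" using v assms j by (intro frac_id) auto
    ultimately show "(j, frac v) \<notin> snd ` (Y \<union> I)" using assms(7)[OF v] by force
  qed (use p u in simp)
  then show ?thesis using assms j u by (simp add: lift_coloring[OF colorings_Pi[OF g]])
qed

lemma strand_unique:
  assumes I: "filling I sg" and s: "(j, a, b) \<in> S"
    and g: "g \<in> colorings R n (Y \<union> I) sg k" and h: "h \<in> colorings R n (Y \<union> I) sg k"
    and out: "\<And>p. \<lbrakk>p \<in> base n; p \<notin> inside\<rbrakk> \<Longrightarrow> g p = h p"
    and over: "\<And>p u. \<lbrakk>(p, (j, u)) \<in> I; a < u; u < b\<rbrakk> \<Longrightarrow> g p = h p"
    and p: "p \<in> closed_strand (j, a, b)"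
  shows "g p = h p"
proof -
  obtain t where t: "p = (j, t)" "a \<le> t" "t \<le> b" using p by auto
  have j: "j < n" "0 < a" "a < b" "b < 1" using strands[OF s] by auto
  have "(j, a) \<notin> inside" using j by (intro strand_end[OF s]) auto
  then have "g (j, a) = h (j, a)" using j by (intro out) (auto simp: base_def)
  then have start: "lift R k g j a = lift R k h j a"
    using j by (simp add: lift_coloring[OF colorings_Pi[OF g]] lift_coloring[OF colorings_Pi[OF h]])
  have "lift R k g j t = lift R k h j t"
  proof (rule coloring_unique[OF g h j(1) filling_base[OF I] t(2) start])
    fix u p assume u: "a < u" "u \<le> t" and p: "(p, (j, frac u)) \<in> Y \<union> I"
    have fu: "frac u = u" using u t j by (intro frac_id) auto
    have "(j, u) \<in> snd ` (Y \<union> I)" using p by (force simp: fu)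
    then have "u \<noteq> b" using strand_end_under[OF I s, of b] by auto
    moreover have "(p, (j, u)) \<in> I" using p strand_under[OF I s, of u p] u t by (simp add: fu)
    ultimately show "g p = h p" using u t by (intro over) auto
  qed
  then show ?thesis
    using t j by (simp add: lift_coloring[OF colorings_Pi[OF g]] lift_coloring[OF colorings_Pi[OF h]])
qed

lemma coloring_eqI:
  assumes "g \<in> colorings R n X sg k" "h \<in> colorings R n X sg k"
    and "\<And>p. \<lbrakk>p \<in> base n; p \<notin> inside\<rbrakk> \<Longrightarrow> g p = h p"
        "\<And>p. p \<in> inside \<Longrightarrow> g p = h p"
  shows "g = h"
proof (rule PiE_ext)
  show "g \<in> base n \<rightarrow>\<^sub>E carrier R" "h \<in> base n \<rightarrow>\<^sub>E carrier R"
    using assms(1,2) by (simp_all add: colorings_PiE)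
qed (use assms(3,4) in blast)

text \<open>Only existence of an extension is recorded here; its uniqueness is the business of
  \<open>rigid\<close>.\<close>

definition extends ::
    "(param \<times> param) set \<Rightarrow> (param \<times> param \<Rightarrow> int) \<Rightarrow> (param \<times> param) set \<Rightarrow> (param \<times> param \<Rightarrow> int) \<Rightarrow> bool" where
  "extends I sg I' sg' \<longleftrightarrow> (\<forall>g\<in>colorings R n (Y \<union> I) sg k. \<exists>h\<in>colorings R n (Y \<union> I') sg' k.
     \<forall>p\<in>base n. p \<notin> inside \<longrightarrow> h p = g p)"

definition rigid :: "(param \<times> param) set \<Rightarrow> (param \<times> param \<Rightarrow> int) \<Rightarrow> bool" where
  "rigid I sg \<longleftrightarrow> (\<forall>g\<in>colorings R n (Y \<union> I) sg k. \<forall>h\<in>colorings R n (Y \<union> I) sg k.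
     (\<forall>p\<in>base n. p \<notin> inside \<longrightarrow> g p = h p) \<longrightarrow> g = h)"

text \<open>Both sets are compared with their restrictions to the outside of the disc: rigidity
  makes the restriction maps injective, and extension in both directions makes their images
  equal.\<close>

lemma card_colorings_eq:
  assumes "rigid I sg" "rigid I' sg'" "extends I sg I' sg'" "extends I' sg' I sg"
  shows "card (colorings R n (Y \<union> I) sg k) = card (colorings R n (Y \<union> I') sg' k)"
proof -
  let ?C = "colorings R n (Y \<union> I) sg k" and ?C' = "colorings R n (Y \<union> I') sg' k"
  define restr where "restr = (\<lambda>g::param \<Rightarrow> 'a. restrict g (base n - inside))"
  have eq: "restr g = restr h
      \<longleftrightarrow> (\<forall>p\<in>base n. p \<notin> inside \<longrightarrow> g p = h p)" for g h
    by (auto simp: restr_def fun_eq_iff restrict_def)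
  have "inj_on restr ?C" "inj_on restr ?C'"
    using assms(1,2) by (auto simp: inj_on_def rigid_def eq)
  moreover have "restr ` ?C = restr ` ?C'"
  proof (intro equalityI image_subsetI)
    fix g assume "g \<in> ?C"
    then obtain h where "h \<in> ?C'" "restr g = restr h" using assms(3) unfolding extends_def eq by metis
    then show "restr g \<in> restr ` ?C'" by simp
  next
    fix g assume "g \<in> ?C'"
    then obtain h where "h \<in> ?C" "restr g = restr h" using assms(4) unfolding extends_def eq by metis
    then show "restr g \<in> restr ` ?C" by simp
  qed
  ultimately show ?thesis using card_image[of restr ?C] card_image[of restr ?C'] by simp
qed

end

lemma PiE_modify:
  assumes "g \<in> B \<rightarrow>\<^sub>E C" "A \<subseteq> B"
      "\<And>q. q \<in> A \<Longrightarrow> u q \<in> C"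
  shows "(\<lambda>q. if q \<in> A then u q else g q) \<in> B \<rightarrow>\<^sub>E C"
  using assms by (intro PiE_I) (auto dest: PiE_arb)

context tangle
begin

text \<open>\<open>r\<close> numbers the strands from the top downwards. Once the colors on all
  higher strands are known, those on a strand are determined from its starting point. A
  self-crossing of a strand admits no such numbering.\<close>

lemma rigidI:
  fixes r :: "strand \<Rightarrow> nat"
  assumes I: "filling I sg"
    and r: "\<And>p q s s'. \<lbrakk>(p, q) \<in> I; s \<in> S; s' \<in> S; p \<in> open_strand s; q \<in> open_strand s'\<rbrakk> \<Longrightarrow> r s < r s'"
  shows "rigid I sg"
  unfolding rigid_def
proof (intro ballI impI)
  fix g h assume g: "g \<in> colorings R n (Y \<union> I) sg k" and h:
      "h \<in> colorings R n (Y \<union> I) sg k"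
    and out: "\<forall>p\<in>base n. p \<notin> inside \<longrightarrow> g p = h p"
  have eq: "g p = h p" if "s \<in> S" "p \<in> open_strand s" for s p
    using that
  proof (induction "r s" arbitrary: s p rule: less_induct)
    case less
    obtain j a b where s: "s = (j, a, b)" by (cases s)
    show ?case
    proof (rule strand_unique[OF I _ g h])
      show "(j, a, b) \<in> S" using less s by simp
      show "p \<in> closed_strand (j, a, b)" using less open_subset_closed s by blast
      fix q u assume q: "(q, (j, u)) \<in> I" "a < u" "u < b"
      then have "q \<in> inside" using I by (auto simp: filling_def)
      then obtain s' where s': "s' \<in> S" "q \<in> open_strand s'" by (auto simp: inside_def)
      then have "r s' < r s" using r[OF q(1) s'(1) less(2) s'(2)] q s by simp
      then show "g q = h q" using less(1) s' by blast
    qed (use out in simp)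
  qed
  show "g = h" using out eq by (intro coloring_eqI[OF g h]) (auto simp: inside_def)
qed

lemma strand_ok_step1:
  assumes I: "filling I sg" and s: "(j, a, b) \<in> S" and h: "h \<in> base n \<rightarrow> carrier R"
    and v: "a < v" "v < b"
    and step: "\<And>t. \<lbrakk>a \<le> t; t \<le> b\<rbrakk> \<Longrightarrow> h (j, t)
        = (if t < v then x else y)"
    and other: "\<And>p t. \<lbrakk>(p, (j, t)) \<in> I; a < t; t < b\<rbrakk> \<Longrightarrow> t = v"
    and v_jump: "\<And>p. (p, (j, v)) \<in> I \<Longrightarrow> y = signed_act R (sg (p, (j, v))) x (h p)"
    and v_const: "(j, v) \<notin> snd ` I \<Longrightarrow> y = x"
  shows "strand_ok R (Y \<union> I) sg (lift R k h) (j, a, b)"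
proof -
  \<comment> \<open>A dummy second breakpoint, at which the color stays the same.\<close>
  define w where "w = (v + b) / 2"
  have w: "v < w" "w < b" using v by (auto simp: w_def)
  have w_under: "(p, (j, w)) \<notin> I" for p using other[of p w] w v by auto
  show ?thesis
  proof (rule strand_ok_step[where x = x and y = y and z = y, OF I s h v(1) w])
    show "h (j, t) = (if t < v then x else if t < w then y else y)" if "a \<le> t" "t \<le> b" for t
      using step[OF that] by simp
    show "t = v \<or> t = w" if "(p, (j, t)) \<in> I" "a < t" "t < b" for p t
      using other[OF that] by simp
  qed (use v_jump v_const w_under in blast)+
qed

lemma strand_ok_const:
  assumes I: "filling I sg" and s: "(j, a, b) \<in> S" and h: "h \<in> base n \<rightarrow> carrier R"
    and step: "\<And>t. \<lbrakk>a \<le> t; t \<le> b\<rbrakk> \<Longrightarrow> h (j, t) = x"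
    and other: "\<And>p t. \<lbrakk>a < t; t < b\<rbrakk> \<Longrightarrow> (p, (j, t)) \<notin> I"
  shows "strand_ok R (Y \<union> I) sg (lift R k h) (j, a, b)"
  using strands[OF s] other
  by (intro strand_ok_step1[where x = x and y = x and v = "(a + b) / 2", OF I s h]) (auto simp: step)

lemma open_disjoint:
  "\<lbrakk>s \<in> S; s' \<in> S; p \<in> open_strand s; p \<in> open_strand s'\<rbrakk>
      \<Longrightarrow> s = s'"
  using disjoint[of s s'] open_subset_closed by blast

lemma open_closed_disjoint:
  "\<lbrakk>s \<in> S; s' \<in> S; p \<in> closed_strand s; p \<in> closed_strand s'\<rbrakk>
      \<Longrightarrow> s = s'"
  using disjoint[of s s'] by blast

subsection \<open>The second move\<close>

text \<open>The overstrand keeps one color \<open>x\<close> throughout, so the two crossings act by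
  mutually inverse translations and the understrand leaves with its original color. The
  undercrossings are taken in the order \<open>v < w\<close>, while the order of \<open>p\<close>
  and \<open>p'\<close> on the overstrand is left open.\<close>

lemma card_colorings_move2:
  assumes S: "S = {(i, a, b), (j, c, d)}" "(i, a, b) \<noteq> (j, c, d)"
    and empty: "filling {} sg" and I: "filling I sg'"
    and I_def: "I = {((i, p), (j, v)), ((i, p'), (j, w))}"
    and pts: "a < p" "p < b" "a < p'" "p' < b" "c < v" "v < w" "w < d"
    and opposite: "sg' ((i, p'), (j, w)) = 1 \<longleftrightarrow> sg' ((i, p), (j, v)) \<noteq> 1"
  shows "card (colorings R n (Y \<union> {}) sg k) = card (colorings R n (Y \<union> I) sg' k)"
proof (rule card_colorings_eq)
  have o: "(i, a, b) \<in> S" and u: "(j, c, d) \<in> S" using S by auto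
  have no: "(i, t) \<noteq> (j, t')" if "a \<le> t" "t \<le> b" "c \<le> t'" "t' \<le> d" for t t'
    using open_closed_disjoint[OF o u, of "(i, t)"] that S(2) by auto
  show "rigid {} sg" using empty by (rule rigidI) auto
  show "rigid I sg'"
  proof (rule rigidI[where r = "\<lambda>s. if s = (i, a, b) then 0 else 1", OF I])
    fix q q' s s' assume q: "(q, q') \<in> I" "s \<in> S" "s' \<in> S" "q \<in> open_strand s"
        "q' \<in> open_strand s'"
    have "q \<in> open_strand (i, a, b)" "q' \<in> open_strand (j, c, d)" using q(1) pts
        by (auto simp: I_def)
    then have "s = (i, a, b)" "s' = (j, c, d)"
      using open_disjoint[OF q(2) o q(4)] open_disjoint[OF q(3) u q(5)] by auto
    then show "(if s = (i, a, b) then 0 else 1) < (if s' = (i, a, b) then 0 else 1 :: nat)" using S(2)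
        by auto
  qed
  have no_under: "(q, (i, t)) \<notin> I" if "a < t" "t < b" for q t
    using no[of t v] no[of t w] that pts by (auto simp: I_def)
  have u_under: "(j, t) \<in> snd ` I \<longleftrightarrow> t = v \<or> t = w" for t
    by (auto simp: I_def)
  have bases: "(i, p) \<in> base n" "(i, p') \<in> base n" "(j, c) \<in> base n" "(i, a) \<in> base n"
    using strands[OF o] strands[OF u] pts by (auto simp: base_def)
  have "{j} \<times> {v..<w} \<subseteq> open_strand (j, c, d)" using pts by auto
  then have mid: "{j} \<times> {v..<w} \<subseteq> inside" using u unfolding inside_def by blast
  show "extends {} sg I sg'"
    unfolding extends_def
  proof
    fix g assume g: "g \<in> colorings R n (Y \<union> {}) sg k"
    define x where "x = g (i, a)"
    define y where "y = g (j, c)"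
    define y' where "y' = signed_act R (sg' ((i, p), (j, v))) y x"
    have xy: "x \<in> carrier R" "y \<in> carrier R" "y' \<in> carrier R"
      using bases colorings_closed[OF g] by (auto simp: x_def y_def y'_def signed_act_closed)
    have g_o: "g (i, t) = x" if "a \<le> t" "t \<le> b" for t
      unfolding x_def using that by (intro strand_const[OF empty o g]) auto
    have g_u: "g (j, t) = y" if "c \<le> t" "t \<le> d" for t
      unfolding y_def using that by (intro strand_const[OF empty u g]) auto
    \<comment> \<open>Only the stretch between the two undercrossings is recolored; it is closed on
      the left and open on the right because colorings are right-continuous.\<close>
    define h where "h = (\<lambda>q. if q \<in> {j} \<times> {v..<w} then y' else g q)"
    have h_in: "h \<in> base n \<rightarrow>\<^sub>E carrier R"
      unfolding h_def using colorings_PiE[OF g] xy mid inside_base by (intro PiE_modify) auto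
    have h_o: "h (i, t) = x" if "a \<le> t" "t \<le> b" for t
      using no[of t t] g_o that pts by (auto simp: h_def)
    have h_u: "h (j, t) = (if t < v then y else if t < w then y' else y)" if "c \<le> t" "t \<le> d" for t
      using that g_u by (auto simp: h_def)
    have "h \<in> colorings R n (Y \<union> I) sg' k"
    proof (rule filling_coloring[OF empty I g h_in])
      show "h q = g q" if "q \<notin> inside" for q
        using that mid by (auto simp: h_def)
      fix s assume "s \<in> S"
      then consider "s = (i, a, b)" | "s = (j, c, d)" using S by auto
      then show "strand_ok R (Y \<union> I) sg' (lift R k h) s"
      proof cases
        case 1
        show ?thesis unfolding 1 using h_in h_o no_under by (intro strand_ok_const[OF I o]) auto
      next
        case 2
        have cancel: "signed_act R (sg' ((i, p'), (j, w))) y' x = y"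
          unfolding y'_def using xy opposite by (intro signed_act_cancel) auto
        show ?thesis unfolding 2
        proof (rule strand_ok_step[OF I u _ pts(5-7) h_u])
          show "y' = signed_act R (sg' (q, (j, v))) y (h q)" if "(q, (j, v)) \<in> I" for q
            using that pts h_o[of p] by (auto simp: I_def y'_def)
          show "y = signed_act R (sg' (q, (j, w))) y' (h q)" if "(q, (j, w)) \<in> I" for q
            using that pts h_o[of p'] cancel by (auto simp: I_def)
        qed (use h_in u_under in \<open>auto simp: I_def\<close>)
      qed
    qed
    moreover have "\<forall>q\<in>base n. q \<notin> inside \<longrightarrow> h q = g q"
      using mid by (auto simp: h_def)
    ultimately show "\<exists>h\<in>colorings R n (Y \<union> I) sg' k. \<forall>q\<in>base n. q \<notin> inside \<longrightarrow> h q = g q" by blast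
  qed
  show "extends I sg' {} sg"
    unfolding extends_def
  proof
    fix g assume g: "g \<in> colorings R n (Y \<union> I) sg' k"
    define x where "x = g (i, a)"
    define y where "y = g (j, c)"
    have xy: "x \<in> carrier R" "y \<in> carrier R"
      using bases colorings_closed[OF g] by (auto simp: x_def y_def)
    have g_o: "g (i, t) = x" if "a \<le> t" "t \<le> b" for t
    proof -
      have "(i, u) \<notin> snd ` I" if "a < u" "u \<le> t" for u
        using no[of u v] no[of u w] pts that \<open>t \<le> b\<close> by (auto simp: I_def)
      then show ?thesis unfolding x_def using that by (intro strand_const[OF I o g]) auto
    qed
    have g1: "g (j, t) = y" if "c \<le> t" "t < v" for t
      unfolding y_def using that pts u_under by (intro strand_const[OF I u g]) auto
    have "g (j, v) = signed_act R (sg' ((i, p), (j, v))) (g (j, c)) (g (i, p))"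
      using pts u_under by (intro strand_jump[OF I u g]) (auto simp: I_def)
    then have gv: "g (j, v) = signed_act R (sg' ((i, p), (j, v))) y x" using g_o pts by (simp add: y_def)
    have "g (j, w) = signed_act R (sg' ((i, p'), (j, w))) (g (j, v)) (g (i, p'))"
      using pts u_under by (intro strand_jump[OF I u g]) (auto simp: I_def)
    also have "\<dots> = y"
      using g_o pts xy opposite by (simp add: gv) (intro signed_act_cancel, auto)
    finally have gw: "g (j, w) = y" .
    have g3: "g (j, t) = y" if "w \<le> t" "t \<le> d" for t
      using that pts u_under gw strand_const[OF I u g, of w t] by auto
    define h where "h = (\<lambda>q. if q \<in> {j} \<times> {v..<w} then y else g q)"
    have h_in: "h \<in> base n \<rightarrow>\<^sub>E carrier R"
      unfolding h_def using colorings_PiE[OF g] xy mid inside_base by (intro PiE_modify) auto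
    have h_o: "h (i, t) = x" if "a \<le> t" "t \<le> b" for t
      using no[of t t] g_o that pts by (auto simp: h_def)
    have h_u: "h (j, t) = y" if "c \<le> t" "t \<le> d" for t
      using that g1 g3 by (auto simp: h_def)
    have "h \<in> colorings R n (Y \<union> {}) sg k"
    proof (rule filling_coloring[OF I empty g h_in])
      show "h q = g q" if "q \<notin> inside" for q
        using that mid by (auto simp: h_def)
      fix s assume "s \<in> S"
      then consider "s = (i, a, b)" | "s = (j, c, d)" using S by auto
      then show "strand_ok R (Y \<union> {}) sg (lift R k h) s"
      proof cases
        case 1
        show ?thesis unfolding 1 using h_in h_o by (intro strand_ok_const[OF empty o]) auto
      next
        case 2
        show ?thesis unfolding 2 using h_in h_u by (intro strand_ok_const[OF empty u]) auto
      qed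
    qed
    moreover have "\<forall>q\<in>base n. q \<notin> inside \<longrightarrow> h q = g q"
      using mid by (auto simp: h_def)
    ultimately show "\<exists>h\<in>colorings R n (Y \<union> {}) sg k. \<forall>q\<in>base n. q \<notin> inside \<longrightarrow> h q = g q" by blast
  qed
qed

end

subsection \<open>The third move\<close>

context tangle
begin

text \<open>This is all that the coloring argument retains of the geometry: the three signs and,
  through \<open>mid_first\<close> and \<open>lo_first\<close>, whether each lower strand reaches
  the crossing of the two lower strands before it passes under the highest one.\<close>

definition triangle_filling ::
    "(param \<times> param) set \<Rightarrow> (param \<times> param \<Rightarrow> int) \<Rightarrow> strand \<Rightarrow> strand \<Rightarrow> strand \<Rightarrow>
      int \<Rightarrow> int \<Rightarrow> int \<Rightarrow> bool \<Rightarrow> bool \<Rightarrow> bool" where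
  "triangle_filling I sg hi mid lo e1 e2 e3 mid_first lo_first \<longleftrightarrow>
     (case (hi, mid, lo) of ((i, a, b), (j, c, d), (l, e, f)) \<Rightarrow>
       \<exists>p p' v m w u. {p, p'} \<subseteq> {a<..<b} \<and> {v, m} \<subseteq> {c<..<d} \<and> {w, u} \<subseteq> {e<..<f} \<and> v \<noteq> m \<and> w \<noteq> u \<and>
         I = {((i, p), (j, v)), ((i, p'), (l, w)), ((j, m), (l, u))} \<and>
         sg ((i, p), (j, v)) = e1 \<and> sg ((i, p'), (l, w)) = e2 \<and> sg ((j, m), (l, u)) = e3 \<and>
         (mid_first \<longleftrightarrow> m < v) \<and> (lo_first \<longleftrightarrow> u < w))"

lemma triangle_fillingI:
  assumes "a < p" "p < b" "a < p'" "p' < b" "c < v" "v < d" "c < m" "m < d"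
      "e < w" "w < f" "e < u" "u < f" "v \<noteq> m" "w \<noteq> u"
    and "I = {((i, p), (j, v)), ((i, p'), (l, w)), ((j, m), (l, u))}"
    and "sg ((i, p), (j, v)) = e1" "sg ((i, p'), (l, w)) = e2" "sg ((j, m), (l, u)) = e3"
    and "mid_first \<longleftrightarrow> m < v" "lo_first \<longleftrightarrow> u < w"
  shows "triangle_filling I sg (i, a, b) (j, c, d) (l, e, f) e1 e2 e3 mid_first lo_first"
  unfolding triangle_filling_def prod.case
  by (rule exI[of _ p], rule exI[of _ p'], rule exI[of _ v], rule exI[of _ m], rule exI[of _ w], rule exI[of _ u])
    (simp only: assms insert_subset empty_subsetI greaterThanLessThan_iff simp_thms)

lemma triangle_fillingE:
  assumes "triangle_filling I sg (i, a, b) (j, c, d) (l, e, f) e1 e2 e3 mid_first lo_first"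
  obtains p p' v m w u where "a < p" "p < b" "a < p'" "p' < b" "c < v" "v < d" "c < m" "m < d"
      "e < w" "w < f" "e < u" "u < f" "v \<noteq> m" "w \<noteq> u"
      "I = {((i, p), (j, v)), ((i, p'), (l, w)), ((j, m), (l, u))}"
      "sg ((i, p), (j, v)) = e1" "sg ((i, p'), (l, w)) = e2" "sg ((j, m), (l, u)) = e3"
      "mid_first \<longleftrightarrow> m < v" "lo_first \<longleftrightarrow> u < w"
  using assms unfolding triangle_filling_def prod.case by (elim exE conjE) (rule that; simp)

text \<open>
  The two orders of the undercrossings on the lowest strand give the same outgoing color by
  self-distributivity, since the move also changes whether the middle strand meets the lowest one
  before or after passing under the highest one.
\<close>

lemma triangle_move_extends:
  assumes S: "S = {hi, mid, lo}" "hi \<noteq> mid" "hi \<noteq> lo" "mid \<noteq> lo"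
    and I: "filling I sg" and I': "filling I' sg'"
    and tri: "triangle_filling I sg hi mid lo e1 e2 e3 mf lf"
    and tri': "triangle_filling I' sg' hi mid lo e1 e2 e3 (\<not> mf) (\<not> lf)"
    and signs: "(e1 = 1 \<longleftrightarrow> e2 = 1) \<longleftrightarrow> (mf \<longleftrightarrow> lf)"
  shows "extends I sg I' sg'"
  unfolding extends_def
proof
  fix g assume g: "g \<in> colorings R n (Y \<union> I) sg k"
  obtain i a b j c d l e f where names: "hi = (i, a, b)" "mid = (j, c, d)" "lo = (l, e, f)"
    by (metis prod_cases3)
  have hS: "(i, a, b) \<in> S" and mS: "(j, c, d) \<in> S" and lS: "(l, e, f) \<in> S" using S names by auto
  obtain p p' v m w u where pts: "a < p" "p < b" "a < p'" "p' < b" "c < v" "v < d" "c < m" "m < d"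
      "e < w" "w < f" "e < u" "u < f" "v \<noteq> m" "w \<noteq> u"
    and I_def: "I = {((i, p), (j, v)), ((i, p'), (l, w)), ((j, m), (l, u))}"
    and sg: "sg ((i, p), (j, v)) = e1" "sg ((i, p'), (l, w)) = e2" "sg ((j, m), (l, u)) = e3"
    and mf: "mf \<longleftrightarrow> m < v" and lf: "lf \<longleftrightarrow> u < w"
    by (rule triangle_fillingE[OF tri[unfolded names]])
  obtain r r' v' m' w' u' where pts': "a < r" "r < b" "a < r'" "r' < b" "c < v'" "v' < d" "c < m'" "m' < d"
      "e < w'" "w' < f" "e < u'" "u' < f" "v' \<noteq> m'" "w' \<noteq> u'"
    and I'_def: "I' = {((i, r), (j, v')), ((i, r'), (l, w')), ((j, m'), (l, u'))}"
    and sg': "sg' ((i, r), (j, v')) = e1" "sg' ((i, r'), (l, w')) = e2" "sg' ((j, m'), (l, u')) = e3"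
    and mf': "\<not> mf \<longleftrightarrow> m' < v'" and lf': "\<not> lf \<longleftrightarrow> u' < w'"
    by (rule triangle_fillingE[OF tri'[unfolded names]])
  have hm: "(i, t) \<noteq> (j, t')" if "a \<le> t" "t \<le> b" "c \<le> t'" "t' \<le> d" for t t'
    using open_closed_disjoint[OF hS mS, of "(i, t)"] that S(2) names by auto
  have hl: "(i, t) \<noteq> (l, t')" if "a \<le> t" "t \<le> b" "e \<le> t'" "t' \<le> f" for t t'
    using open_closed_disjoint[OF hS lS, of "(i, t)"] that S(3) names by auto
  have ml: "(j, t) \<noteq> (l, t')" if "c \<le> t" "t \<le> d" "e \<le> t'" "t' \<le> f" for t t'
    using open_closed_disjoint[OF mS lS, of "(j, t)"] that S(4) names by auto
  have h_under: "(i, t) \<notin> snd ` I" "(i, t) \<notin> snd ` I'" if "a < t" "t < b" for t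
    using that pts pts' hm[of t v] hl[of t w] hl[of t u] hm[of t v'] hl[of t w'] hl[of t u']
    by (auto simp: I_def I'_def)
  have m_under: "(j, t) \<in> snd ` I \<longleftrightarrow> t = v"
      "(j, t) \<in> snd ` I' \<longleftrightarrow> t = v'" if "c < t" "t < d" for t
    using that pts pts' ml[of t w] ml[of t u] ml[of t w'] ml[of t u'] by (auto simp: I_def I'_def)
  have l_under: "(l, t) \<in> snd ` I \<longleftrightarrow> t = w \<or> t = u"
      "(l, t) \<in> snd ` I' \<longleftrightarrow> t = w' \<or> t = u'" if "e < t" "t < f" for t
    using that pts pts' ml[of v t] ml[of v' t] by (auto simp: I_def I'_def)
  have end_under: "(i, b) \<notin> snd ` I" "(j, d) \<notin> snd ` I" "(l, f) \<notin> snd ` I"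
    using strand_end_under[OF I hS, of b] strand_end_under[OF I mS, of d] strand_end_under[OF I lS, of f]
    by auto
  have in_I: "((i, p), (j, v)) \<in> I" "((i, p'), (l, w)) \<in> I" "((j, m), (l, u)) \<in> I"
      by (simp_all add: I_def)
  define x where "x = g (i, a)"
  define y where "y = g (j, c)"
  define z where "z = g (l, e)"
  have bases: "(i, a) \<in> base n" "(j, c) \<in> base n" "(l, e) \<in> base n"
    using strands[OF hS] strands[OF mS] strands[OF lS] by (auto simp: base_def)
  have xyz: "x \<in> carrier R" "y \<in> carrier R" "z \<in> carrier R"
    using bases colorings_closed[OF g] by (auto simp: x_def y_def z_def)
  define y' where "y' = signed_act R e1 y x"
  \<comment> \<open>\<open>gm\<close> and \<open>hm'\<close> are the colors of the middle strand
    where it crosses over the lowest one, before and after the move; \<open>zf\<close> is the color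
    with which the lowest strand leaves, and \<open>z'\<close> its color between the undercrossings
    after the move.\<close>
  define gm where "gm = (if mf then y else y')"
  define hm' where "hm' = (if mf then y' else y)"
  define zf where "zf = (if lf then signed_act R e2 (signed_act R e3 z gm) x
      else signed_act R e3 (signed_act R e2 z x) gm)"
  define z' where "z' = (if lf then signed_act R e2 z x else signed_act R e3 z hm')"
  have y': "y' \<in> carrier R" using xyz by (simp add: y'_def signed_act_closed)
  then have closed: "gm \<in> carrier R" "hm' \<in> carrier R" using xyz by (auto simp: gm_def hm'_def)
  then have closed': "zf \<in> carrier R" "z' \<in> carrier R" using xyz
      by (auto simp: zf_def z'_def signed_act_closed)

  have g_hi: "g (i, t) = x" if "a \<le> t" "t \<le> b" for t
  proof -
    have "(i, s) \<notin> snd ` I" if "a < s" "s \<le> b" for s using h_under(1)[of s] end_under that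
        by (cases "s = b") auto
    then show ?thesis unfolding x_def using that by (intro strand_const[OF I hS g]) auto
  qed
  have g_mid1: "g (j, t) = y" if "c \<le> t" "t < v" for t
    unfolding y_def using that pts m_under(1) by (intro strand_const[OF I mS g]) auto
  have "g (j, v) = signed_act R (sg ((i, p), (j, v))) (g (j, c)) (g (i, p))"
    using pts m_under(1) in_I by (intro strand_jump[OF I mS g]) auto
  then have gv: "g (j, v) = y'" using g_hi pts sg by (simp add: y_def y'_def)
  have g_mid2: "g (j, t) = y'" if "v \<le> t" "t \<le> d" for t
  proof -
    have "(j, s) \<notin> snd ` I" if "v < s" "s \<le> d" for s
      using m_under(1)[of s] end_under that pts by (cases "s = d") auto
    then show ?thesis unfolding gv[symmetric] using that pts by (intro strand_const[OF I mS g]) auto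
  qed
  have gm: "g (j, m) = gm" using g_mid1 g_mid2 pts mf by (auto simp: gm_def)
  have l_const: "g (l, t) = g (l, s)" if "e \<le> s" "s \<le> t" "t \<le> f"
      "\<not> (s < w \<and> w \<le> t)" "\<not> (s < u \<and> u \<le> t)" for s t
  proof -
    have "(l, q) \<notin> snd ` I" if "s < q" "q \<le> t" for q
      using l_under(1)[of q] end_under that pts \<open>e \<le> s\<close> \<open>t \<le> f\<close> \<open>\<not> (s < w \<and> w \<le> t)\<close> \<open>\<not> (s < u \<and> u \<le> t)\<close>
      by (cases "q = f") auto
    then show ?thesis using that by (intro strand_const[OF I lS g]) auto
  qed
  have jump_w: "g (l, w) = signed_act R e2 (g (l, s)) x" if "e \<le> s" "s < w" "u \<le> s \<or> w < u"
      for s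
  proof -
    have "g (l, w) = signed_act R (sg ((i, p'), (l, w))) (g (l, s)) (g (i, p'))"
      using that pts l_under(1) in_I by (intro strand_jump[OF I lS g]) auto
    then show ?thesis using g_hi pts sg by simp
  qed
  have jump_u: "g (l, u) = signed_act R e3 (g (l, s)) gm" if "e \<le> s" "s < u" "w \<le> s \<or> u < w"
      for s
  proof -
    have "g (l, u) = signed_act R (sg ((j, m), (l, u))) (g (l, s)) (g (j, m))"
      using that pts l_under(1) in_I by (intro strand_jump[OF I lS g]) auto
    then show ?thesis using gm sg by simp
  qed
  have gf: "g (l, f) = zf"
  proof (cases lf)
    case True
    then have "u < w" using lf by simp
    then have "g (l, f) = g (l, w)" "g (l, w) = signed_act R e2 (g (l, u)) x"
        "g (l, u) = signed_act R e3 z gm"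
      unfolding z_def using pts by (intro l_const jump_w jump_u; simp)+
    then show ?thesis using True by (simp add: zf_def)
  next
    case False
    then have "w < u" using lf pts by simp
    then have "g (l, f) = g (l, u)" "g (l, u) = signed_act R e3 (g (l, w)) gm"
        "g (l, w) = signed_act R e2 z x"
      unfolding z_def using pts by (intro l_const jump_w jump_u; simp)+
    then show ?thesis using False by (simp add: zf_def)
  qed
  \<comment> \<open>Self-distributivity exchanges the two actions on \<open>z\<close> if the color
    of the middle strand is moved through the action of \<open>x\<close> as well, and this takes
    \<open>gm\<close> to \<open>hm'\<close> or back.\<close>
  have zf': "zf = (if lf then signed_act R e3 z' hm' else signed_act R e2 z' x)"
  proof -
    \<comment> \<open>Different order flags mean opposite signs \<open>e1\<close> and
      \<open>e2\<close>, so the action with \<open>e2\<close> undoes the passage of the middle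
      strand under the highest; equal flags mean that it repeats this passage.\<close>
    have eq: "signed_act R e2 y' x = y" if "mf \<noteq> lf"
      unfolding y'_def using that signs xyz by (intro signed_act_cancel) auto
    have eq': "signed_act R e2 y x = y'" if "mf = lf"
      using that signs by (auto simp: y'_def signed_act_def)
    show ?thesis
    proof (cases lf)
      case True
      have "signed_act R e2 gm x = hm'" using eq eq' True by (cases mf) (auto simp: gm_def hm'_def)
      then show ?thesis
        using True xyz closed signed_act_dist[of z gm x e2 e3] by (simp add: zf_def z'_def)
    next
      case False
      have "signed_act R e2 hm' x = gm" using eq eq' False by (cases mf) (auto simp: gm_def hm'_def)
      then show ?thesis
        using False xyz closed signed_act_dist[of z hm' x e2 e3] by (simp add: zf_def z'_def)
    qed
  qed

  define w1 where "w1 = min u' w'"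
  define w2 where "w2 = max u' w'"
  have w12: "e < w1" "w1 < w2" "w2 < f" using pts' by (auto simp: w1_def w2_def)
  \<comment> \<open>The middle and the lowest strand may belong to the same component, so the
    component index alone does not tell them apart and the interval has to be tested too.\<close>
  define hv where "hv = (\<lambda>q :: param. if fst q = j \<and> c < snd q
      \<and> snd q < d then (if snd q < v' then y else y')
      else if snd q < w1 then z else if snd q < w2 then z' else zf)"
  define h where "h = (\<lambda>q. if q \<in> open_strand (j, c, d) \<union> open_strand (l, e, f) then hv q else g q)"
  have mid_sub: "open_strand (j, c, d) \<union> open_strand (l, e, f) \<subseteq> inside"
    using mS lS unfolding inside_def by blast
  have h_in: "h \<in> base n \<rightarrow>\<^sub>E carrier R"
    unfolding h_def using colorings_PiE[OF g] mid_sub inside_base xyz y' closed'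
    by (intro PiE_modify) (auto simp: hv_def)
  then have h_Pi: "h \<in> base n \<rightarrow> carrier R" by auto
  have h_hi: "h (i, t) = x" if "a \<le> t" "t \<le> b" for t
    using that hm[of t t] hl[of t t] g_hi by (auto simp: h_def)
  have h_mid: "h (j, t) = (if t < v' then y else y')" if "c \<le> t" "t \<le> d" for t
  proof (cases "c < t \<and> t < d")
    case False
    have "t = c \<or> t = d" using that False by auto
    moreover have "h (j, t) = g (j, t)" using False that ml[of t t] by (auto simp: h_def)
    ultimately show ?thesis using g_mid1[of c] g_mid2[of d] pts pts' by auto
  qed (auto simp: h_def hv_def)
  have h_lo: "h (l, t) = (if t < w1 then z else if t < w2 then z' else zf)" if "e \<le> t" "t \<le> f" for t
  proof (cases "e < t \<and> t < f")
    case True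
    then have "\<not> (l = j \<and> c < t \<and> t < d)" using ml[of t t] by auto
    then show ?thesis using True by (auto simp: h_def hv_def)
  next
    case False
    have "t = e \<or> t = f" using that False by auto
    moreover have "h (l, t) = g (l, t)" using False that ml[of t t] by (auto simp: h_def)
    ultimately show ?thesis using gf w12 by (auto simp: z_def)
  qed
  have hm': "h (j, m') = hm'" using h_mid[of m'] pts' mf' by (auto simp: hm'_def)
  have "h \<in> colorings R n (Y \<union> I') sg' k"
  proof (rule filling_coloring[OF I I' g h_in])
    show "h q = g q" if "q \<notin> inside" for q
      using that mid_sub by (auto simp: h_def)
    fix s assume "s \<in> S"
    then consider "s = (i, a, b)" | "s = (j, c, d)" | "s = (l, e, f)" using S names by auto
    then show "strand_ok R (Y \<union> I') sg' (lift R k h) s"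
    proof cases
      case 1
      show ?thesis unfolding 1
      proof (rule strand_ok_const[OF I' hS h_Pi])
        show "(q, (i, t)) \<notin> I'" if "a < t" "t < b" for q t
          using h_under(2)[OF that] by force
      qed (rule h_hi)
    next
      case 2
      show ?thesis unfolding 2
      proof (rule strand_ok_step1[OF I' mS h_Pi pts'(5,6) h_mid])
        show "t = v'" if "(q, (j, t)) \<in> I'" "c < t" "t < d" for q t
          using that m_under(2)[of t] by force
        show "y' = signed_act R (sg' (q, (j, v'))) y (h q)" if "(q, (j, v')) \<in> I'" for q
        proof -
          have "q = (i, r)" using that pts' ml[of v' w'] ml[of v' u'] by (auto simp: I'_def)
          then show ?thesis using h_hi pts' sg' by (simp add: y'_def)
        qed
        show "y' = y" if "(j, v') \<notin> snd ` I'" using that m_under(2)[of v'] pts' by simp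
      qed
    next
      case 3
      have w_q: "q = (i, r')" if "(q, (l, w')) \<in> I'" for q
        using that pts' ml[of v' w'] by (auto simp: I'_def)
      have u_q: "q = (j, m')" if "(q, (l, u')) \<in> I'" for q
        using that pts' ml[of v' u'] by (auto simp: I'_def)
      show ?thesis unfolding 3
      proof (rule strand_ok_step[OF I' lS h_Pi w12 h_lo])
        show "t = w1 \<or> t = w2" if "(q, (l, t)) \<in> I'" "e < t" "t < f" for q t
        proof -
          have "t = w' \<or> t = u'" using that l_under(2)[of t] by force
          then show ?thesis by (auto simp: w1_def w2_def min_def max_def)
        qed
        have "w1 = w' \<and> w2 = u'" if lf using that lf' pts' by (auto simp: w1_def w2_def)
        moreover have "w1 = u' \<and> w2 = w'" if "\<not> lf" using that lf' pts'
            by (auto simp: w1_def w2_def)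
        ultimately have w: "w1 = (if lf then w' else u')" "w2 = (if lf then u' else w')" by auto
        show "z' = signed_act R (sg' (q, (l, w1))) z (h q)" if "(q, (l, w1)) \<in> I'" for q
          using that w_q[of q] u_q[of q] sg' hm' h_hi[of r'] pts' by (cases lf) (simp_all add: w z'_def)
        show "zf = signed_act R (sg' (q, (l, w2))) z' (h q)" if "(q, (l, w2)) \<in> I'" for q
          using that w_q[of q] u_q[of q] sg' hm' h_hi[of r'] pts' zf' by (cases lf) (simp_all add: w)
        show "z' = z" if "(l, w1) \<notin> snd ` I'" using that l_under(2)[of w1] w12 pts'
            by (simp add: w split: if_splits)
        show "zf = z'" if "(l, w2) \<notin> snd ` I'" using that l_under(2)[of w2] w12 pts'
            by (simp add: w split: if_splits)
      qed
    qed
  qed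
  moreover have "\<forall>q\<in>base n. q \<notin> inside \<longrightarrow> h q = g q"
    using mid_sub by (auto simp: h_def)
  ultimately show "\<exists>h\<in>colorings R n (Y \<union> I') sg' k. \<forall>q\<in>base n. q \<notin> inside \<longrightarrow> h q = g q" by blast
qed

lemma triangle_rigid:
  assumes S: "S = {hi, mid, lo}" "hi \<noteq> mid" "hi \<noteq> lo" "mid \<noteq> lo"
    and I: "filling I sg" and tri: "triangle_filling I sg hi mid lo e1 e2 e3 mf lf"
  shows "rigid I sg"
proof (rule rigidI[where r = "\<lambda>s. if s = hi then 0 else if s = mid then 1 else 2", OF I])
  fix q q' s s' assume q: "(q, q') \<in> I" "s \<in> S" "s' \<in> S" "q \<in> open_strand s"
      "q' \<in> open_strand s'"
  obtain i a b j c d l e f where names: "hi = (i, a, b)" "mid = (j, c, d)" "lo = (l, e, f)"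
    by (metis prod_cases3)
  have S': "hi \<in> S" "mid \<in> S" "lo \<in> S" using S by auto
  have "q \<in> open_strand hi \<and> q' \<in> open_strand mid \<or> q \<in> open_strand hi
      \<and> q' \<in> open_strand lo \<or>
      q \<in> open_strand mid \<and> q' \<in> open_strand lo"
  proof -
    obtain p p' v m w u where "a < p" "p < b" "a < p'" "p' < b" "c < v" "v < d" "c < m" "m < d"
        "e < w" "w < f" "e < u" "u < f" "v \<noteq> m" "w \<noteq> u"
      and I_def: "I = {((i, p), (j, v)), ((i, p'), (l, w)), ((j, m), (l, u))}"
      and "sg ((i, p), (j, v)) = e1" "sg ((i, p'), (l, w)) = e2" "sg ((j, m), (l, u)) = e3"
        "mf \<longleftrightarrow> m < v" "lf \<longleftrightarrow> u < w"
      by (rule triangle_fillingE[OF tri[unfolded names]])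
    moreover have "(q, q') \<in> {((i, p), (j, v)), ((i, p'), (l, w)), ((j, m), (l, u))}"
      using q(1) by (simp only: I_def)
    ultimately show ?thesis unfolding names by auto
  qed
  then have "s = hi \<and> s' = mid \<or> s = hi \<and> s' = lo \<or> s = mid \<and> s' = lo"
    using open_disjoint[OF q(2) _ q(4)] open_disjoint[OF q(3) _ q(5)] S' by blast
  then show "(if s = hi then 0 else if s = mid then 1 else 2) < (if s' = hi then 0 else if s'
      = mid then 1 else 2 :: nat)"
    using S(2-4) by (elim disjE conjE; simp)
qed

text \<open>Negating both order flags turns one side of the move into the other and preserves the
  condition on the signs, so the extension lemma serves in both directions.\<close>

lemma card_colorings_move3:
  assumes S: "S = {hi, mid, lo}" "hi \<noteq> mid" "hi \<noteq> lo" "mid \<noteq> lo"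
    and I: "filling I sg" and I': "filling I' sg'"
    and tri: "triangle_filling I sg hi mid lo e1 e2 e3 mf lf"
    and tri': "triangle_filling I' sg' hi mid lo e1 e2 e3 (\<not> mf) (\<not> lf)"
    and signs: "(e1 = 1 \<longleftrightarrow> e2 = 1) \<longleftrightarrow> (mf \<longleftrightarrow> lf)"
  shows "card (colorings R n (Y \<union> I) sg k) = card (colorings R n (Y \<union> I') sg' k)"
proof (rule card_colorings_eq)
  show "rigid I sg" by (rule triangle_rigid[OF S I tri])
  show "rigid I' sg'" by (rule triangle_rigid[OF S I' tri'])
  show "extends I sg I' sg'" by (rule triangle_move_extends[OF S I I' tri tri' signs])
  show "extends I' sg' I sg" by (rule triangle_move_extends[OF S I' I tri'])
      (use tri in simp, use signs in blast)
qed

end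

section \<open>Reparametrization and the first move\<close>

text \<open>These are the lifts to the real line of orientation-preserving homeomorphisms of the
  circle.\<close>

definition circle_map :: "(real \<Rightarrow> real) \<Rightarrow> bool" where
  "circle_map \<phi> \<longleftrightarrow> strict_mono \<phi> \<and> surj \<phi>
      \<and> (\<forall>t. \<phi> (t + 1) = \<phi> t + 1)"

definition reparam :: "(nat \<Rightarrow> real \<Rightarrow> real) \<Rightarrow> param \<Rightarrow> param" where
  "reparam \<phi> p = (fst p, frac (\<phi> (fst p) (snd p)))"

lemma unit_translation_add_of_int:
  fixes \<phi> :: "real \<Rightarrow> real"
  assumes "\<And>t. \<phi> (t + 1) = \<phi> t + 1"
  shows "\<phi> (t + of_int m) = \<phi> t + of_int m"
proof -
  have nat: "\<phi> (t + of_nat n) = \<phi> t + of_nat n" for t n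
  proof (induction n)
    case (Suc n)
    have "\<phi> (t + of_nat n + 1) = \<phi> (t + of_nat n) + 1" by (rule assms)
    with Suc show ?case by (simp add: algebra_simps)
  qed simp
  show ?thesis
  proof (cases m)
    case (neg n)
    have m: "real_of_int m = - real (Suc n)" using neg by simp
    have "\<phi> t = \<phi> (t - real (Suc n)) + real (Suc n)"
      using nat[of "t - real (Suc n)" "Suc n"] by (simp only: diff_add_cancel)
    moreover have "t + of_int m = t - real (Suc n)" using m by simp
    ultimately show ?thesis using m by (simp only:)
  qed (simp add: nat)
qed

lemma circle_map_add_of_int: "circle_map \<phi> \<Longrightarrow> \<phi> (t + of_int m)
    = \<phi> t + of_int m"
  by (rule unit_translation_add_of_int) (simp add: circle_map_def)

lemma circle_map_inv:
  assumes "circle_map \<phi>"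
  obtains \<psi> where "circle_map \<psi>" "\<And>t. \<phi> (\<psi> t) = t" "\<And>t. \<psi> (\<phi> t) = t"
proof -
  have mono: "strict_mono \<phi>" and surj: "surj \<phi>" using assms by (auto simp: circle_map_def)
  have inj: "inj \<phi>" using mono strict_mono_imp_inj_on by blast
  define \<psi> where "\<psi> = inv \<phi>"
  have \<psi>: "\<phi> (\<psi> t) = t" "\<psi> (\<phi> t) = t" for t
    using inj surj by (simp_all add: \<psi>_def surj_f_inv_f)
  have "strict_mono \<psi>"
  proof (rule strict_monoI)
    fix x y :: real assume "x < y"
    then show "\<psi> x < \<psi> y" using strict_mono_less[OF mono, of "\<psi> x" "\<psi> y"]
        by (simp add: \<psi>(1))
  qed
  moreover have "\<psi> (t + 1) = \<psi> t + 1" for t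
  proof -
    have "\<phi> (\<psi> t + 1) = t + 1" using assms \<psi>(1) by (simp add: circle_map_def)
    then show ?thesis by (metis \<psi>(2))
  qed
  moreover have "surj \<psi>" using \<psi>(2) by (metis surjI)
  ultimately show ?thesis using that \<psi> by (auto simp: circle_map_def)
qed

text \<open>An increasing surjection carries one-sided neighborhoods of \<open>t\<close> to
  one-sided neighborhoods of \<open>\<phi> t\<close> on the same side.\<close>

lemma circle_map_eventually:
  assumes "circle_map \<phi>"
  shows "eventually P (at_left (\<phi> t)) \<Longrightarrow> \<forall>\<^sub>F s in at_left t. P (\<phi> s)"
    and "eventually P (at_right (\<phi> t))
        \<Longrightarrow> \<forall>\<^sub>F s in at_right t. P (\<phi> s)"
proof -
  have mono: "strict_mono \<phi>" and surj: "surj \<phi>" using assms by (auto simp: circle_map_def)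
  show "\<forall>\<^sub>F s in at_left t. P (\<phi> s)" if ev: "eventually P (at_left (\<phi> t))"
  proof -
    obtain c where c: "\<phi> c < \<phi> t" "\<And>y. \<lbrakk>\<phi> c < y; y < \<phi> t\<rbrakk>
        \<Longrightarrow> P y"
      using ev surj unfolding eventually_at_left_field by (metis surjD)
    then show ?thesis
      using mono by (intro eventually_at_leftI[of c]) (auto simp: strict_mono_less)
  qed
  show "\<forall>\<^sub>F s in at_right t. P (\<phi> s)" if ev: "eventually P (at_right (\<phi> t))"
  proof -
    obtain c where c: "\<phi> t < \<phi> c" "\<And>y. \<lbrakk>\<phi> t < y; y < \<phi> c\<rbrakk>
        \<Longrightarrow> P y"
      using ev surj unfolding eventually_at_right_field by (metis surjD)
    then show ?thesis
      using mono by (intro eventually_at_rightI[of _ c]) (auto simp: strict_mono_less)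
  qed
qed

lemma circle_map_frac_eq:
  assumes "circle_map \<phi>"
  shows "frac (\<phi> s) = frac (\<phi> t) \<longleftrightarrow> frac s = frac t"
proof -
  have inj: "\<phi> x = \<phi> y \<Longrightarrow> x = y" for x y
    using assms strict_mono_eq by (auto simp: circle_map_def)
  have int: "frac x = frac y \<longleftrightarrow> (\<exists>m :: int. x = y + of_int m)" for x y :: real
  proof
    assume "frac x = frac y"
    then have "x = y + of_int (\<lfloor>x\<rfloor> - \<lfloor>y\<rfloor>)" by (simp add: frac_def)
    then show "\<exists>m :: int. x = y + of_int m" by blast
  qed (auto simp: frac_add_of_int)
  have "\<phi> s = \<phi> t + of_int m \<longleftrightarrow> s = t + of_int m" for m :: int
    using inj circle_map_add_of_int[OF assms] by metis
  then show ?thesis by (simp add: int)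
qed

lemma reparam_base: "p \<in> base n \<Longrightarrow> reparam \<phi> p \<in> base n"
  by (auto simp: reparam_def base_def frac_lt_1)

lemma inj_on_reparam:
  assumes "\<And>i. i < n \<Longrightarrow> circle_map (\<phi> i)"
  shows "inj_on (reparam \<phi>) (base n)"
proof (rule inj_onI)
  fix p q assume pq: "p \<in> base n" "q \<in> base n" "reparam \<phi> p = reparam \<phi> q"
  then have "fst p = fst q" "frac (\<phi> (fst p) (snd p)) = frac (\<phi> (fst p) (snd q))"
      by (auto simp: reparam_def)
  moreover from this have "frac (snd p) = frac (snd q)"
    using assms[of "fst p"] pq(1) circle_map_frac_eq by (auto simp: base_def)
  ultimately show "p = q" using pq(1,2) by (auto simp: base_def frac_id prod_eq_iff)
qed

context finite_rack
begin

text \<open>The value is taken from the lift because \<open>\<phi>\<close> need not preserve the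
  period from 0 to 1: a parameter carried past an integer has to pick up the twist of its
  component.\<close>

definition pullback :: "nat \<Rightarrow> (nat \<Rightarrow> int) \<Rightarrow> (nat \<Rightarrow> real \<Rightarrow> real) \<Rightarrow> (param \<Rightarrow> 'a) \<Rightarrow> param \<Rightarrow> 'a" where
  "pullback n k \<phi> g = (\<lambda>p\<in>base n. lift R k g (fst p) (\<phi> (fst p) (snd p)))"

lemma pullback_PiE: "g \<in> base n \<rightarrow> carrier R
    \<Longrightarrow> pullback n k \<phi> g \<in> base n \<rightarrow>\<^sub>E carrier R"
  unfolding pullback_def restrict_PiE_iff by (intro ballI lift_closed) (auto simp: base_def)

lemma lift_pullback:
  assumes g: "g \<in> base n \<rightarrow> carrier R" and i: "i < n" and \<phi>: "circle_map (\<phi> i)"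
  shows "lift R k (pullback n k \<phi> g) i t = lift R k g i (\<phi> i t)"
proof -
  have "\<phi> i t = \<phi> i (frac t) + of_int \<lfloor>t\<rfloor>"
    using circle_map_add_of_int[OF \<phi>, of "frac t" "\<lfloor>t\<rfloor>"] by (simp add: frac_def)
  then have "lift R k g i (\<phi> i t)
      = twist R (k i * \<lfloor>t\<rfloor>) (lift R k g i (\<phi> i (frac t)))"
    using lift_add_of_int[OF g i] by simp
  moreover have "(i, frac t) \<in> base n" using i by (simp add: base_def frac_lt_1)
  then have "pullback n k \<phi> g (i, frac t) = lift R k g i (\<phi> i (frac t))"
      by (simp add: pullback_def)
  ultimately show ?thesis by (simp only: lift_def[of R k "pullback n k \<phi> g"])
qed

lemma pullback_coloring:
  assumes \<phi>: "\<And>i. i < n \<Longrightarrow> circle_map (\<phi> i)"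
    and X: "X' \<subseteq> base n \<times> base n" "X = map_prod (reparam \<phi>) (reparam \<phi>) ` X'"
    and sg: "\<And>x. x \<in> X' \<Longrightarrow> sg' x
        = sg (map_prod (reparam \<phi>) (reparam \<phi>) x)"
    and g: "g \<in> colorings R n X sg k"
  shows "pullback n k \<phi> g \<in> colorings R n X' sg' k"
  unfolding colorings_def
proof (intro CollectI conjI allI impI ballI)
  have XX: "X \<subseteq> base n \<times> base n" using X by (force intro: reparam_base)
  note gPi = colorings_Pi[OF g]
  show "pullback n k \<phi> g \<in> base n \<rightarrow>\<^sub>E carrier R" using gPi by (rule pullback_PiE)
  fix i and t :: real assume i: "i < n" and t: "t \<in> {0..<1}"
  note lift = lift_pullback[where \<phi> = \<phi>, OF gPi _ \<phi>]
  show "right_ok (lift R k (pullback n k \<phi> g)) i t"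
    using circle_map_eventually(2)[OF \<phi>[OF i] colorings_ok(1)[OF g i XX, unfolded right_ok_def]]
    by (simp add: right_ok_def lift i)
  have re: "reparam \<phi> (i, frac t) = (i, frac (\<phi> i t))"
    using circle_map_frac_eq[OF \<phi>[OF i], of "frac t" t] by (simp add: reparam_def)
  show "left_ok R X' sg' (lift R k (pullback n k \<phi> g)) i t"
    unfolding left_ok_def
  proof (intro conjI impI allI)
    assume not_under: "(i, frac t) \<notin> snd ` X'"
    have "(i, frac (\<phi> i t)) \<notin> snd ` X"
    proof
      assume "(i, frac (\<phi> i t)) \<in> snd ` X"
      then obtain p q where pq: "(p, q) \<in> X'" "reparam \<phi> q = reparam \<phi> (i, frac t)"
        unfolding X(2) re by force
      have "q = (i, frac t)"
        using inj_onD[OF inj_on_reparam[of n \<phi>, OF \<phi>] pq(2)] X(1) pq(1) i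
            by (auto simp: base_def frac_lt_1)
      then show False using pq(1) not_under by force
    qed
    from left_ok_const[OF colorings_ok(2)[OF g i XX] this]
    show "\<forall>\<^sub>F s in at_left t. lift R k (pullback n k \<phi> g) i t
        = lift R k (pullback n k \<phi> g) i s"
      using circle_map_eventually(1)[OF \<phi>[OF i], of "\<lambda>y. lift R k g i (\<phi> i t)
          = lift R k g i y"]
      by (simp add: lift i)
  next
    fix p assume p: "(p, (i, frac t)) \<in> X'"
    then have "map_prod (reparam \<phi>) (reparam \<phi>) (p, (i, frac t)) \<in> X" unfolding X(2)
        by (rule imageI)
    then have pX: "(reparam \<phi> p, (i, frac (\<phi> i t))) \<in> X" by (simp add: re)
    have pb: "p \<in> base n" using p X(1) by auto
    then have fp: "fst p < n" by (auto simp: base_def)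
    let ?r = "lift R k g (fst (reparam \<phi> p)) (snd (reparam \<phi> p))"
    have rc: "?r \<in> carrier R" using lift_closed[OF gPi] fp by (simp add: reparam_def)
    \<comment> \<open>\<open>\<phi>\<close> may carry the overcrossing out of the base period, which
      twists its color; the twisted color acts as the original one by
      \<open>signed_act_twist\<close>.\<close>
    have "lift R k (pullback n k \<phi> g) (fst p) (snd p) = lift R k g (fst p) (\<phi> (fst p) (snd p))"
      by (rule lift[OF fp fp])
    also have "\<dots> = lift R k g (fst p) (frac (\<phi> (fst p) (snd p)) + of_int \<lfloor>\<phi> (fst p) (snd p)\<rfloor>)"
      by (simp add: frac_def)
    also have "\<dots> = twist R (k (fst p) * \<lfloor>\<phi> (fst p) (snd p)\<rfloor>) ?r"
      unfolding lift_add_of_int[OF gPi fp] by (simp add: reparam_def)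
    finally have over: "lift R k (pullback n k \<phi> g) (fst p) (snd p)
        = twist R (k (fst p) * \<lfloor>\<phi> (fst p) (snd p)\<rfloor>) ?r" .
    have "sg' (p, (i, frac t)) = sg (reparam \<phi> p, (i, frac (\<phi> i t)))" using sg[OF p]
        by (simp add: re)
    then show "\<forall>\<^sub>F s in at_left t. lift R k (pullback n k \<phi> g) i t
        = signed_act R (sg' (p, (i, frac t))) (lift R k (pullback n k \<phi> g) i s)
            (lift R k (pullback n k \<phi> g) (fst p) (snd p))"
      using circle_map_eventually(1)[OF \<phi>[OF i] left_ok_jump[OF colorings_ok(2)[OF g i XX] pX]]
      unfolding over lift[OF i i] by (simp add: signed_act_twist rc lift_closed[OF gPi i])
  qed
qed

lemma card_colorings_reparam:
  assumes \<phi>: "\<And>i. i < n \<Longrightarrow> circle_map (\<phi> i)"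
    and X: "X' \<subseteq> base n \<times> base n" "X = map_prod (reparam \<phi>) (reparam \<phi>) ` X'"
    and sg: "\<And>x. x \<in> X' \<Longrightarrow> sg' x
        = sg (map_prod (reparam \<phi>) (reparam \<phi>) x)"
  shows "card (colorings R n X sg k) = card (colorings R n X' sg' k)"
proof -
  have "\<exists>\<psi>. circle_map \<psi> \<and> (\<forall>t. \<phi> i (\<psi> t) = t)
      \<and> (\<forall>t. \<psi> (\<phi> i t) = t)" if "i < n" for i
    using circle_map_inv[OF \<phi>[OF that]] by metis
  then obtain \<psi> where \<psi>: "\<And>i. i < n \<Longrightarrow> circle_map (\<psi> i)"
    "\<And>i t. i < n \<Longrightarrow> \<phi> i (\<psi> i t) = t"
        "\<And>i t. i < n \<Longrightarrow> \<psi> i (\<phi> i t) = t" by metis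
  have re: "reparam \<psi> (reparam \<phi> p) = p" if "p \<in> base n" for p
  proof -
    have i: "fst p < n" using that by (auto simp: base_def)
    have "frac (\<psi> (fst p) (frac (\<phi> (fst p) (snd p))))
        = frac (\<psi> (fst p) (\<phi> (fst p) (snd p)))"
      by (subst circle_map_frac_eq[OF \<psi>(1)[OF i]]) simp
    then show ?thesis using that i \<psi>(3)[OF i] by (auto simp: reparam_def base_def frac_id)
  qed
  have re2: "map_prod (reparam \<psi>) (reparam \<psi>) (map_prod (reparam \<phi>) (reparam \<phi>) x)
      = x" if "x \<in> X'" for x
    using that X(1) re by (cases x) auto
  have XX: "X \<subseteq> base n \<times> base n" using X by (force intro: reparam_base)
  have inverse: "pullback n k \<alpha> (pullback n k \<beta> g) = g"
    if g: "g \<in> base n \<rightarrow>\<^sub>E carrier R" and \<beta>: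
        "\<And>i. i < n \<Longrightarrow> circle_map (\<beta> i)"
      and inv: "\<And>i t. i < n \<Longrightarrow> \<beta> i (\<alpha> i t) = t" for \<alpha> \<beta> g
  proof (rule PiE_ext[where s = "\<lambda>_. carrier R" and k = "base n"])
    have gPi: "g \<in> base n \<rightarrow> carrier R" using g by auto
    have "pullback n k \<beta> g \<in> base n \<rightarrow>\<^sub>E carrier R" using gPi
        by (rule pullback_PiE)
    then show "pullback n k \<alpha> (pullback n k \<beta> g) \<in> base n \<rightarrow>\<^sub>E carrier R" by (intro pullback_PiE) auto
    fix p assume p: "p \<in> base n"
    then have i: "fst p < n" by (auto simp: base_def)
    show "pullback n k \<alpha> (pullback n k \<beta> g) p = g p"
      using p by (simp add: pullback_def[of n k \<alpha>] lift_pullback[where \<phi> = \<beta>, OF gPi i \<beta>[OF i]] inv[OF i] lift_point[OF gPi p])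
  qed (use g in simp)
  have "bij_betw (pullback n k \<phi>) (colorings R n X sg k) (colorings R n X' sg' k)"
  proof (rule bij_betw_byWitness[where f' = "pullback n k \<psi>"])
    show "pullback n k \<phi> ` colorings R n X sg k \<subseteq> colorings R n X' sg' k"
      using pullback_coloring[where \<phi> = \<phi> and X = X and X' = X' and sg = sg
          and sg' = sg', OF \<phi> X sg] by blast
    have "X' = map_prod (reparam \<psi>) (reparam \<psi>) ` X"
      unfolding X(2) image_image using re2 by auto
    moreover have "sg x = sg' (map_prod (reparam \<psi>) (reparam \<psi>) x)" if "x \<in> X" for x
      using that re2 sg unfolding X(2) by auto
    ultimately show "pullback n k \<psi> ` colorings R n X' sg' k \<subseteq> colorings R n X sg k"
      using pullback_coloring[where \<phi> = \<psi> and X = X' and X' = X and sg = sg'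
          and sg' = sg, OF \<psi>(1) XX] by blast
    show "\<forall>g\<in>colorings R n X sg k. pullback n k \<psi> (pullback n k \<phi> g) = g"
      by (intro ballI inverse \<phi> \<psi>(2)) (rule colorings_PiE)
    show "\<forall>g\<in>colorings R n X' sg' k. pullback n k \<phi> (pullback n k \<psi> g) = g"
      by (intro ballI inverse \<psi>(1,3)) (rule colorings_PiE)
  qed
  then show ?thesis by (rule bij_betw_same_card)
qed

subsection \<open>The first move\<close>

text \<open>The exponent \<open>c\<close> has to be constant only near \<open>t\<close> on the
  understrand: there the twist commutes with the action, while the exponent at the overcrossing may
  be arbitrary, as twisting the acting color changes nothing.\<close>

lemma left_ok_twist:
  assumes X: "X \<subseteq> base n \<times> base n" and i: "i < n"
    and closed: "\<And>j s. j < n \<Longrightarrow> f j s \<in> carrier R"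
    and f': "\<And>j s. j < n \<Longrightarrow> f' j s = twist R (c j s) (f j s)"
    and const: "\<forall>\<^sub>F s in at_left t. c i s = c i t"
    and ok: "left_ok R X sg f i t"
  shows "left_ok R X sg f' i t"
  unfolding left_ok_def
proof (intro conjI impI allI)
  assume "(i, frac t) \<notin> snd ` X"
  from const left_ok_const[OF ok this] show "\<forall>\<^sub>F s in at_left t. f' i t = f' i s"
    by eventually_elim (simp add: f' i)
next
  fix p assume p: "(p, (i, frac t)) \<in> X"
  then have fp: "fst p < n" using X by (auto simp: base_def)
  from const left_ok_jump[OF ok p]
  show "\<forall>\<^sub>F s in at_left t. f' i t
      = signed_act R (sg (p, (i, frac t))) (f' i s) (f' (fst p) (snd p))"
    by eventually_elim (simp add: f' i fp closed signed_act_twist twist_signed_act twist_closed)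
qed

lemma right_ok_twist:
  assumes "\<And>s. f' i s = twist R (c s) (f i s)" and "\<forall>\<^sub>F s in at_right t. c s = c t"
      and "right_ok f i t"
  shows "right_ok f' i t"
  using assms(2,3) unfolding right_ok_def by eventually_elim (simp add: assms(1))

text \<open>
  A kink of sign \<open>e\<close> on component \<open>i\<close> with undercrossing at \<open>v\<close> multiplies the colors behind
  \<open>v\<close> by \<open>e\<close> twists; on the universal cover of the component this is a staircase function.
\<close>

definition stair :: "nat \<Rightarrow> real \<Rightarrow> int \<Rightarrow> nat \<Rightarrow> real \<Rightarrow> int" where
  "stair i v e j t = (if j = i then e * \<lfloor>t - v + 1\<rfloor> else 0)"

definition add_kink :: "nat \<Rightarrow> nat \<Rightarrow> real \<Rightarrow> int \<Rightarrow> (param \<Rightarrow> 'a) \<Rightarrow> param \<Rightarrow> 'a" where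
  "add_kink n i v e g = (\<lambda>p\<in>base n. twist R (stair i v e (fst p) (snd p)) (g p))"

text \<open>The staircase rises by \<open>e\<close> in each period, and this rise is absorbed by
  increasing the twist of component \<open>i\<close> from \<open>k i\<close> to
  \<open>k i + e\<close>.\<close>

lemma lift_add_kink:
  assumes g: "g \<in> base n \<rightarrow> carrier R" and j: "j < n" and k': "k' = k(i := k i + e)"
  shows "lift R k' (add_kink n i v e g) j t = twist R (stair i v e j t) (lift R k g j t)"
proof -
  have b: "(j, frac t) \<in> base n" using j by (simp add: base_def frac_lt_1)
  then have c: "g (j, frac t) \<in> carrier R" using g by auto
  have "\<lfloor>t - v + 1\<rfloor> = \<lfloor>frac t - v + 1\<rfloor> + \<lfloor>t\<rfloor>"
  proof -
    have "t - v + 1 = (frac t - v + 1) + of_int \<lfloor>t\<rfloor>" by (simp add: frac_def)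
    then show ?thesis by (metis floor_add_int)
  qed
  then have "k' j * \<lfloor>t\<rfloor> + stair i v e j (frac t)
      = stair i v e j t + k j * \<lfloor>t\<rfloor>"
    by (simp add: k' stair_def algebra_simps)
  then show ?thesis using b c by (simp add: lift_def add_kink_def flip: twist_add)
qed

lemma stair_right: "\<forall>\<^sub>F s in at_right t. stair i v e j s = stair i v e j t"
proof -
  have "\<forall>\<^sub>F s in at_right t. \<lfloor>s - v + 1\<rfloor> = \<lfloor>t - v + 1\<rfloor>"
  proof (rule eventually_at_rightI[of _ "of_int \<lfloor>t - v + 1\<rfloor> + v"])
    show "t < of_int \<lfloor>t - v + 1\<rfloor> + v" by linarith
    fix s assume "s \<in> {t<..<of_int \<lfloor>t - v + 1\<rfloor> + v}"
    then show "\<lfloor>s - v + 1\<rfloor> = \<lfloor>t - v + 1\<rfloor>"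
        by (auto simp: floor_eq_iff) linarith+
  qed
  then show ?thesis by eventually_elim (simp add: stair_def)
qed

lemma stair_left:
  assumes "0 < v" "v < 1" "0 \<le> t" "t < 1" "j = i \<Longrightarrow> t \<noteq> v"
  shows "\<forall>\<^sub>F s in at_left t. stair i v e j s = stair i v e j t"
proof (cases "j = i")
  case True
  define c where "c = (if t < v then v - 1 else v)"
  have "c < t" using assms True by (auto simp: c_def)
  then show ?thesis
  proof (rule eventually_at_leftI[rotated])
    fix s assume s: "s \<in> {c<..<t}"
    have "\<lfloor>s - v + 1\<rfloor> = (if t < v then 0 else 1)"
        "\<lfloor>t - v + 1\<rfloor> = (if t < v then 0 else 1)"
      using s assms True by (intro floor_unique; auto simp: c_def split: if_splits)+
    then show "stair i v e j s = stair i v e j t" by (simp add: stair_def)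
  qed
qed (simp add: stair_def)

lemma stair_at:
  assumes "0 < v" "v < 1" "0 < t" "t < 1"
  shows "stair i v e i t = (if t < v then 0 else e)"
proof -
  have "\<lfloor>t - v + 1\<rfloor> = (if t < v then 0 else 1)" using assms by (intro floor_unique) auto
  then show ?thesis by (simp add: stair_def)
qed

lemma add_kink_inverse:
  assumes "g \<in> base n \<rightarrow>\<^sub>E carrier R"
  shows "add_kink n i v (- e) (add_kink n i v e g) = g"
proof (rule PiE_ext[where s = "\<lambda>_. carrier R" and k = "base n"])
  have neg: "stair i v (- e) j t = - stair i v e j t" for j t by (simp add: stair_def)
  show "add_kink n i v (- e) (add_kink n i v e g) \<in> base n \<rightarrow>\<^sub>E carrier R"
    using assms by (auto simp: add_kink_def intro!: twist_closed)
  show "add_kink n i v (- e) (add_kink n i v e g) p = g p" if "p \<in> base n" for p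
    using assms that by (auto simp: add_kink_def neg intro!: twist_cancel)
qed (rule assms)

text \<open>On the strand of the kink a color meets only itself up to twists, and twists act
  trivially, so the jump at \<open>v\<close> is the twist by \<open>e\<close>. Adding the staircase
  creates exactly this jump, subtracting it removes the jump, and all other crossings are
  unaffected.\<close>

lemma card_colorings_move1:
  assumes X: "X \<subseteq> base n \<times> base n" and X': "X' = insert ((i, u), (i, v)) X"
    and i: "i < n" and pts: "0 < a" "a < u" "u < b" "a < v" "v < b" "b < 1" "u \<noteq> v"
    and clean: "\<And>t. \<lbrakk>a < t; t < b\<rbrakk> \<Longrightarrow> (i, t) \<notin> snd ` X"
    and sg: "\<And>x. x \<in> X \<Longrightarrow> sg' x = sg x" and e: "e = sg' ((i, u), (i, v))"
        "e = 1 \<or> e = - 1"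
    and k': "k' = k(i := k i + e)"
  shows "card (colorings R n X sg k) = card (colorings R n X' sg' k')"
proof -
  have X'b: "X' \<subseteq> base n \<times> base n" using X X' i pts by (auto simp: base_def)
  have sgX: "colorings R n X sg k = colorings R n X sg' k" using sg X by (intro colorings_cong) auto
  have ub: "(i, u) \<in> base n" and vb: "(i, v) \<in> base n" using i pts by (auto simp: base_def)
  have under: "(p, (j, t)) \<in> X' \<longleftrightarrow> (p, (j, t)) \<in> X" if
      "(j, t) \<noteq> (i, v)" for p j t
    using that by (auto simp: X')
  have v_under: "(i, v) \<notin> snd ` X" using clean pts by auto
  have fv: "frac v = v" using pts by (intro frac_id) auto
  have fX: "left_ok R X' sg' f j t \<longleftrightarrow> left_ok R X sg' f j t" if
      "(j, frac t) \<noteq> (i, v)" for f j t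
    using under[OF that] by (auto simp: left_ok_def image_iff) 
  have forward: "add_kink n i v e g \<in> colorings R n X' sg' k'" if g: "g \<in> colorings R n X sg' k"
      for g
    unfolding colorings_def
  proof (intro CollectI conjI allI impI ballI)
    note gPi = colorings_Pi[OF g]
    show "add_kink n i v e g \<in> base n \<rightarrow>\<^sub>E carrier R"
      using gPi by (auto simp: add_kink_def intro!: twist_closed)
    note lift = lift_add_kink[OF gPi _ k']
    fix j and t :: real assume j: "j < n" and t: "t \<in> {0..<1}"
    show "right_ok (lift R k' (add_kink n i v e g)) j t"
      by (rule right_ok_twist[where c = "stair i v e j" and f = "lift R k g"])
        (auto simp: lift j stair_right colorings_ok(1)[OF g j X])
    show "left_ok R X' sg' (lift R k' (add_kink n i v e g)) j t"
    proof (cases "(j, t) = (i, v)")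
      case False
      then show ?thesis using t pts
        by (subst fX) (auto simp: frac_id intro!: left_ok_twist[OF X j lift_closed[OF gPi] lift]
            stair_left colorings_ok(2)[OF g j X])
    next
      case True
      have const: "g (i, s) = g (i, v)" if "a < s" "s < b" for s
      proof -
        have "lift R k g i (max s v) = lift R k g i (min s v)"
          using that pts clean by (intro coloring_const[OF g i X]) (auto simp: frac_id)
        then show ?thesis using that pts
            by (auto simp: lift_coloring[OF gPi i] max_def min_def split: if_splits)
      qed
      have yc: "g (i, v) \<in> carrier R" using gPi vb by auto
      have l: "lift R k' (add_kink n i v e g) i s = twist R (if s < v then 0 else e) (g (i, v))"
        if "a < s" "s < b" for s
        using that pts i const[OF that] by (simp add: lift stair_at lift_coloring[OF gPi])
      have "left_ok R X' sg' (lift R k' (add_kink n i v e g)) i v"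
        unfolding left_ok_def fv
      proof (intro conjI impI allI)
        assume "(i, v) \<notin> snd ` X'"
        then show "\<forall>\<^sub>F s in at_left v. lift R k' (add_kink n i v e g) i v
            = lift R k' (add_kink n i v e g) i s"
          by (simp add: X')
      next
        fix p assume p: "(p, (i, v)) \<in> X'"
        then have p: "p = (i, u)" using v_under by (force simp: X')
        have "\<forall>\<^sub>F s in at_left v. s \<in> {a<..<v}" using pts
            by (intro eventually_at_leftI[of a]) auto
        then show "\<forall>\<^sub>F s in at_left v. lift R k' (add_kink n i v e g) i v
            = signed_act R (sg' (p, (i, v))) (lift R k' (add_kink n i v e g) i s)
                (lift R k' (add_kink n i v e g) (fst p) (snd p))"
          by eventually_elim
            (use pts yc e(2) e(1)[symmetric] in \<open>simp add: l p twist_0 signed_act_twist signed_act_self\<close>)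
      qed
      then show ?thesis using True by simp
    qed
  qed
  have backward: "add_kink n i v (- e) g \<in> colorings R n X sg' k" if g:
      "g \<in> colorings R n X' sg' k'" for g
    unfolding colorings_def
  proof (intro CollectI conjI allI impI ballI)
    note gPi = colorings_Pi[OF g]
    show "add_kink n i v (- e) g \<in> base n \<rightarrow>\<^sub>E carrier R"
      using gPi by (auto simp: add_kink_def intro!: twist_closed)
    have k: "k = k'(i := k' i + - e)" using k' by auto
    note lift = lift_add_kink[OF gPi _ k]
    fix j and t :: real assume j: "j < n" and t: "t \<in> {0..<1}"
    show "right_ok (lift R k (add_kink n i v (- e) g)) j t"
      by (rule right_ok_twist[where c = "stair i v (- e) j" and f = "lift R k' g"])
        (auto simp: lift j stair_right colorings_ok(1)[OF g j X'b])
    show "left_ok R X sg' (lift R k (add_kink n i v (- e) g)) j t"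
    proof (cases "(j, t) = (i, v)")
      case False
      then show ?thesis using t pts
        by (subst fX[symmetric]) (auto simp: frac_id intro!: left_ok_twist[OF X'b j lift_closed[OF gPi] lift]
            stair_left colorings_ok(2)[OF g j X'b])
    next
      case True
      have X'_under: "(i, s) \<notin> snd ` X'" if "a < s" "s < b" "s \<noteq> v" for s
        using clean that by (auto simp: X')
      have const: "g (i, t) = g (i, s)" if "a < s" "s \<le> t" "t < b" "t < v \<or> v \<le> s" for s t
      proof -
        have "lift R k' g i t = lift R k' g i s"
        proof (rule coloring_const[OF g i X'b that(2)])
          fix q assume "s < q" "q \<le> t"
          then have "frac q = q" "a < q" "q < b" "q \<noteq> v" using that pts by (auto intro: frac_id)
          then show "(i, frac q) \<notin> snd ` X'" by (simp add: X'_under)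
        qed
        then show ?thesis using that pts by (auto simp: lift_coloring[OF gPi i])
      qed
      have jump: "g (i, v) = twist R e (g (i, s))" if s: "a < s" "s < v" for s
      proof -
        have sc: "g (i, s) \<in> carrier R" "g (i, v) \<in> carrier R" using gPi i s pts
            by (auto simp: base_def)
        have "lift R k' g i v = signed_act R (sg' ((i, u), (i, frac v))) (lift R k' g i s) (g (i, u))"
        proof (rule coloring_jump[OF g i X'b s(2)])
          fix q assume "s < q" "q < v"
          then have "frac q = q" "a < q" "q < b" "q \<noteq> v" using s pts by (auto intro: frac_id)
          then show "(i, frac q) \<notin> snd ` X'" by (simp add: X'_under)
        qed (simp add: fv X')
        then have *: "g (i, v) = signed_act R e (g (i, s)) (g (i, u))"
          using s pts e by (simp add: fv lift_coloring[OF gPi i])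
        \<comment> \<open>If the overcrossing comes first, the acting color is the incoming one;
          otherwise it is the outgoing one, and the relation is an equation for a color that acts in
          its own definition. Both cases give the twist by \<open>e\<close>.\<close>
        show ?thesis
        proof (cases "u < v")
          case True
          have "g (i, u) = g (i, s)" using True s pts const[of u s] const[of s u] by (cases
              "u \<le> s") auto
          then show ?thesis using * sc e by (simp add: signed_act_self)
        next
          case False
          then have "g (i, u) = g (i, v)" using pts by (intro const) auto
          then show ?thesis using * sc e by (intro signed_act_fixed) auto
        qed
      qed
      \<comment> \<open>The sample point halfway between \<open>a\<close> and \<open>v\<close>
        carries the color ahead of the undercrossing; after untwisting, this color persists up to
        and including \<open>v\<close>.\<close>
      have l: "lift R k (add_kink n i v (- e) g) i s = g (i, (a + v) / 2)" if s: "a < s" "s \<le> v" for s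
      proof (cases "s = v")
        case True
        have "g (i, (a + v) / 2) \<in> carrier R" using gPi i pts by (auto simp: base_def)
        then show ?thesis
          using True pts i jump[of "(a + v) / 2"]
              by (simp add: lift stair_at lift_coloring[OF gPi] twist_cancel)
      next
        case False
        have "g (i, s) = g (i, (a + v) / 2)"
          using False s pts const[of s "(a + v) / 2"] const[of "(a + v) / 2" s] by (cases
              "s \<le> (a + v) / 2") auto
        moreover have "g (i, s) \<in> carrier R" using gPi i s pts by (auto simp: base_def)
        ultimately show ?thesis
          using False s pts i by (simp add: lift stair_at lift_coloring[OF gPi] twist_0)
      qed
      have "left_ok R X sg' (lift R k (add_kink n i v (- e) g)) i v"
        unfolding left_ok_def fv
      proof (intro conjI impI allI)
        show "\<forall>\<^sub>F s in at_left v. lift R k (add_kink n i v (- e) g) i v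
            = lift R k (add_kink n i v (- e) g) i s"
          using pts by (intro eventually_at_leftI[of a]) (auto simp: l)
      qed (use v_under in force)
      then show ?thesis using True by simp
    qed
  qed
  have "bij_betw (add_kink n i v e) (colorings R n X sg' k) (colorings R n X' sg' k')"
  proof (rule bij_betw_byWitness[where f' = "add_kink n i v (- e)"])
    show "\<forall>g\<in>colorings R n X sg' k. add_kink n i v (- e) (add_kink n i v e g) = g"
      by (intro ballI add_kink_inverse) (rule colorings_PiE)
    show "\<forall>g\<in>colorings R n X' sg' k'. add_kink n i v e (add_kink n i v (- e) g) = g"
    proof
      fix g assume "g \<in> colorings R n X' sg' k'"
      from add_kink_inverse[OF colorings_PiE[OF this], of i v "- e"]
      show "add_kink n i v e (add_kink n i v (- e) g) = g" by simp
    qed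
  qed (use forward backward in \<open>simp_all add: image_subset_iff\<close>)
  then show ?thesis unfolding sgX by (rule bij_betw_same_card)
qed

end

section \<open>Arcs and colorings\<close>

locale generic_diagram =
  fixes D :: diagram
  assumes link_diagram: "link_diagram D"
begin

lemma params_eq: "params D = base (ncomps D)"
  by (simp add: params_def base_def)

lemma classical_double: "classical D \<subseteq> double_points D"
  using link_diagram by (simp add: link_diagram_def)

lemma classical_base: "classical D \<subseteq> base (ncomps D) \<times> base (ncomps D)"
  using classical_double by (auto simp: double_points_def params_eq)

lemma finite_double: "finite (double_points D)"
  using link_diagram by (simp add: link_diagram_def)

lemma finite_classical: "finite (classical D)"
  using classical_double finite_double by (rule finite_subset)

lemma double_sym: "(p, q) \<in> double_points D \<Longrightarrow> (q, p) \<in> double_points D"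
  by (auto simp: double_points_def)

lemma double_unique: "\<lbrakk>(p, q) \<in> double_points D; (p, r) \<in> double_points D\<rbrakk>
    \<Longrightarrow> q = r"
  using link_diagram unfolding link_diagram_def by blast

lemma classical_asym: "(p, q) \<in> classical D \<Longrightarrow> (q, p) \<notin> classical D"
  using link_diagram unfolding link_diagram_def by blast

text \<open>A parameter has only one partner among the double points, so a point both over and under
  would make one crossing classical in both directions.\<close>

lemma over_not_under: "(p, q) \<in> classical D \<Longrightarrow> p \<notin> under_params D"
proof
  assume pq: "(p, q) \<in> classical D" and "p \<in> under_params D"
  then obtain r where r: "(r, p) \<in> classical D" by (auto simp: under_params_def)
  have "r = q" using double_unique[of p r q] double_sym[of r p] classical_double pq r by blast
  then show False using classical_asym[OF pq] r by simp
qed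

text \<open>Undercrossings are isolated on the universal cover: there are finitely many parameters,
  and only finitely many of their integer translates are within distance 1 of
  \<open>t\<close>.\<close>

lemma near_free:
  obtains d where "d > 0" "\<And>u. \<lbrakk>u \<noteq> t; \<bar>u - t\<bar> < d\<rbrakk>
      \<Longrightarrow> (i, frac u) \<notin> under_params D"
proof -
  let ?B = "{u \<in> {t - 1..t + 1}. (i, frac u) \<in> under_params D}"
  have "?B \<subseteq> (\<lambda>(m, p). of_int m + snd p) ` ({\<lfloor>t - 1\<rfloor>..\<lfloor>t + 1\<rfloor>} \<times> under_params D)"
  proof
    fix u assume u: "u \<in> ?B"
    then have "\<lfloor>u\<rfloor> \<in> {\<lfloor>t - 1\<rfloor>..\<lfloor>t + 1\<rfloor>}"
      using floor_mono[of "t - 1" u] floor_mono[of u "t + 1"] by simp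
    then show "u \<in> (\<lambda>(m, p). of_int m + snd p) ` ({\<lfloor>t - 1\<rfloor>..\<lfloor>t + 1\<rfloor>} \<times> under_params D)"
      using u by (intro image_eqI[of _ _ "(\<lfloor>u\<rfloor>, (i, frac u))"]) (auto simp: frac_def)
  qed
  moreover have "finite (under_params D)" using finite_classical by (simp add: under_params_def)
  ultimately have "finite ?B" by (meson finite_SigmaI finite_atLeastAtMost_int finite_imageI finite_subset)
  then obtain d where d: "d > 0" "\<And>u. \<lbrakk>u \<in> ?B; u \<noteq> t\<rbrakk>
      \<Longrightarrow> d \<le> dist t u"
    using finite_set_avoid[of ?B t] by blast
  have "(i, frac u) \<notin> under_params D" if "u \<noteq> t" "\<bar>u - t\<bar> < min d 1" for u
    using d(2)[of u] that by (auto simp: dist_real_def abs_if split: if_splits)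
  then show ?thesis using that[of "min d 1"] d(1) by simp
qed

lemma arc_of_segment:
  assumes "\<And>u. u \<in> closed_segment t s \<Longrightarrow> (i, frac u) \<notin> under_params D"
  shows "arc_of D i t = arc_of D i s"
proof -
  have sub: "arc_of D i t \<subseteq> arc_of D i s"
    if "\<And>u. u \<in> closed_segment t s \<Longrightarrow> (i, frac u) \<notin> under_params D" for t s
  proof
    fix p assume "p \<in> arc_of D i t"
    then obtain r where r: "p = (i, frac r)" "\<And>u. u \<in> closed_segment t r
        \<Longrightarrow> (i, frac u) \<notin> under_params D"
      by (auto simp: arc_of_def)
    have "closed_segment s r \<subseteq> closed_segment t s \<union> closed_segment t r"
      by (auto simp: closed_segment_eq_real_ivl split: if_splits)
    then have "\<forall>u\<in>closed_segment s r. (i, frac u) \<notin> under_params D" using that r(2)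
        by blast
    then show "p \<in> arc_of D i s" using r(1) by (auto simp: arc_of_def)
  qed
  show ?thesis using sub[of t s] sub[of s t] assms by (auto simp: closed_segment_commute)
qed

lemma arc_of_add_of_int: "arc_of D i (t + of_int m) = arc_of D i t"
proof -
  have sub: "arc_of D i t \<subseteq> arc_of D i (t + of_int m)" for t and m :: int
  proof
    fix p assume "p \<in> arc_of D i t"
    then obtain r where r: "p = (i, frac r)" "\<And>u. u \<in> closed_segment t r
        \<Longrightarrow> (i, frac u) \<notin> under_params D"
      by (auto simp: arc_of_def)
    have "(i, frac u) \<notin> under_params D" if "u \<in> closed_segment (t + of_int m) (r + of_int m)"
        for u
    proof -
      have "u + of_int (- m) \<in> closed_segment t r"
        using that by (auto simp: closed_segment_eq_real_ivl split: if_splits)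
      then show ?thesis using r(2) frac_add_of_int[of u "- m"] by metis
    qed
    then show "p \<in> arc_of D i (t + of_int m)"
      unfolding arc_of_def r(1) using frac_add_of_int[of r m] by (intro CollectI exI[of _
          "r + of_int m"]) auto
  qed
  show ?thesis using sub[of t m] sub[of "t + of_int m" "- m"] by auto
qed

lemma arc_of_frac: "arc_of D i (frac t) = arc_of D i t"
  using arc_of_add_of_int[of i "frac t" "\<lfloor>t\<rfloor>"] by (simp add: frac_def)

lemma arc_of_mem: "(i, frac t) \<notin> under_params D \<Longrightarrow> (i, frac t) \<in> arc_of D i t"
  by (auto simp: arc_of_def intro!: exI[of _ t])

lemma arc_of_arcs:
  assumes "i < ncomps D" "(i, frac t) \<notin> under_params D"
  shows "arc_of D i t \<in> arcs D"
  unfolding arcs_def arc_of_frac[of i t, symmetric] using assms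
  by (intro CollectI exI[of _ i] exI[of _ "frac t"]) (auto simp: params_def frac_lt_1)

text \<open>Isolation of the undercrossings makes the arc just behind \<open>t\<close> eventually
  constant, which justifies the definite description in \<open>arc_after\<close>.\<close>

lemma arc_after:
  obtains d where "d > 0" "\<And>s. \<lbrakk>t < s; s < t + d\<rbrakk>
      \<Longrightarrow> (i, frac s) \<notin> under_params D \<and> arc_of D i s = arc_after D (i, t)"
proof -
  obtain d where d: "d > 0" "\<And>u. \<lbrakk>u \<noteq> t; \<bar>u - t\<bar> < d\<rbrakk>
      \<Longrightarrow> (i, frac u) \<notin> under_params D" using near_free by blast
  define A where "A = arc_of D i (t + d / 2)"
  have A: "arc_of D i s = A" if "t < s" "s < t + d" for s
    unfolding A_def using that d by (intro arc_of_segment d(2))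
        (auto simp: closed_segment_eq_real_ivl split: if_splits)
  have ev: "\<forall>\<^sub>F s in at_right t. arc_of D i s = A"
    using d(1) A by (intro eventually_at_rightI[of _ "t + d"]) auto
  have uniq: "B = A" if "\<forall>\<^sub>F s in at_right t. arc_of D i s = B" for B
  proof -
    from ev that have "\<forall>\<^sub>F s in at_right t. B = A" by eventually_elim simp
    then show ?thesis by simp
  qed
  have "arc_after D (i, t) = A"
    unfolding arc_after_def fst_conv snd_conv using ev by (rule the_equality) (rule uniq)
  then show ?thesis using that[of d] d A by auto
qed

lemma arc_before:
  obtains d where "d > 0" "\<And>s. \<lbrakk>t - d < s; s < t\<rbrakk>
      \<Longrightarrow> (i, frac s) \<notin> under_params D \<and> arc_of D i s = arc_before D (i, t)"
proof -
  obtain d where d: "d > 0" "\<And>u. \<lbrakk>u \<noteq> t; \<bar>u - t\<bar> < d\<rbrakk>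
      \<Longrightarrow> (i, frac u) \<notin> under_params D" using near_free by blast
  define A where "A = arc_of D i (t - d / 2)"
  have A: "arc_of D i s = A" if "t - d < s" "s < t" for s
    unfolding A_def using that d by (intro arc_of_segment d(2))
        (auto simp: closed_segment_eq_real_ivl split: if_splits)
  have ev: "\<forall>\<^sub>F s in at_left t. arc_of D i s = A"
    using d(1) A by (intro eventually_at_leftI[of "t - d"]) auto
  have uniq: "B = A" if "\<forall>\<^sub>F s in at_left t. arc_of D i s = B" for B
  proof -
    from ev that have "\<forall>\<^sub>F s in at_left t. B = A" by eventually_elim simp
    then show ?thesis by simp
  qed
  have "arc_before D (i, t) = A"
    unfolding arc_before_def fst_conv snd_conv using ev by (rule the_equality) (rule uniq)
  then show ?thesis using that[of d] d A by auto
qed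

lemma arc_after_arcs: "i < ncomps D \<Longrightarrow> arc_after D (i, t) \<in> arcs D"
proof -
  assume i: "i < ncomps D"
  obtain d where "d > 0" "\<And>s. \<lbrakk>t < s; s < t + d\<rbrakk>
      \<Longrightarrow> (i, frac s) \<notin> under_params D \<and> arc_of D i s = arc_after D (i, t)"
    using arc_after by blast
  from this(1) this(2)[of "t + d / 2"] show ?thesis using arc_of_arcs[OF i, of "t + d / 2"] by auto
qed

lemma arc_before_arcs: "i < ncomps D \<Longrightarrow> arc_before D (i, t) \<in> arcs D"
proof -
  assume i: "i < ncomps D"
  obtain d where "d > 0" "\<And>s. \<lbrakk>t - d < s; s < t\<rbrakk>
      \<Longrightarrow> (i, frac s) \<notin> under_params D \<and> arc_of D i s = arc_before D (i, t)"
    using arc_before by blast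
  from this(1) this(2)[of "t - d / 2"] show ?thesis using arc_of_arcs[OF i, of "t - d / 2"] by auto
qed

lemma arc_after_free:
  assumes "(i, frac t) \<notin> under_params D"
  shows "arc_after D (i, t) = arc_of D i t"
proof -
  obtain d where d: "d > 0" "\<And>s. \<lbrakk>t < s; s < t + d\<rbrakk>
      \<Longrightarrow> (i, frac s) \<notin> under_params D \<and> arc_of D i s = arc_after D (i, t)"
    using arc_after by blast
  have "arc_of D i t = arc_of D i (t + d / 2)"
  proof (rule arc_of_segment)
    fix u assume "u \<in> closed_segment t (t + d / 2)"
    then have "u = t \<or> t < u \<and> u < t + d" using d(1) by (auto simp: closed_segment_eq_real_ivl)
    then show "(i, frac u) \<notin> under_params D" using assms d(2) by blast
  qed
  then show ?thesis using d(1) d(2)[of "t + d / 2"] by simp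
qed

lemma arcs_arc_after: "arcs D = arc_after D ` (base (ncomps D) - under_params D)"
proof -
  have "arc_after D p = arc_of D (fst p) (snd p)" if "p \<in> base (ncomps D) - under_params D" for p
    using that arc_after_free[of "fst p" "snd p"] by (auto simp: base_def frac_id)
  then have "arc_after D ` (base (ncomps D) - under_params D)
      = (\<lambda>p. arc_of D (fst p) (snd p)) ` (base (ncomps D) - under_params D)"
    by (intro image_cong) auto
  also have "\<dots> = arcs D"
  proof (intro equalityI subsetI)
    fix A assume "A \<in> arcs D"
    then obtain i t where "A = arc_of D i t" "(i, t) \<in> base (ncomps D) - under_params D"
      unfolding arcs_def params_eq by blast
    then show "A \<in> (\<lambda>p. arc_of D (fst p) (snd p)) ` (base (ncomps D) - under_params D)"
      by (intro image_eqI[of _ _ "(i, t)"]) simp_all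
  next
    fix A assume "A \<in> (\<lambda>p. arc_of D (fst p) (snd p)) ` (base (ncomps D) - under_params D)"
    then obtain i t where "A = arc_of D i t" "(i, t) \<in> base (ncomps D) - under_params D" by auto
    then show "A \<in> arcs D" unfolding arcs_def params_eq by blast
  qed
  finally show ?thesis by simp
qed

lemma over_arc:
  assumes "(p, q) \<in> classical D"
  shows "over_arc D (p, q) = arc_after D p" "over_arc D (p, q) \<in> arcs D"
proof -
  have "p \<in> base (ncomps D)" using assms classical_base by auto
  then have p: "fst p < ncomps D" "frac (snd p) = snd p" by (auto simp: base_def frac_id)
  then have "(fst p, frac (snd p)) \<notin> under_params D" using over_not_under[OF assms] by simp
  then show "over_arc D (p, q) = arc_after D p" using arc_after_free[of "fst p" "snd p"]
      by (simp add: over_arc_def)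
  then show "over_arc D (p, q) \<in> arcs D" using arc_after_arcs[OF p(1), of "snd p"] by simp
qed

lemma side_arcs:
  assumes "(p, q) \<in> classical D"
  shows "left_arc D (p, q) \<in> arcs D" "right_arc D (p, q) \<in> arcs D"
proof -
  have "q \<in> base (ncomps D)" using assms classical_base by auto
  then have "fst q < ncomps D" by (auto simp: base_def)
  then have "arc_after D q \<in> arcs D" "arc_before D q \<in> arcs D"
    using arc_after_arcs[of "fst q" "snd q"] arc_before_arcs[of "fst q" "snd q"] by simp_all
  then show "left_arc D (p, q) \<in> arcs D" "right_arc D (p, q) \<in> arcs D"
    by (simp_all add: left_arc_def right_arc_def)
qed

end

locale colored_diagram = generic_diagram D + finite_rack R
  for D :: diagram and R :: "('a, 'm) rack_scheme" (structure)
begin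

definition arc_colorings :: "(param set \<Rightarrow> 'a) set" where
  "arc_colorings = {h \<in> arcs D \<rightarrow>\<^sub>E carrier R. \<forall>x\<in>classical D.
     h (left_arc D x) = h (right_arc D x) \<triangleright> h (over_arc D x)}"

lemma card_fundamental_rack_hom: "card (rack_hom (fundamental_rack D) R) = card arc_colorings"
proof -
  let ?Rel = "{(Gen (left_arc D x), Act (Gen (right_arc D x)) (Gen (over_arc D x))) | x. x \<in> classical D}"
  interpret presentation "arcs D" ?Rel
  proof
    show "?Rel \<subseteq> terms_over (arcs D) \<times> terms_over (arcs D)"
    proof
      fix r assume "r \<in> ?Rel"
      then obtain p q where "(p, q) \<in> classical D"
        "r = (Gen (left_arc D (p, q)), Act (Gen (right_arc D (p, q))) (Gen (over_arc D (p, q))))" by auto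
      then show "r \<in> terms_over (arcs D) \<times> terms_over (arcs D)" using side_arcs over_arc(2)
          by simp
    qed
  qed
  have "(\<forall>(s, t)\<in>?Rel. term_eval R g s = term_eval R g t) \<longleftrightarrow>
      (\<forall>x\<in>classical D. g (left_arc D x) = g (right_arc D x) \<triangleright> g
          (over_arc D x))" for g
    unfolding Ball_def mem_Collect_eq by force
  then have "{g \<in> arcs D \<rightarrow>\<^sub>E carrier R. \<forall>(s, t)\<in>?Rel. term_eval R g s
      = term_eval R g t} = arc_colorings"
    unfolding arc_colorings_def by simp
  then show ?thesis
    using bij_betw_same_card[OF bij_betw_rack_hom[OF rack_axioms]] by (simp add: fundamental_rack_def)
qed

text \<open>At an undercrossing \<open>arc_of\<close> is empty, because its segment contains the
  undercrossing itself. Using \<open>arc_after\<close> gives the outgoing color there, in accordance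
  with right continuity.\<close>

definition spread :: "(param set \<Rightarrow> 'a) \<Rightarrow> param \<Rightarrow> 'a" where
  "spread h = (\<lambda>p\<in>base (ncomps D). h (arc_after D p))"

lemma lift_0:
  assumes "g \<in> base (ncomps D) \<rightarrow> carrier R" "i < ncomps D"
  shows "lift R (\<lambda>_. 0) g i t = g (i, frac t)"
proof -
  have "(i, frac t) \<in> base (ncomps D)" using assms(2) by (simp add: base_def frac_lt_1)
  then show ?thesis using assms(1) by (auto simp: lift_def intro!: twist_0)
qed

lemma spread_PiE: "h \<in> arcs D \<rightarrow> carrier R
    \<Longrightarrow> spread h \<in> base (ncomps D) \<rightarrow>\<^sub>E carrier R"
  unfolding spread_def restrict_PiE_iff using arc_after_arcs by (auto simp: base_def)

lemma signed_act_iff: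
  assumes "x \<in> carrier R" "y \<in> carrier R" "z \<in> carrier R"
  shows "z = signed_act R e y x \<longleftrightarrow> (if e = 1 then z = y \<triangleright> x else y
      = z \<triangleright> x)"
  using assms by (auto simp: signed_act_def act_inv_act inv_act_act)

text \<open>The left and right arcs are the outgoing and incoming ones at a positive crossing and
  change places at a negative one. Solving the relation for the outgoing color then produces the
  inverse action at negative crossings.\<close>

lemma spread_coloring_iff:
  assumes h: "h \<in> arcs D \<rightarrow> carrier R"
  shows "spread h \<in> colorings R (ncomps D) (classical D) (crossing_sign D) (\<lambda>_. 0) \<longleftrightarrow>
    (\<forall>x\<in>classical D. h (left_arc D x) = h (right_arc D x) \<triangleright> h (over_arc D x))"
proof -
  let ?f = "lift R (\<lambda>_. 0) (spread h)"
  have gPi: "spread h \<in> base (ncomps D) \<rightarrow> carrier R" using spread_PiE[OF h] by auto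
  have free: "?f i s = h (arc_of D i s)" if "i < ncomps D" "(i, frac s) \<notin> under_params D" for i s
  proof -
    have "(i, frac s) \<in> base (ncomps D)" using that(1) by (simp add: base_def frac_lt_1)
    then show ?thesis
      using that(2) arc_after_free[of i "frac s"] unfolding lift_0[OF gPi that(1)]
      by (simp add: spread_def arc_of_frac)
  qed
  have at: "?f i t = h (arc_after D (i, t))" if "i < ncomps D" "0 \<le> t" "t < 1" for i t
    using that unfolding lift_0[OF gPi that(1)] by (simp add: spread_def base_def frac_id)
  have right: "right_ok ?f i t" if i: "i < ncomps D" and t: "0 \<le> t" "t < 1" for i t
  proof -
    obtain d where "d > 0" "\<And>s. \<lbrakk>t < s; s < t + d\<rbrakk>
        \<Longrightarrow> (i, frac s) \<notin> under_params D \<and> arc_of D i s = arc_after D (i, t)"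
      using arc_after by blast
    then show ?thesis unfolding right_ok_def
      by (intro eventually_at_rightI[of _ "t + d"]) (auto simp: free[OF i] at[OF i t])
  qed
  have left: "\<forall>\<^sub>F s in at_left t. ?f i s = h (arc_before D (i, t))" if i: "i < ncomps D"
      for i t
  proof -
    obtain d where "d > 0" "\<And>s. \<lbrakk>t - d < s; s < t\<rbrakk>
        \<Longrightarrow> (i, frac s) \<notin> under_params D \<and> arc_of D i s = arc_before D (i, t)"
      using arc_before by blast
    then show ?thesis by (intro eventually_at_leftI[of "t - d"]) (auto simp: free[OF i])
  qed
  have left_const: "h (arc_before D (i, t)) = h (arc_after D (i, t))"
    if i: "i < ncomps D" and t: "0 \<le> t" "t < 1" and nu: "(i, t) \<notin> under_params D" for i t
  proof -
    obtain d where d: "d > 0" "\<And>s. \<lbrakk>t - d < s; s < t\<rbrakk>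
        \<Longrightarrow> (i, frac s) \<notin> under_params D \<and> arc_of D i s = arc_before D (i, t)"
      using arc_before by blast
    have "arc_of D i t = arc_of D i (t - d / 2)"
    proof (rule arc_of_segment)
      fix u assume "u \<in> closed_segment t (t - d / 2)"
      then have "u = t \<or> t - d < u \<and> u < t" using d(1) by (auto simp: closed_segment_eq_real_ivl)
      then show "(i, frac u) \<notin> under_params D" using nu t d(2) by (auto simp: frac_id)
    qed
    then show ?thesis
      using d(1) d(2)[of "t - d / 2"] arc_after_free[of i t] nu t by (simp add: frac_id)
  qed
  have rel: "(\<forall>\<^sub>F s in at_left (snd q). ?f (fst q) (snd q)
      = signed_act R (crossing_sign D (p, q)) (?f (fst q) s) (?f (fst p) (snd p)))
      \<longleftrightarrow> h (left_arc D (p, q)) = h (right_arc D (p, q)) \<triangleright> h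
          (over_arc D (p, q))"
    if pq: "(p, q) \<in> classical D" for p q
  proof -
    have b: "p \<in> base (ncomps D)" "q \<in> base (ncomps D)" using pq classical_base by auto
    then have i: "fst p < ncomps D" "fst q < ncomps D" by (auto simp: base_def)
    have over: "?f (fst p) (snd p) = h (over_arc D (p, q))"
      using b unfolding lift_point[OF gPi b(1)] by (simp add: spread_def over_arc[OF pq])
    have under: "?f (fst q) (snd q) = h (arc_after D q)"
      using b unfolding lift_point[OF gPi b(2)] by (simp add: spread_def)
    have c: "h (over_arc D (p, q)) \<in> carrier R" "h (arc_before D q) \<in> carrier R"
        "h (arc_after D q) \<in> carrier R"
      using h over_arc(2)[OF pq] arc_before_arcs[OF i(2), of "snd q"] arc_after_arcs[OF i(2), of
          "snd q"] by auto
    have "(\<forall>\<^sub>F s in at_left (snd q). ?f (fst q) (snd q)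
        = signed_act R (crossing_sign D (p, q)) (?f (fst q) s) (?f (fst p) (snd p)))
        \<longleftrightarrow> (\<forall>\<^sub>F s in at_left (snd q). h (arc_after D q) = signed_act R
            (crossing_sign D (p, q)) (h (arc_before D q)) (h (over_arc D (p, q))))"
      unfolding over under using left[OF i(2), of "snd q"]
      by (intro eventually_cong) (auto elim: eventually_mono)
    also have "\<dots> \<longleftrightarrow> h (arc_after D q)
        = signed_act R (crossing_sign D (p, q)) (h (arc_before D q)) (h (over_arc D (p, q)))"
      by simp
    also have "\<dots> \<longleftrightarrow> h (left_arc D (p, q))
        = h (right_arc D (p, q)) \<triangleright> h (over_arc D (p, q))"
      using c by (auto simp: signed_act_iff left_arc_def right_arc_def)
    finally show ?thesis .
  qed
  show ?thesis
  proof
    assume g: "spread h \<in> colorings R (ncomps D) (classical D) (crossing_sign D) (\<lambda>_. 0)"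
    show "\<forall>x\<in>classical D. h (left_arc D x)
        = h (right_arc D x) \<triangleright> h (over_arc D x)"
    proof
      fix x assume x: "x \<in> classical D"
      obtain p q where pq: "x = (p, q)" by (cases x)
      have q: "fst q < ncomps D" "frac (snd q) = snd q" using x pq classical_base
          by (auto simp: base_def frac_id)
      then have "(p, (fst q, frac (snd q))) \<in> classical D" using x pq by simp
      from left_ok_jump[OF colorings_ok(2)[OF g q(1) classical_base] this]
      show "h (left_arc D x) = h (right_arc D x) \<triangleright> h (over_arc D x)"
        using rel[of p q] x q by (simp add: pq)
    qed
  next
    assume h_rel: "\<forall>x\<in>classical D. h (left_arc D x)
        = h (right_arc D x) \<triangleright> h (over_arc D x)"
    have "left_ok R (classical D) (crossing_sign D) ?f i t" if i: "i < ncomps D" and t: "0 \<le> t"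
        "t < 1" for i t
      unfolding left_ok_def frac_id[OF t]
    proof (intro conjI impI allI)
      assume "(i, t) \<notin> snd ` classical D"
      then have "?f i t = h (arc_before D (i, t))"
        using left_const[OF i t] at[OF i t] by (simp add: under_params_def)
      with left[OF i, of t] show "\<forall>\<^sub>F s in at_left t. ?f i t = ?f i s"
        by (auto elim: eventually_mono)
    next
      fix p assume "(p, (i, t)) \<in> classical D"
      then show "\<forall>\<^sub>F s in at_left t. ?f i t
          = signed_act R (crossing_sign D (p, (i, t))) (?f i s) (?f (fst p) (snd p))"
        using rel[of p "(i, t)"] h_rel by auto
    qed
    then show "spread h \<in> colorings R (ncomps D) (classical D) (crossing_sign D) (\<lambda>_. 0)"
      unfolding colorings_def using spread_PiE[OF h] right by auto
  qed
qed

text \<open>With zero twist the lift is periodic, so a coloring is constant on every arc, including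
  an arc that passes through parameter 0, and it descends to a function on arcs.\<close>

lemma card_arc_colorings:
  "card arc_colorings = card (colorings R (ncomps D) (classical D) (crossing_sign D) (\<lambda>_. 0))"
      (is "_ = card ?C")
proof -
  have "inj_on spread arc_colorings"
  proof (rule inj_onI)
    fix h h' assume h: "h \<in> arc_colorings" "h' \<in> arc_colorings" and eq: "spread h = spread h'"
    have eq': "h (arc_after D p) = h' (arc_after D p)" if "p \<in> base (ncomps D)" for p
      using fun_cong[OF eq, of p] that by (simp add: spread_def)
    then have "h A = h' A" if "A \<in> arcs D" for A
      using that unfolding arcs_arc_after by blast
    moreover have "h \<in> arcs D \<rightarrow>\<^sub>E carrier R"
        "h' \<in> arcs D \<rightarrow>\<^sub>E carrier R"
      using h by (simp_all add: arc_colorings_def)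
    ultimately show "h = h'" by (metis PiE_ext)
  qed
  moreover have "spread ` arc_colorings = ?C"
  proof (intro equalityI subsetI)
    fix g assume "g \<in> spread ` arc_colorings"
    then obtain h where h: "h \<in> arcs D \<rightarrow> carrier R" "g = spread h"
      "\<forall>x\<in>classical D. h (left_arc D x) = h (right_arc D x) \<triangleright> h (over_arc D x)"
      by (auto simp: arc_colorings_def)
    then show "g \<in> ?C" using spread_coloring_iff by blast
  next
    fix g assume g: "g \<in> ?C"
    note gPi = colorings_Pi[OF g]
    have const: "g p = g (i, frac t)" if i: "i < ncomps D" and p: "p \<in> arc_of D i t" for i t p
    proof -
      obtain s where s: "p = (i, frac s)" "\<And>u. u \<in> closed_segment t s
          \<Longrightarrow> (i, frac u) \<notin> under_params D"
        using p by (auto simp: arc_of_def)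
      have "lift R (\<lambda>_. 0) g i (max s t) = lift R (\<lambda>_. 0) g i (min s t)"
      proof (rule coloring_const[OF g i classical_base])
        fix u assume "min s t < u" "u \<le> max s t"
        then have "u \<in> closed_segment t s" by (auto simp: closed_segment_eq_real_ivl)
        then show "(i, frac u) \<notin> snd ` classical D" using s(2) by (simp add: under_params_def)
      qed simp
      then show ?thesis using s(1) by (auto simp: lift_0[OF gPi i] max_def min_def split: if_splits)
    qed
    define h where "h = (\<lambda>A\<in>arcs D. g (SOME p. p \<in> A))"
    have h_arc: "h (arc_of D i t) = g (i, frac t)" if i: "i < ncomps D" and
        "(i, frac t) \<notin> under_params D" for i t
    proof -
      have "(SOME p. p \<in> arc_of D i t) \<in> arc_of D i t" using arc_of_mem[OF that(2)] by (rule someI)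
      then show ?thesis using const[OF i] arc_of_arcs[OF that] by (simp add: h_def)
    qed
    have h_after: "h (arc_after D p) = g p" if p: "p \<in> base (ncomps D)" for p
    proof -
      obtain i t where it: "p = (i, t)" "i < ncomps D" "0 \<le> t" "t < 1" using p by (auto simp: base_def)
      obtain d where d: "d > 0" "\<And>s. \<lbrakk>t < s; s < t + d\<rbrakk>
          \<Longrightarrow> (i, frac s) \<notin> under_params D \<and> arc_of D i s = arc_after D (i, t)"
        using arc_after by blast
      have "\<forall>\<^sub>F s in at_right t. s \<in> {t<..<t + d}"
        using d(1) by (intro eventually_at_rightI[of _ "t + d"]) auto
      moreover have "\<forall>\<^sub>F s in at_right t. lift R (\<lambda>_. 0) g i s
          = lift R (\<lambda>_. 0) g i t"
        using colorings_ok(1)[OF g it(2) classical_base] by (simp add: right_ok_def)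
      ultimately have "\<forall>\<^sub>F s in at_right t. h (arc_after D (i, t)) = g (i, t)"
      proof eventually_elim
        case (elim s)
        then have "h (arc_after D (i, t)) = g (i, frac s)" using d(2)[of s] h_arc[OF it(2), of s] by auto
        then show ?case using elim it by (simp add: lift_0[OF gPi] frac_id)
      qed
      then show ?thesis by (simp add: it(1))
    qed
    have h_in: "h \<in> arcs D \<rightarrow>\<^sub>E carrier R"
    proof
      fix A assume "A \<in> arcs D"
      then obtain p where "p \<in> base (ncomps D)" "A = arc_after D p" unfolding arcs_arc_after by auto
      then show "h A \<in> carrier R" using h_after gPi by auto
    qed (simp add: h_def)
    have "spread h = g"
      using h_after PiE_arb[OF colorings_PiE[OF g]] by (auto simp: spread_def fun_eq_iff restrict_def)
    moreover from this have "h \<in> arc_colorings"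
      using spread_coloring_iff[of h] g h_in unfolding arc_colorings_def by auto
    ultimately show "g \<in> spread ` arc_colorings" by blast
  qed
  ultimately show ?thesis using card_image[of spread arc_colorings] by simp
qed

end

section \<open>The sign of a crossing of two chords\<close>

text \<open>The segment from \<open>g t\<close> to \<open>c * g t\<close> meets 0 only if
  \<open>c\<close> is a nonpositive real, so the straight-line homotopy stays off 0.\<close>

lemma winding_number_mult_not_nonpos:
  assumes "path g" "pathfinish g = pathstart g" "0 \<notin> path_image g"
      "c \<notin> \<real>\<^sub>\<le>\<^sub>0"
  shows "winding_number (\<lambda>t. c * g t) 0 = winding_number g 0"
proof (rule winding_number_loops_linear_eq)
  show "path (\<lambda>t. c * g t)" using assms(1) by (auto simp: path_def intro!: continuous_intros)
  show "pathfinish (\<lambda>t. c * g t) = pathstart (\<lambda>t. c * g t)"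
    using assms(2) by (simp add: pathfinish_def pathstart_def)
  show "0 \<notin> closed_segment (g t) (c * g t)" if t: "t \<in> {0..1}" for t
  proof
    assume "0 \<in> closed_segment (g t) (c * g t)"
    then obtain u where u: "0 \<le> u" "u \<le> 1" "0 = (1 - u) *\<^sub>R g t + u *\<^sub>R (c * g t)"
      unfolding in_segment by auto
    have "g t \<noteq> 0" using assms(3) t by (auto simp: path_image_def)
    moreover have "g t * (of_real (1 - u) + of_real u * c) = 0"
      using u(3) by (simp add: scaleR_conv_of_real algebra_simps)
    ultimately have eq: "of_real u * c = - of_real (1 - u)" by (simp add: add_eq_0_iff)
    have "u \<noteq> 0" using eq by auto
    then have "c = of_real (- (1 - u) / u)" using eq by (simp add: field_simps)
    moreover have "- (1 - u) / u \<le> 0" using u \<open>u \<noteq> 0\<close> by (simp add: field_simps)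
    ultimately show False using assms(4) by (metis nonpos_Reals_of_real_iff)
  qed
qed (use assms in auto)

text \<open>A half turn would lead the straight-line homotopy through 0. Multiplying twice by
  \<open>csqrt c\<close>, which is nonzero and lies in the closed right half plane, avoids
  this.\<close>

lemma winding_number_mult:
  assumes g: "path g" "pathfinish g = pathstart g" "0 \<notin> path_image g" and "c \<noteq> 0"
  shows "winding_number (\<lambda>t. c * g t) 0 = winding_number g 0"
proof -
  let ?s = "csqrt c"
  have s: "?s \<noteq> 0" "?s * ?s = c" using assms(4) power2_csqrt[of c] by (auto simp: power2_eq_square)
  have nonpos: "?s \<notin> \<real>\<^sub>\<le>\<^sub>0"
  proof
    assume "?s \<in> \<real>\<^sub>\<le>\<^sub>0"
    then obtain r where r: "?s = of_real r" "r \<le> 0" by (auto elim: nonpos_Reals_cases)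
    moreover have "Re ?s > 0 \<or> Re ?s = 0 \<and> 0 \<le> Im ?s" using csqrt_principal by blast
    ultimately show False using s(1) by auto
  qed
  have "winding_number (\<lambda>t. ?s * (?s * g t)) 0 = winding_number (\<lambda>t. ?s * g t) 0"
    using g s by (intro winding_number_mult_not_nonpos nonpos)
      (auto simp: path_def pathfinish_def pathstart_def path_image_def intro!: continuous_intros)
  also have "\<dots> = winding_number g 0" using g nonpos by (rule winding_number_mult_not_nonpos)
  finally show ?thesis using s(2) by (simp add: mult.assoc[symmetric])
qed

text \<open>Written as \<open>a * z + b * cnj z\<close>, the map has determinant |a|^2 - |b|^2,
  which equals \<open>- cdet v w\<close>. Its sign decides which term dominates along
  \<open>k\<close>, and the loop winds like \<open>k\<close> or like its conjugate.\<close>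

lemma winding_number_real_linear:
  fixes v w :: complex
  assumes k: "path k" "pathfinish k = pathstart k" "0 \<notin> path_image k" "winding_number k 0 = 1"
    and "cdet v w \<noteq> 0"
  shows "winding_number (\<lambda>t. Im (k t) *\<^sub>R w - Re (k t) *\<^sub>R v) 0
      = (if cdet v w < 0 then 1 else - 1)"
proof -
  define a b where "a = - v / 2 - \<i> * w / 2" and "b = - v / 2 + \<i> * w / 2"
  have L: "Im z *\<^sub>R w - Re z *\<^sub>R v = a * z + b * cnj z" for z
    by (simp add: complex_eq_iff a_def b_def field_simps)
  have det: "(norm a)\<^sup>2 - (norm b)\<^sup>2 = - cdet v w"
    unfolding cmod_power2 by (simp add: a_def b_def cdet_def power2_eq_square field_simps)
  have pk: "continuous_on {0..1} k" using k(1) by (simp add: path_def)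
  have pL: "path (\<lambda>t. a * k t + b * cnj (k t))"
    using pk by (auto simp: path_def intro!: continuous_intros)
  have nz: "k t \<noteq> 0" if "t \<in> {0..1}" for t using k(3) that by (auto simp: path_image_def)
  show ?thesis
  proof (cases "cdet v w < 0")
    case True
    then have lt: "norm b < norm a" using det by (intro power2_less_imp_less[of "norm b"]) auto
    then have "a \<noteq> 0" by auto
    have "winding_number (\<lambda>t. a * k t + b * cnj (k t)) 0 = winding_number (\<lambda>t. a * k t) 0"
      using k pL pk lt nz by (intro winding_number_nearby_loops_eq)
        (auto simp: path_def norm_mult pathfinish_def pathstart_def intro!: continuous_intros)
    also have "\<dots> = 1" using winding_number_mult[OF k(1-3) \<open>a \<noteq> 0\<close>] k(4) by simp
    finally show ?thesis using True by (simp add: L)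
  next
    case False
    then have lt: "norm a < norm b" using det assms(5) by (intro power2_less_imp_less[of "norm a"]) auto
    then have "b \<noteq> 0" by auto
    have ck: "path (cnj \<circ> k)" "pathfinish (cnj \<circ> k) = pathstart (cnj \<circ> k)"
        "0 \<notin> path_image (cnj \<circ> k)"
      using k pk by (auto simp: path_def pathfinish_def pathstart_def path_image_def intro!: continuous_intros)
    have "winding_number (\<lambda>t. a * k t + b * cnj (k t)) 0
        = winding_number (\<lambda>t. b * (cnj \<circ> k) t) 0"
      using k pL pk lt nz by (intro winding_number_nearby_loops_eq)
        (auto simp: path_def norm_mult pathfinish_def pathstart_def intro!: continuous_intros)
    also have "\<dots> = winding_number (cnj \<circ> k) (cnj 0)"
        using winding_number_mult[OF ck \<open>b \<noteq> 0\<close>] by simp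
    also have "\<dots> = - 1" using winding_number_cnj[OF k(1,3)] k(4) by simp
    finally show ?thesis using False by (simp add: L)
  qed
qed

text \<open>The kernel vanishes by Cramer's rule, and an injective linear map in finite dimension is
  bounded below. The bound is what the remainder of a first-order expansion is measured
  against.\<close>

lemma real_linear_bounded_below:
  assumes "cdet v w \<noteq> 0"
  obtains B where "B > 0" "\<And>z. B * norm z \<le> norm (Im z *\<^sub>R w - Re z *\<^sub>R v)"
proof -
  let ?L = "\<lambda>z. Im z *\<^sub>R w - Re z *\<^sub>R v"
  have lin: "bounded_linear ?L"
    by (intro bounded_linear_intros bounded_linear_Re bounded_linear_Im)
  have "inj ?L"
  proof (rule linear_injective_0[THEN iffD2, rule_format])
    show "linear ?L" using lin bounded_linear.linear by blast
    fix z assume z: "?L z = 0"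
    then have re: "Im z * Re w = Re z * Re v" and im: "Im z * Im w = Re z * Im v"
      by (simp_all add: complex_eq_iff)
    have "Re z * cdet v w = Im w * (Re z * Re v) - Re w * (Re z * Im v)"
      by (simp add: cdet_def algebra_simps)
    also have "\<dots> = 0" unfolding re[symmetric] im[symmetric] by simp
    finally have "Re z = 0" using assms by simp
    have "Im z * cdet v w = Re v * (Im z * Im w) - Im v * (Im z * Re w)"
      by (simp add: cdet_def algebra_simps)
    also have "\<dots> = 0" unfolding re im by simp
    finally have "Im z = 0" using assms by simp
    with \<open>Re z = 0\<close> show "z = 0" by (simp add: complex_eq_iff)
  qed
  then show ?thesis using linear_inj_bounded_below_pos[of ?L] that lin bounded_linear.linear by blast
qed

text \<open>A complex number encodes the pair of parameters. The difference of the two strands has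
  its only zero in the rectangle at \<open>z0\<close>, so the boundary can be shrunk towards
  \<open>z0\<close> without changing the winding number, until the derivative of the difference
  decides it.\<close>

lemma winding_number_difference:
  fixes \<gamma> \<delta> :: "real \<Rightarrow> complex"
  assumes ab: "a < m" "m < b" "c < l" "l < d"
    and cont: "continuous_on {a..b} \<gamma>" "continuous_on {c..d} \<delta>"
    and only: "\<And>s t. \<lbrakk>s \<in> {a..b}; t \<in> {c..d}; \<gamma> s = \<delta> t\<rbrakk>
        \<Longrightarrow> s = m \<and> t = l"
    and cross: "\<gamma> m = \<delta> l"
    and deriv: "(\<gamma> has_vector_derivative v) (at m)" "(\<delta> has_vector_derivative w) (at l)"
    and det: "cdet v w \<noteq> 0"
  shows "winding_number ((\<lambda>z. \<delta> (Im z) - \<gamma> (Re z)) \<circ> rectpath (Complex a c) (Complex b d)) 0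
           = (if cdet v w < 0 then 1 else - 1)"
proof -
  define F where "F = (\<lambda>z. \<delta> (Im z) - \<gamma> (Re z))"
  define L where "L = (\<lambda>z. Im z *\<^sub>R w - Re z *\<^sub>R v)"
  define q where "q = rectpath (Complex a c) (Complex b d)"
  define z0 where "z0 = Complex m l"
  let ?K = "cbox (Complex a c) (Complex b d)"
  have z0: "z0 \<in> box (Complex a c) (Complex b d)"
    using ab by (simp add: z0_def in_box_complex_iff)
  have q: "path q" "pathfinish q = pathstart q" by (auto simp: q_def)
  have q_ne: "z0 \<notin> path_image q"
    using z0 ab path_image_rectpath_cbox_minus_box[of "Complex a c" "Complex b d"] by (auto simp: q_def)
  have q_K: "path_image q \<subseteq> ?K"
    using ab path_image_rectpath_subset_cbox[of "Complex a c" "Complex b d"] by (simp add: q_def)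
  have F0: "F z = 0 \<longleftrightarrow> z = z0" if "z \<in> ?K" for z
    using that only[of "Re z" "Im z"] cross by (auto simp: F_def z0_def in_cbox_complex_iff complex_eq_iff)
  have contF: "continuous_on ?K F"
    unfolding F_def
    by (intro continuous_intros continuous_on_compose2[OF cont(1)] continuous_on_compose2[OF cont(2)])
      (auto simp: in_cbox_complex_iff)
  have derF: "(F has_derivative L) (at z0)"
  proof -
    have "((\<lambda>z. \<gamma> (Re z)) has_derivative (\<lambda>z. Re z *\<^sub>R v)) (at z0)"
      using has_derivative_compose[of Re Re z0 UNIV \<gamma> "\<lambda>x. x *\<^sub>R v"] deriv(1)
      by (simp add: has_vector_derivative_def z0_def bounded_linear_Re bounded_linear_imp_has_derivative)
    moreover have "((\<lambda>z. \<delta> (Im z)) has_derivative (\<lambda>z. Im z *\<^sub>R w)) (at z0)"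
      using has_derivative_compose[of Im Im z0 UNIV \<delta> "\<lambda>x. x *\<^sub>R w"] deriv(2)
      by (simp add: has_vector_derivative_def z0_def bounded_linear_Im bounded_linear_imp_has_derivative)
    ultimately show ?thesis unfolding F_def L_def by (intro has_derivative_diff)
  qed
  obtain B where B: "B > 0" "\<And>z. B * norm z \<le> norm (L z)"
    using real_linear_bounded_below[OF det] unfolding L_def by blast
  \<comment> \<open>Half of the lower bound \<open>B\<close> keeps the remainder strictly smaller
    than the linear part away from \<open>z0\<close>.\<close>
  obtain \<rho> where \<rho>: "\<rho> > 0" "\<And>z. norm (z - z0) < \<rho>
      \<Longrightarrow> norm (F z - F z0 - L (z - z0)) \<le> B / 2 * norm (z - z0)"
    using derF B(1) unfolding has_derivative_at_alt by (metis half_gt_zero)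
  obtain M where M: "M > 0" "\<And>t. t \<in> {0..1} \<Longrightarrow> norm (q t - z0) \<le> M"
  proof -
    have "compact ((\<lambda>t. q t - z0) ` {0..1})"
      using q(1) by (intro compact_continuous_image) (auto simp: path_def intro!: continuous_intros)
    then show ?thesis using that compact_imp_bounded bounded_pos by (smt (verit) image_eqI)
  qed
  \<comment> \<open>Shrinking factor of the boundary loop: being at most 1 it keeps the loop in the
    rectangle, and since \<open>M\<close> bounds the distance of the loop from \<open>z0\<close>,
    the shrunk loop comes within \<open>\<rho>\<close> of \<open>z0\<close>.\<close>
  define \<eta> where "\<eta> = min 1 (\<rho> / (2 * M))"
  have \<eta>: "0 < \<eta>" "\<eta> \<le> 1" "\<eta> * M < \<rho>"
    using \<rho>(1) M(1) by (auto simp: \<eta>_def min_def field_simps)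
  define k where "k = (\<lambda>t. of_real \<eta> * (q t - z0))"
  define q' where "q' = (\<lambda>t. z0 + k t)"
  have qt: "q t \<in> ?K" "q t \<noteq> z0" if "t \<in> {0..1}" for t
    using that q_K q_ne by (auto simp: path_image_def)
  have k: "path k" "pathfinish k = pathstart k" "0 \<notin> path_image k"
    using q \<eta>(1) qt(2)
        by (auto simp: path_def pathfinish_def pathstart_def path_image_def k_def intro!: continuous_intros)
  have q': "path q'" "pathfinish q' = pathstart q'"
    using k by (auto simp: path_def pathfinish_def pathstart_def q'_def intro!: continuous_intros)
  \<comment> \<open>The homotopy moves each point along its ray towards \<open>z0\<close> and stops
    short of it, so it stays in the rectangle by convexity and never meets the zero.\<close>
  have seg: "closed_segment (q t) (q' t) \<subseteq> ?K - {z0}" if t: "t \<in> {0..1}" for t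
  proof
    fix z assume "z \<in> closed_segment (q t) (q' t)"
    then obtain u where u: "0 \<le> u" "u \<le> 1" "z = (1 - u) *\<^sub>R q t + u *\<^sub>R q' t"
        by (auto simp: in_segment)
    define r where "r = (1 - u) + u * \<eta>"
    have r: "0 < r" "r \<le> 1"
    proof -
      show "0 < r" using u \<eta> by (cases "u = 0") (auto simp: r_def add_nonneg_pos)
      have "u * \<eta> \<le> u" using u \<eta> by (simp add: mult_left_le)
      then show "r \<le> 1" by (simp add: r_def)
    qed
    have z: "z = (1 - r) *\<^sub>R z0 + r *\<^sub>R q t"
      by (simp add: u(3) r_def q'_def k_def scaleR_conv_of_real algebra_simps)
    have "z0 \<in> ?K" using z0 box_subset_cbox by blast
    then have "z \<in> ?K" unfolding z using qt(1)[OF t] r convex_box(1) by (intro convexD) auto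
    moreover have "z - z0 = r *\<^sub>R (q t - z0)" unfolding z by (simp add: algebra_simps)
    then have "z \<noteq> z0" using r qt(2)[OF t] by (metis eq_iff_diff_eq_0 less_irrefl scaleR_eq_0_iff)
    ultimately show "z \<in> ?K - {z0}" by simp
  qed
  have "homotopic_loops (- {0}) (F \<circ> q) (F \<circ> q')"
  proof (rule homotopic_loops_continuous_image)
    show "homotopic_loops (?K - {z0}) q q'" using q q' seg by (intro homotopic_loops_linear) auto
    show "continuous_on (?K - {z0}) F" using contF by (rule continuous_on_subset) auto
    show "F \<in> ?K - {z0} \<rightarrow> - {0}" using F0 by auto
  qed
  then have "winding_number (F \<circ> q) 0 = winding_number (F \<circ> q') 0"
    by (rule winding_number_homotopic_loops)
  also have "\<dots> = winding_number (\<lambda>t. L (k t)) 0"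
  proof (rule winding_number_nearby_loops_eq)
    show "path (\<lambda>t. L (k t))" using k(1) by (auto simp: L_def path_def intro!: continuous_intros)
    have "path_image q' \<subseteq> ?K" using seg ends_in_segment(2) by (fastforce simp: path_image_def)
    then show "path (F \<circ> q')" using q'(1) contF by (intro path_continuous_image)
        (auto intro: continuous_on_subset)
    show "pathfinish (\<lambda>t. L (k t)) = pathstart (\<lambda>t. L (k t))" using k(2)
        by (simp add: pathfinish_def pathstart_def)
    show "pathfinish (F \<circ> q') = pathstart (F \<circ> q')" using q'(2)
        by (simp add: pathfinish_def pathstart_def)
    fix t :: real assume t: "t \<in> {0..1}"
    have k0: "k t \<noteq> 0" using k(3) t by (auto simp: path_image_def)
    have "norm (k t) = \<eta> * norm (q t - z0)" using \<eta> by (simp add: k_def norm_mult)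
    also have "\<dots> \<le> \<eta> * M" using M(2)[OF t] \<eta> by (intro mult_left_mono) auto
    finally have "norm (q' t - z0) < \<rho>" using \<eta> by (simp add: q'_def)
    from \<rho>(2)[OF this] have "norm (F (q' t) - L (k t)) \<le> B / 2 * norm (k t)"
      using F0[of z0] subsetD[OF box_subset_cbox z0] by (simp add: q'_def)
    also have "\<dots> < B * norm (k t)" using B k0 by simp
    also have "\<dots> \<le> norm (L (k t))" by (rule B)
    finally show "norm ((F \<circ> q') t - L (k t)) < norm (L (k t) - 0)" by simp
  qed
  also have "\<dots> = (if cdet v w < 0 then 1 else - 1)"
    unfolding L_def
  proof (rule winding_number_real_linear[OF k _ det])
    have "winding_number k 0 = winding_number (\<lambda>t. q t - z0) 0"
      unfolding k_def using q \<eta>(1) qt(2)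
      by (intro winding_number_mult)
        (auto simp: path_def pathfinish_def pathstart_def path_image_def intro!: continuous_intros)
    also have "\<dots> = 1" using winding_number_rectpath[OF z0]
        by (simp add: winding_number_offset[of q] q_def[symmetric])
    finally show "winding_number k 0 = 1" .
  qed
  finally show ?thesis by (simp add: F_def q_def)
qed

lemma half_plane_segment:
  fixes z w P :: complex
  assumes "z \<bullet> P < 0" "w \<bullet> P < 0"
  shows "0 \<notin> closed_segment z w"
proof
  assume "0 \<in> closed_segment z w"
  moreover have "closed_segment z w \<subseteq> {x. P \<bullet> x < 0}"
    using assms convex_halfspace_lt[of P 0] by (intro closed_segment_subset) (auto simp: inner_commute)
  ultimately show False by auto
qed

text \<open>Strict convexity of the disc: it touches its tangent line at \<open>P\<close> only in
  \<open>P\<close>. If the inner product of \<open>Q\<close> and \<open>P\<close> were 1, then |Q -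
  P|^2 would be at most 1 - 2 + 1 = 0.\<close>

lemma inner_unit_less_one:
  fixes P Q :: complex
  assumes "norm P = 1" "norm Q \<le> 1" "Q \<noteq> P"
  shows "(Q - P) \<bullet> P < 0"
proof -
  have "Q \<bullet> P \<le> norm Q * norm P" by (rule norm_cauchy_schwarz)
  then have le: "Q \<bullet> P \<le> 1" using assms by simp
  have PP: "P \<bullet> P = 1" using assms(1) by (simp add: dot_square_norm)
  have QQ: "Q \<bullet> Q \<le> 1" using assms(2) by (simp add: dot_square_norm abs_square_le_1)
  have "(Q - P) \<bullet> (Q - P) > 0" using assms(3) by simp
  then have "Q \<bullet> P \<noteq> 1" using PP QQ by (auto simp: inner_diff inner_commute[of P Q])
  then show ?thesis using le PP by (simp add: inner_diff_left)
qed

text \<open>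
  The winding number around 0 of the difference of the two chords, along the boundary of the
  parameter rectangle, is determined by the sign of the crossing; at each point of this boundary
  the differences for two pairs of chords with the same end points lie in a common half plane.
\<close>

lemma chord_crossing_sign:
  fixes \<gamma> \<delta> \<gamma>' \<delta>' :: "real \<Rightarrow> complex"
  assumes ml: "a < m" "m < b" "c < l" "l < d"
    and cont: "continuous_on {a..b} \<gamma>" "continuous_on {c..d} \<delta>"
    and only: "\<And>s t. \<lbrakk>s \<in> {a..b}; t \<in> {c..d}; \<gamma> s = \<delta> t\<rbrakk>
        \<Longrightarrow> s = m \<and> t = l"
    and cross: "\<gamma> m = \<delta> l"
    and deriv: "(\<gamma> has_vector_derivative v) (at m)" "(\<delta> has_vector_derivative w) (at l)"
    and det: "cdet v w \<noteq> 0"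
    and ml': "a < m'" "m' < b" "c < l'" "l' < d"
    and cont': "continuous_on {a..b} \<gamma>'" "continuous_on {c..d} \<delta>'"
    and only': "\<And>s t. \<lbrakk>s \<in> {a..b}; t \<in> {c..d}; \<gamma>' s = \<delta>' t\<rbrakk>
        \<Longrightarrow> s = m' \<and> t = l'"
    and cross': "\<gamma>' m' = \<delta>' l'"
    and deriv': "(\<gamma>' has_vector_derivative v') (at m')"
        "(\<delta>' has_vector_derivative w') (at l')"
    and det': "cdet v' w' \<noteq> 0"
    and disc: "\<And>s. s \<in> {a..b} \<Longrightarrow> norm (\<gamma> s) \<le> 1"
        "\<And>t. t \<in> {c..d} \<Longrightarrow> norm (\<delta> t) \<le> 1"
      "\<And>s. s \<in> {a..b} \<Longrightarrow> norm (\<gamma>' s) \<le> 1"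
          "\<And>t. t \<in> {c..d} \<Longrightarrow> norm (\<delta>' t) \<le> 1"
    and ends: "\<gamma>' a = \<gamma> a" "\<gamma>' b = \<gamma> b" "\<delta>' c = \<delta> c"
        "\<delta>' d = \<delta> d"
    and circle: "norm (\<gamma> a) = 1" "norm (\<gamma> b) = 1" "norm (\<delta> c) = 1"
        "norm (\<delta> d) = 1"
  shows "cdet v' w' > 0 \<longleftrightarrow> cdet v w > 0"
proof -
  let ?q = "rectpath (Complex a c) (Complex b d)"
  define F where "F = (\<lambda>z. \<delta> (Im z) - \<gamma> (Re z))"
  define F' where "F' = (\<lambda>z. \<delta>' (Im z) - \<gamma>' (Re z))"
  have q: "path ?q" "pathfinish ?q = pathstart ?q" by auto
  have img: "path_image ?q \<subseteq> cbox (Complex a c) (Complex b d)"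
    using ml by (intro path_image_rectpath_subset_cbox) auto
  have bd: "Re z \<in> {a, b} \<and> Im z \<in> {c..d} \<or> Re z \<in> {a..b} \<and> Im z \<in> {c, d}"
      if "z \<in> path_image ?q" for z
    using that ml path_image_rectpath[of "Complex a c" "Complex b d"] by auto
  have nz: "0 \<notin> closed_segment (F z) (F' z)" if "z \<in> path_image ?q" for z
    using bd[OF that]
  proof
    \<comment> \<open>On these sides the first strand rests at an end point \<open>?P\<close> common
      to both pairs, and both differences point from \<open>?P\<close> into the disc. On the other
      two sides the second strand rests, and the half plane is the opposite one.\<close>
    assume z: "Re z \<in> {a, b} \<and> Im z \<in> {c..d}"
    let ?P = "\<gamma> (Re z)"
    have P: "norm ?P = 1" "\<gamma>' (Re z) = ?P" using z ends circle by auto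
    have "\<delta> (Im z) \<noteq> ?P" using only[of "Re z" "Im z"] z ml by auto
    moreover have "\<delta>' (Im z) \<noteq> \<gamma>' (Re z)" using only'[of "Re z" "Im z"] z ml' by auto
    ultimately show ?thesis
      using P z disc by (intro half_plane_segment[of _ ?P])
          (auto simp: F_def F'_def intro!: inner_unit_less_one)
  next
    assume z: "Re z \<in> {a..b} \<and> Im z \<in> {c, d}"
    let ?P = "\<delta> (Im z)"
    have P: "norm ?P = 1" "\<delta>' (Im z) = ?P" using z ends circle by auto
    have ne: "\<gamma> (Re z) \<noteq> ?P" using only[of "Re z" "Im z"] z ml by auto
    have ne': "\<gamma>' (Re z) \<noteq> \<delta>' (Im z)" using only'[of "Re z" "Im z"] z ml' by auto
    have "(\<gamma> (Re z) - ?P) \<bullet> ?P < 0" "(\<gamma>' (Re z) - ?P) \<bullet> ?P < 0"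
      using P z disc ne ne' by (auto intro!: inner_unit_less_one)
    then have "F z \<bullet> - ?P < 0" "F' z \<bullet> - ?P < 0"
      using P(2) by (auto simp: F_def F'_def inner_diff_left)
    then show ?thesis by (rule half_plane_segment)
  qed
  have path: "path (F \<circ> ?q)" "path (F' \<circ> ?q)"
  proof -
    have "continuous_on (cbox (Complex a c) (Complex b d)) F"
      unfolding F_def
      by (intro continuous_intros continuous_on_compose2[OF cont(1)] continuous_on_compose2[OF cont(2)])
        (auto simp: in_cbox_complex_iff)
    then show "path (F \<circ> ?q)" using q img by (intro path_continuous_image)
        (auto intro: continuous_on_subset)
    have "continuous_on (cbox (Complex a c) (Complex b d)) F'"
      unfolding F'_def
      by (intro continuous_intros continuous_on_compose2[OF cont'(1)] continuous_on_compose2[OF cont'(2)])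
        (auto simp: in_cbox_complex_iff)
    then show "path (F' \<circ> ?q)" using q img by (intro path_continuous_image)
        (auto intro: continuous_on_subset)
  qed
  have "winding_number (F' \<circ> ?q) 0 = winding_number (F \<circ> ?q) 0"
    using path q nz by (intro winding_number_loops_linear_eq)
        (auto simp: path_image_def pathfinish_def pathstart_def)
  moreover have "winding_number (F \<circ> ?q) 0 = (if cdet v w < 0 then 1 else - 1)"
    unfolding F_def using ml cont only cross deriv det by (rule winding_number_difference)
  moreover have "winding_number (F' \<circ> ?q) 0 = (if cdet v' w' < 0 then 1 else - 1)"
    unfolding F'_def using ml' cont' only' cross' deriv' det' by (rule winding_number_difference)
  ultimately show ?thesis using det det' by (auto split: if_splits)
qed

section \<open>Curves, planar isotopy and the detour move\<close>

abbreviation curve :: "diagram \<Rightarrow> nat \<Rightarrow> real \<Rightarrow> complex" where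
  "curve D i \<equiv> curves D ! i"

context generic_diagram
begin

lemma regular: "i < ncomps D \<Longrightarrow> regular_closed_curve (curve D i)"
  using link_diagram by (simp add: link_diagram_def ncomps_def)

lemma curve_deriv:
  assumes "i < ncomps D"
  shows "(curve D i has_vector_derivative vel D (i, t)) (at t)"
proof -
  obtain c' where "\<And>x. (curve D i has_vector_derivative c' x) (at x)"
    using regular[OF assms] unfolding regular_closed_curve_def C1_differentiable_on_def by auto
  then show ?thesis using vector_derivative_at[of "curve D i" "c' t" t] by (simp add: vel_def)
qed

lemma curve_cont: "i < ncomps D \<Longrightarrow> continuous_on A (curve D i)"
  using curve_deriv has_vector_derivative_continuous
  by (meson continuous_at_imp_continuous_on)

lemma vel_cont:
  assumes "i < ncomps D"
  shows "continuous_on A (\<lambda>t. vel D (i, t))"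
proof -
  obtain c' where c': "\<And>x. (curve D i has_vector_derivative c' x) (at x)" "continuous_on UNIV c'"
    using regular[OF assms] unfolding regular_closed_curve_def C1_differentiable_on_def by auto
  have "vel D (i, t) = c' t" for t
    by (rule vector_derivative_unique_at[OF curve_deriv[OF assms] c'(1)])
  then have "continuous_on UNIV (\<lambda>t. vel D (i, t))" using c'(2) by simp
  then show ?thesis by (rule continuous_on_subset) simp
qed

lemma vel_nonzero: "i < ncomps D \<Longrightarrow> vel D (i, t) \<noteq> 0"
  using regular by (auto simp: regular_closed_curve_def vel_def)

lemma curve_add_of_int:
  assumes "i < ncomps D"
  shows "curve D i (t + of_int m) = curve D i t"
proof -
  have per: "curve D i (t + 1) = curve D i t" for t
    using regular[OF assms] by (simp add: regular_closed_curve_def)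
  have nat: "curve D i (t + of_nat k) = curve D i t" for t k
  proof (induction k)
    case (Suc k)
    have "curve D i (t + of_nat (Suc k)) = curve D i ((t + of_nat k) + 1)" by (simp add: algebra_simps)
    with Suc show ?case by (simp only: per)
  qed simp
  show ?thesis
  proof (cases m)
    case (neg k)
    then have "t = (t + of_int m) + of_nat (Suc k)" by simp
    then show ?thesis using nat[of "t + of_int m" "Suc k"] by metis
  qed (simp add: nat)
qed

lemma curve_frac: "i < ncomps D \<Longrightarrow> curve D i (frac t) = curve D i t"
  using curve_add_of_int[of i "frac t" "\<lfloor>t\<rfloor>"] by (simp add: frac_def)

lemma pos_frac: "i < ncomps D \<Longrightarrow> pos D (i, frac t) = curve D i t"
  by (simp add: pos_def curve_frac)

lemma vel_frac:
  assumes "i < ncomps D"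
  shows "vel D (i, frac t) = vel D (i, t)"
proof -
  let ?m = "of_int \<lfloor>t\<rfloor> :: real"
  have "((\<lambda>u. u + ?m) has_vector_derivative 1) (at (frac t))"
    by (auto intro!: derivative_eq_intros)
  from vector_diff_chain_at[OF this curve_deriv[OF assms]]
  have "(curve D i has_vector_derivative vel D (i, frac t + ?m)) (at (frac t))"
    by (simp add: o_def curve_add_of_int[OF assms])
  moreover have "frac t + ?m = t" by (simp add: frac_def)
  ultimately have "(curve D i has_vector_derivative vel D (i, t)) (at (frac t))" by simp
  with curve_deriv[OF assms] show ?thesis by (rule vector_derivative_unique_at)
qed

lemma crossing_det: "(p, q) \<in> double_points D \<Longrightarrow> cdet (vel D p) (vel D q) \<noteq> 0"
  using link_diagram by (auto simp: link_diagram_def)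

lemma crossing_sign_cases: "crossing_sign D x = 1 \<or> crossing_sign D x = - 1"
  by (simp add: crossing_sign_def)

end

lemma vel_eqI:
  assumes "\<forall>\<^sub>F u in nhds t. curve D i u = curve D' i u"
  shows "vel D (i, t) = vel D' (i, t)"
  unfolding vel_def fst_conv snd_conv
  by (rule vector_derivative_cong_eq) (use assms in \<open>auto elim: eventually_mono\<close>)

lemma crossing_sign_cong:
  "\<lbrakk>vel D p = vel D' p; vel D q = vel D' q\<rbrakk> \<Longrightarrow> crossing_sign D (p, q)
      = crossing_sign D' (p, q)"
  by (simp add: crossing_sign_def)

lemma writhe_cong:
  "\<lbrakk>classical D = classical D'; \<And>x. x \<in> classical D \<Longrightarrow> crossing_sign D x
      = crossing_sign D' x\<rbrakk>
    \<Longrightarrow> writhe D i = writhe D' i"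
  unfolding writhe_def by (intro sum.cong) auto

context finite_rack
begin

definition framed_count :: "diagram \<Rightarrow> (nat \<Rightarrow> int) \<Rightarrow> nat" where
  "framed_count D m =
     card (colorings R (ncomps D) (classical D) (crossing_sign D) (\<lambda>i. m i + writhe D i))"

text \<open>The count sees the curves only through the signs of classical crossings. These avoid the
  closed strand, so both diagrams agree on a whole neighborhood of each such point and have the same
  velocities there.\<close>

lemma framed_count_detour:
  assumes D: "link_diagram D" and D': "link_diagram D'" and move: "detour D D'"
  shows "framed_count D m = framed_count D' m"
proof -
  interpret D: generic_diagram D by unfold_locales (rule D)
  interpret D': generic_diagram D' by unfold_locales (rule D')
  have n: "ncomps D = ncomps D'" and cl: "classical D = classical D'" using move by (auto simp: detour_def)
  obtain j a b where s: "strand_in D (j, a, b)"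
    and out: "\<And>p. \<lbrakk>p \<in> params D; p \<notin> open_strand (j, a, b)\<rbrakk>
        \<Longrightarrow> pos D p = pos D' p"
    and avoid: "\<And>p q. (p, q) \<in> classical D \<Longrightarrow> p \<notin> closed_strand (j, a, b)
        \<and> q \<notin> closed_strand (j, a, b)"
    using move unfolding detour_def by (metis (mono_tags, lifting) Diff_iff case_prodD prod_cases3)
  have ab: "0 < a" "a < b" "b < 1" using s by auto
  have vel: "vel D p = vel D' p" if p: "p \<in> base (ncomps D)" "p \<notin> closed_strand (j, a, b)" for p
  proof -
    obtain i t where it: "p = (i, t)" by (cases p)
    have i: "i < ncomps D" and ft: "frac t = t" using p it by (auto simp: base_def frac_id)
    have notin: "\<not> (i = j \<and> a \<le> t \<and> t \<le> b)" using p it by auto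
    have "\<forall>\<^sub>F u in at_left t. (i, frac u) \<notin> open_strand (j, a, b)"
      using p it notin ab by (intro eventually_at_left_avoid[of _ _ "ncomps D"]) auto
    moreover have "\<forall>\<^sub>F u in at_right t. (i, frac u) \<notin> open_strand (j, a, b)"
      using p it notin by (intro eventually_at_right_avoid[of _ _ "ncomps D"]) auto
    moreover have "(i, frac t) \<notin> open_strand (j, a, b)" using ft notin by auto
    ultimately have "\<forall>\<^sub>F u in nhds t. (i, frac u) \<notin> open_strand (j, a, b)"
      by (simp add: eventually_nhds_conv_at eventually_at_split)
    then have "\<forall>\<^sub>F u in nhds t. curve D i u = curve D' i u"
    proof eventually_elim
      case (elim u)
      have "(i, frac u) \<in> params D" using i by (simp add: params_def frac_lt_1)
      from out[OF this elim] show ?case using i n by (simp add: D.pos_frac D'.pos_frac)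
    qed
    then show ?thesis unfolding it by (rule vel_eqI)
  qed
  have sign: "crossing_sign D x = crossing_sign D' x" if "x \<in> classical D" for x
  proof -
    obtain p q where x: "x = (p, q)" by (cases x)
    have "p \<in> base (ncomps D)" "q \<in> base (ncomps D)" using that x D.classical_base by auto
    moreover have "p \<notin> closed_strand (j, a, b)" "q \<notin> closed_strand (j, a, b)"
        using avoid that x by blast+
    ultimately show ?thesis unfolding x by (intro crossing_sign_cong vel)
  qed
  have "writhe D i = writhe D' i" for i using cl sign by (rule writhe_cong)
  then show ?thesis unfolding framed_count_def n cl
    using sign D'.classical_base cl n by (intro arg_cong[where f = card] colorings_cong) auto
qed

end

section \<open>Planar isotopy: determinants and preservation of crossing signs\<close>

lemma real_linear_expand:
  fixes A :: "complex \<Rightarrow> complex"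
  assumes "linear A"
  shows "A z = Re z *\<^sub>R A 1 + Im z *\<^sub>R A \<i>"
proof -
  have "z = Re z *\<^sub>R 1 + Im z *\<^sub>R \<i>" by (simp add: complex_eq_iff)
  then have "A z = A (Re z *\<^sub>R 1 + Im z *\<^sub>R \<i>)" by simp
  also have "\<dots> = Re z *\<^sub>R A 1 + Im z *\<^sub>R A \<i>" using assms
      by (simp only: linear_add linear_scale)
  finally show ?thesis .
qed

lemma cdet_linear:
  assumes "linear A"
  shows "cdet (A u) (A v) = cdet (A 1) (A \<i>) * cdet u v"
  unfolding real_linear_expand[OF assms, of u] real_linear_expand[OF assms, of v]
  by (simp add: cdet_def algebra_simps)

lemma cdet_nonzero:
  assumes lin: "linear A" and inj: "inj A"
  shows "cdet (A 1) (A \<i>) \<noteq> 0"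
proof
  assume 0: "cdet (A 1) (A \<i>) = 0"
  \<comment> \<open>\<open>z\<close> and \<open>w\<close> come from the rows of the matrix of
    \<open>A\<close>: each kills its own row, and the vanishing determinant makes it kill the
    other.\<close>
  define z where "z = Complex (Re (A \<i>)) (- Re (A 1))"
  define w where "w = Complex (Im (A \<i>)) (- Im (A 1))"
  have "A z = 0" "A w = 0"
    unfolding real_linear_expand[OF lin, of z] real_linear_expand[OF lin, of w]
    using 0 by (auto simp: z_def w_def complex_eq_iff cdet_def algebra_simps)
  then have "z = 0" "w = 0" using inj linear_0[OF lin] by (metis injD)+
  then have "A 1 = 0" by (simp add: z_def w_def complex_eq_iff)
  then have "(1::complex) = 0" using inj linear_0[OF lin] by (metis injD)
  then show False by simp
qed

text \<open>The determinant of the derivative is continuous in time, never zero, and 1 at time 0,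
  where the map is the identity; by the intermediate value theorem it is positive at time 1.\<close>

lemma plane_isotopy_orientation:
  assumes "plane_isotopy H"
  obtains A where "\<And>z. (H 1 has_derivative A z) (at z)" "\<And>z. linear (A z)"
      "\<And>z. cdet (A z 1) (A z \<i>) > 0"
proof -
  obtain H' :: "real \<Rightarrow> complex \<Rightarrow> complex \<Rightarrow>\<^sub>L complex" where
    cont: "continuous_on ({0..1} \<times> UNIV) (\<lambda>(t, z). H' t z)"
    and deriv: "\<And>t z. t \<in> {0..1}
        \<Longrightarrow> (H t has_derivative blinfun_apply (H' t z)) (at z)"
    and bij: "\<And>t z. t \<in> {0..1} \<Longrightarrow> bij (blinfun_apply (H' t z))"
    and H0: "H 0 = id"
    using assms unfolding plane_isotopy_def by blast
  have lin: "linear (blinfun_apply (H' t z))" for t z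
    using blinfun.bounded_linear_right bounded_linear.linear by blast
  have "cdet (H' 1 z 1) (H' 1 z \<i>) > 0" for z
  proof (rule ccontr)
    let ?d = "\<lambda>t. cdet (H' t z 1) (H' t z \<i>)"
    assume neg: "\<not> ?d 1 > 0"
    have c: "continuous_on {0..1} (\<lambda>t. H' t z)"
    proof -
      have "continuous_on {0..1} (\<lambda>t. (t, z))" by (intro continuous_intros)
      from continuous_on_compose2[OF cont this] show ?thesis by (auto simp: image_subset_iff)
    qed
    have cd: "continuous_on {0..1} ?d"
      unfolding cdet_def by (intro continuous_intros blinfun.continuous_on c)
    have "blinfun_apply (H' 0 z) = id"
    proof (rule has_derivative_unique)
      show "(id has_derivative blinfun_apply (H' 0 z)) (at z)" using deriv[of 0 z] H0 by simp
      show "(id has_derivative id) (at z)" by (simp add: id_def)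
    qed
    then have "?d 0 = 1" by (simp add: cdet_def)
    then obtain t where "t \<in> {0..1}" "?d t = 0"
      using IVT2'[of ?d 1 0 0] cd neg by auto
    then show False using cdet_nonzero[OF lin bij_is_inj[OF bij]] by blast
  qed
  then show ?thesis using that[of "\<lambda>z. blinfun_apply (H' 1 z)"] deriv lin by auto
qed

lemma reparametrization_circle_map:
  assumes "reparametrization \<phi>"
  obtains \<phi>' where "circle_map \<phi>" "\<And>t. (\<phi> has_real_derivative \<phi>' t) (at t)"
      "\<And>t. \<phi>' t > 0"
proof -
  obtain \<phi>' where d: "\<And>t. (\<phi> has_vector_derivative \<phi>' t) (at t)"
    using assms unfolding reparametrization_def C1_differentiable_on_def by auto
  then have pos: "\<phi>' t > 0" for t
    using assms vector_derivative_at[OF d] by (simp add: reparametrization_def)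
  have d': "(\<phi> has_real_derivative \<phi>' t) (at t)" for t
    using d by (simp add: has_real_derivative_iff_has_vector_derivative)
  have cont: "continuous_on A \<phi>" for A
    using d has_vector_derivative_continuous by (meson continuous_at_imp_continuous_on)
  have add1: "\<phi> (t + 1) = \<phi> t + 1" for t using assms by (simp add: reparametrization_def)
  have "strict_mono \<phi>"
  proof (rule strict_monoI)
    fix x y :: real assume "x < y"
    then show "\<phi> x < \<phi> y" using DERIV_pos_imp_increasing[of x y \<phi>] d' pos by blast
  qed
  moreover have "surj \<phi>"
  proof -
    have "\<exists>x. \<phi> x = y" for y
    proof -
      define m where "m = \<lfloor>y - \<phi> 0\<rfloor>"
      have "\<phi> (of_int m) = \<phi> 0 + of_int m" "\<phi> (of_int (m + 1)) = \<phi> 0 + of_int (m + 1)"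
        using unit_translation_add_of_int[of \<phi> 0, OF add1] by (simp_all only: add_0)
      moreover have "of_int m \<le> y - \<phi> 0" "y - \<phi> 0 \<le> of_int (m + 1)"
        unfolding m_def by linarith+
      ultimately show ?thesis
        using IVT'[of \<phi> "of_int m" y "of_int (m + 1)"] cont by auto
    qed
    then show ?thesis by (metis surjI)
  qed
  ultimately have "circle_map \<phi>" using add1 by (simp add: circle_map_def)
  then show ?thesis using that d' pos by blast
qed


context finite_rack
begin

text \<open>At a crossing both velocities are mapped by the same derivative, of positive
  determinant, and rescaled by the positive speeds of the reparametrizations. Hence all signs
  survive, and only the change of parameters is left for the colorings.\<close>

lemma framed_count_planar_isotopy:
  assumes D: "link_diagram D" and D': "link_diagram D'" and move: "planar_isotopic D D'"
  shows "framed_count D m = framed_count D' m"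
proof -
  interpret D: generic_diagram D by unfold_locales (rule D)
  interpret D': generic_diagram D' by unfold_locales (rule D')
  obtain H \<phi> where n: "ncomps D = ncomps D'" and H: "plane_isotopy H"
    and re: "\<forall>i<ncomps D. reparametrization (\<phi> i) \<and> (\<forall>t. curve D' i t
        = H 1 (curve D i (\<phi> i t)))"
    and cl: "classical D = map_prod (\<lambda>(i, t). (i, frac (\<phi> i t))) (\<lambda>(i, t). (i, frac (\<phi> i t))) ` classical D'"
    using move unfolding planar_isotopic_def by (elim conjE exE) (rule that)
  have \<phi>: "reparametrization (\<phi> i)" and curve: "curve D' i t = H 1 (curve D i (\<phi> i t))"
      if "i < ncomps D'" for i t
    using re that n by simp_all
  let ?\<Phi> = "map_prod (reparam \<phi>) (reparam \<phi>)"
  have "(\<lambda>(i, t). (i, frac (\<phi> i t))) = reparam \<phi>" by (auto simp: reparam_def)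
  then have cl: "classical D = ?\<Phi> ` classical D'" using cl by simp
  have circle: "circle_map (\<phi> i)" if "i < ncomps D'" for i
    using reparametrization_circle_map[OF \<phi>[OF that]] by metis
  obtain A where A: "\<And>z. (H 1 has_derivative A z) (at z)" "\<And>z. linear (A z)"
      "\<And>z. cdet (A z 1) (A z \<i>) > 0"
    by (rule plane_isotopy_orientation[OF H]) (rule that)
  have vel: "\<exists>r>0. vel D' p
      = A (pos D (reparam \<phi> p)) (r *\<^sub>R vel D (reparam \<phi> p))" if p: "p \<in> base
          (ncomps D')" for p
  proof -
    obtain i t where it: "p = (i, t)" by (cases p)
    have i': "i < ncomps D'" and i: "i < ncomps D" using p it n by (auto simp: base_def)
    obtain \<phi>' where d: "\<And>t. (\<phi> i has_real_derivative \<phi>' t) (at t)" and pos: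
        "\<And>t. \<phi>' t > 0"
      using reparametrization_circle_map[OF \<phi>[OF i']] by metis
    have "(\<phi> i has_vector_derivative \<phi>' t) (at t)"
      using d by (simp add: has_real_derivative_iff_has_vector_derivative)
    from vector_diff_chain_at[OF this D.curve_deriv[OF i]]
    have "(curve D i \<circ> \<phi> i has_vector_derivative \<phi>' t *\<^sub>R vel D (i, \<phi> i t)) (at t)" .
    from has_derivative_compose[OF this[unfolded has_vector_derivative_def] A(1)]
    have "((\<lambda>x. H 1 ((curve D i \<circ> \<phi> i) x)) has_derivative
        (\<lambda>x. A (curve D i (\<phi> i t)) (x *\<^sub>R \<phi>' t *\<^sub>R vel D
            (i, \<phi> i t)))) (at t)" by simp
    moreover have "(\<lambda>x. H 1 ((curve D i \<circ> \<phi> i) x)) = curve D' i" using curve[OF i']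
        by auto
    ultimately have "(curve D' i has_vector_derivative A (curve D i (\<phi> i t)) (\<phi>' t *\<^sub>R vel D (i, \<phi> i t))) (at t)"
      unfolding has_vector_derivative_def using linear_scale[OF A(2)] by (simp add: o_def)
    then have "vel D' (i, t) = A (curve D i (\<phi> i t)) (\<phi>' t *\<^sub>R vel D (i, \<phi> i t))"
      by (rule vector_derivative_unique_at[OF D'.curve_deriv[OF i']])
    then show ?thesis
      using pos by (intro exI[of _ "\<phi>' t"])
          (simp add: it reparam_def D.pos_frac[OF i] D.vel_frac[OF i])
  qed
  have sign: "crossing_sign D' x = crossing_sign D (?\<Phi> x)" if x: "x \<in> classical D'" for x
  proof -
    obtain p q where pq: "x = (p, q)" by (cases x)
    have b: "p \<in> base (ncomps D')" "q \<in> base (ncomps D')" using x pq D'.classical_base by auto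
    have "(reparam \<phi> p, reparam \<phi> q) \<in> classical D" unfolding cl using x pq by force
    then have pos: "pos D (reparam \<phi> p) = pos D (reparam \<phi> q)"
      using D.classical_double by (auto simp: double_points_def)
    obtain r s where rs: "r > 0" "s > 0"
      "vel D' p = A (pos D (reparam \<phi> p)) (r *\<^sub>R vel D (reparam \<phi> p))"
      "vel D' q = A (pos D (reparam \<phi> p)) (s *\<^sub>R vel D (reparam \<phi> q))"
      using vel[OF b(1)] vel[OF b(2)] pos by metis
    have "cdet (vel D' p) (vel D' q)
        = cdet (A (pos D (reparam \<phi> p)) 1) (A (pos D (reparam \<phi> p)) \<i>)
        * (r * s * cdet (vel D (reparam \<phi> p)) (vel D (reparam \<phi> q)))"
      unfolding rs(3,4) cdet_linear[OF A(2), of _ "r *\<^sub>R _"] by (simp add: cdet_def algebra_simps)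
    then have "cdet (vel D' p) (vel D' q) > 0
        \<longleftrightarrow> cdet (vel D (reparam \<phi> p)) (vel D (reparam \<phi> q)) > 0"
      using mult_less_cancel_left_pos[of
          "cdet (A (pos D (reparam \<phi> p)) 1) (A (pos D (reparam \<phi> p)) \<i>) * (r * s)" 0]
        A(3) rs(1,2) by (simp add: mult.assoc)
    then show ?thesis by (simp add: crossing_sign_def pq)
  qed
  have inj: "inj_on ?\<Phi> (classical D')"
  proof -
    have "inj_on (reparam \<phi>) (base (ncomps D'))" using circle by (rule inj_on_reparam)
    then have "inj_on ?\<Phi> (base (ncomps D') \<times> base (ncomps D'))" by (intro map_prod_inj_on)
    then show ?thesis using D'.classical_base by (rule inj_on_subset)
  qed
  have writhe: "writhe D i = writhe D' i" for i
  proof -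
    have "{x \<in> classical D. fst (fst x) = i \<and> fst (snd x) = i}
        = ?\<Phi> ` {x \<in> classical D'. fst (fst x) = i \<and> fst (snd x) = i}"
    proof -
      have "{x \<in> ?\<Phi> ` classical D'. fst (fst x) = i \<and> fst (snd x) = i}
          = ?\<Phi> ` {x \<in> classical D'. fst (fst (?\<Phi> x)) = i \<and> fst (snd
              (?\<Phi> x)) = i}" by (rule Compr_image_eq)
      moreover have "fst (fst (?\<Phi> x)) = fst (fst x)" "fst (snd (?\<Phi> x)) = fst (snd x)" for x
        by (cases x; simp add: reparam_def)+
      ultimately show ?thesis unfolding cl by (simp only:)
    qed
    moreover have "inj_on ?\<Phi> {x \<in> classical D'. fst (fst x) = i \<and> fst (snd x) = i}"
      using inj by (rule inj_on_subset) auto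
    ultimately have "writhe D i = (\<Sum>x \<in> {x \<in> classical D'. fst (fst x) = i
        \<and> fst (snd x) = i}. crossing_sign D (?\<Phi> x))"
      unfolding writhe_def by (simp only: sum.reindex o_def)
    also have "\<dots> = writhe D' i" unfolding writhe_def using sign by (intro sum.cong) auto
    finally show ?thesis .
  qed
  show ?thesis unfolding framed_count_def n writhe
    using circle D'.classical_base cl sign by (rule card_colorings_reparam)
qed

end

section \<open>Moves inside the unit disc\<close>

text \<open>Just behind \<open>v\<close> the sign is that of the slope, and a later change of sign
  would force another zero.\<close>

lemma sgn_after_zero:
  fixes g :: "real \<Rightarrow> real"
  assumes deriv: "(g has_real_derivative g') (at v)" "g' \<noteq> 0" and "g v = 0" "v < w"
    and cont: "continuous_on {v..w} g" and nz: "\<And>t. \<lbrakk>v < t; t \<le> w\<rbrakk>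
        \<Longrightarrow> g t \<noteq> 0"
  shows "sgn (g w) = sgn g'"
proof -
  have pos: "g w > 0" if g: "(g has_real_derivative g') (at v)" "g' > 0" "g v = 0" "continuous_on {v..w} g"
    "\<And>t. \<lbrakk>v < t; t \<le> w\<rbrakk> \<Longrightarrow> g t \<noteq> 0" for g ::
        "real \<Rightarrow> real" and g'
  proof (rule ccontr)
    assume "\<not> g w > 0"
    obtain d where d: "d > 0" "\<And>h. \<lbrakk>0 < h; h < d\<rbrakk> \<Longrightarrow> g v < g (v + h)"
      using DERIV_pos_inc_right[OF g(1,2)] by auto
    define h where "h = min (d / 2) (w - v)"
    have h: "0 < h" "h < d" "v + h \<le> w" using d(1) \<open>v < w\<close> by (auto simp: h_def)
    then have "g (v + h) > 0" using d(2)[of h] g(3) by simp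
    moreover have "continuous_on {v + h..w} g" using g(4) h by (auto intro: continuous_on_subset)
    ultimately obtain t where "v + h \<le> t" "t \<le> w" "g t = 0"
      using IVT2'[of g w 0 "v + h"] h \<open>\<not> g w > 0\<close> by auto
    then show False using g(5)[of t] h by auto
  qed
  show ?thesis
  proof (cases "g' > 0")
    case True
    then show ?thesis using pos[of g g'] assms by simp
  next
    case False
    have "((\<lambda>t. - g t) has_real_derivative - g') (at v)" using deriv(1) by (rule DERIV_minus)
    then have "- g w > 0"
      using pos[of "\<lambda>t. - g t" "- g'"] False assms by (auto intro!: continuous_intros)
    then show ?thesis using False deriv(2) by simp
  qed
qed

lemma sgn_before_zero:
  fixes g :: "real \<Rightarrow> real"
  assumes deriv: "(g has_real_derivative g') (at v)" "g' \<noteq> 0" and "g v = 0" "u < v"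
    and cont: "continuous_on {u..v} g" and nz: "\<And>t. \<lbrakk>u \<le> t; t < v\<rbrakk>
        \<Longrightarrow> g t \<noteq> 0"
  shows "sgn (g u) = - sgn g'"
proof -
  have "((\<lambda>t. g (- t)) has_real_derivative g' * - 1) (at (- v))"
    using deriv(1) by (intro DERIV_chain2[where f = g]) (auto intro!: derivative_eq_intros)
  then have "sgn (g (- (- u))) = sgn (- g')"
    using assms by (intro sgn_after_zero[where g = "\<lambda>t. g (- t)" and v = "- v"])
      (auto intro!: continuous_on_compose2[OF cont] continuous_intros)
  then show ?thesis by (simp add: sgn_minus)
qed

lemma sgn_eq_on_interval:
  fixes f :: "real \<Rightarrow> real"
  assumes cont: "continuous_on {a<..<b} f" and nz: "\<And>t. \<lbrakk>a < t; t < b\<rbrakk>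
      \<Longrightarrow> f t \<noteq> 0"
    and "a < s" "s < b" "a < t" "t < b"
  shows "sgn (f s) = sgn (f t)"
proof (rule ccontr)
  assume ne: "sgn (f s) \<noteq> sgn (f t)"
  have conn: "connected (f ` {a<..<b})" using cont by (rule connected_continuous_image) simp
  have mem: "f s \<in> f ` {a<..<b}" "f t \<in> f ` {a<..<b}" using assms by auto
  have "f s < 0 \<and> 0 < f t \<or> f t < 0 \<and> 0 < f s"
    using ne nz[OF assms(3,4)] nz[OF assms(5,6)] by (auto simp: sgn_if split: if_splits)
  then have "0 \<in> f ` {a<..<b}" using connectedD_interval[OF conn] mem by (meson less_imp_le)
  then show False using nz by auto
qed

locale disc_diagram = generic_diagram D for D +
  fixes S :: "strand list"
  assumes disc: "disc_strands D S"
begin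

lemma strand_bounds: "(j, a, b) \<in> set S \<Longrightarrow> j < ncomps D \<and> 0 < a \<and> a < b
    \<and> b < 1"
  using disc by (auto simp: disc_strands_def)

lemma strands_disjoint:
  assumes "s \<in> set S" "s' \<in> set S" "s \<noteq> s'"
  shows "closed_strand s \<inter> closed_strand s' = {}"
proof -
  have sorted: "sorted_wrt (\<lambda>s s'. closed_strand s \<inter> closed_strand s' = {}) S"
    using disc by (simp add: disc_strands_def)
  obtain x y where xy: "x < length S" "y < length S" "s = S ! x" "s' = S ! y"
    using assms by (metis in_set_conv_nth)
  then have "x \<noteq> y" using assms(3) by auto
  then show ?thesis
    using sorted_wrt_nth_less[OF sorted, of x y] sorted_wrt_nth_less[OF sorted, of y x] xy
    by (cases "x < y") auto
qed

lemma inside_iff: "p \<in> base (ncomps D) \<Longrightarrow> norm (pos D p) < 1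
    \<longleftrightarrow> p \<in> (\<Union>s\<in>set S. open_strand s)"
  using disc unfolding disc_strands_def params_eq by blast

lemma not_on_circle: "(p, q) \<in> double_points D \<Longrightarrow> norm (pos D p) \<noteq> 1"
  using disc unfolding disc_strands_def by blast

lemma strand_base: "(j, a, b) \<in> set S \<Longrightarrow> a \<le> t \<Longrightarrow> t \<le> b
    \<Longrightarrow> (j, t) \<in> base (ncomps D)"
  using strand_bounds by (force simp: base_def)

lemma open_norm: "\<lbrakk>(j, a, b) \<in> set S; a < t; t < b\<rbrakk>
    \<Longrightarrow> norm (curve D j t) < 1"
  using inside_iff[of "(j, t)"] strand_base[of j a b t] by (force simp: pos_def)

lemma closed_norm:
  assumes "(j, a, b) \<in> set S" "a \<le> t" "t \<le> b"
  shows "norm (curve D j t) \<le> 1"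
proof (rule continuous_le_on_closure[where S = "{a<..<b}" and f = "\<lambda>t. norm (curve D j t)"])
  have j: "j < ncomps D" "a < b" using strand_bounds[OF assms(1)] by auto
  show "continuous_on (closure {a<..<b}) (\<lambda>t. norm (curve D j t))"
    using curve_cont[OF j(1)] by (intro continuous_intros)
  show "t \<in> closure {a<..<b}" using assms j(2) by (simp add: closure_greaterThanLessThan)
qed (use open_norm[OF assms(1)] in \<open>simp add: less_imp_le\<close>)

text \<open>An end point belongs to no open strand, by disjointness of the closed ones, so it is not
  in the open disc; by continuity it is in the closed one.\<close>

lemma end_norm:
  assumes "(j, a, b) \<in> set S" "t = a \<or> t = b"
  shows "norm (curve D j t) = 1"
proof -
  have ab: "a \<le> t" "t \<le> b" using assms strand_bounds[OF assms(1)] by auto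
  have "(j, t) \<notin> (\<Union>s\<in>set S. open_strand s)"
  proof
    assume "(j, t) \<in> (\<Union>s\<in>set S. open_strand s)"
    then obtain c d where s: "(j, c, d) \<in> set S" "c < t" "t < d" by auto
    then have "(j, c, d) \<noteq> (j, a, b)" using assms(2) by auto
    then have "closed_strand (j, c, d) \<inter> closed_strand (j, a, b) = {}"
      by (rule strands_disjoint[OF s(1) assms(1)])
    moreover have "(j, t) \<in> closed_strand (j, c, d) \<inter> closed_strand (j, a, b)" using s ab by simp
    ultimately show False by blast
  qed
  then have "\<not> norm (curve D j t) < 1"
    using inside_iff[OF strand_base[OF assms(1) ab]] by (simp add: pos_def)
  then show ?thesis using closed_norm[OF assms(1) ab] by simp
qed

lemma Im_deriv: "j < ncomps D
    \<Longrightarrow> ((\<lambda>t. Im (curve D j t)) has_real_derivative Im (vel D (j, t))) (at t)"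
  unfolding has_real_derivative_iff_has_vector_derivative
  by (rule bounded_linear.has_vector_derivative[OF bounded_linear_Im curve_deriv])

lemma Re_deriv: "j < ncomps D
    \<Longrightarrow> ((\<lambda>t. Re (curve D j t)) has_real_derivative Re (vel D (j, t))) (at t)"
  unfolding has_real_derivative_iff_has_vector_derivative
  by (rule bounded_linear.has_vector_derivative[OF bounded_linear_Re curve_deriv])

text \<open>A regular curve on the real axis has real nonzero velocity, so it runs monotonically
  through the whole diameter. The real part of its final point, 1 or -1, records the direction of
  travel.\<close>

lemma diameter:
  assumes s: "(i, a, b) \<in> set S" and along: "along_diameter D (i, a, b)"
  shows "\<And>t. \<lbrakk>a < t; t < b\<rbrakk> \<Longrightarrow> Im (vel D (i, t)) = 0"
    and "\<And>t. \<lbrakk>a < t; t < b\<rbrakk> \<Longrightarrow> sgn (Re (vel D (i, t)))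
        = Re (curve D i b)"
    and "curve D i a = - curve D i b"
    and "curve D i b = 1 \<or> curve D i b = - 1"
    and "\<And>x. \<bar>x\<bar> < 1 \<Longrightarrow> \<exists>t. a < t \<and> t < b \<and> curve D i t
        = of_real x"
proof -
  have i: "i < ncomps D" "a < b" using strand_bounds[OF s] by auto
  have im: "Im (curve D i t) = 0" if "a < t" "t < b" for t
    using along that by (auto simp: along_diameter_def pos_def)
  have im_end: "Im (curve D i t) = 0" if "t = a \<or> t = b" for t
  proof (rule continuous_constant_on_closure[where S = "{a<..<b}" and f = "\<lambda>t. Im (curve D i t)"])
    show "continuous_on (closure {a<..<b}) (\<lambda>t. Im (curve D i t))"
      using curve_cont[OF i(1)] by (intro continuous_intros)
    show "t \<in> closure {a<..<b}" using that i(2) by (auto simp: closure_greaterThanLessThan)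
  qed (use im in auto)
  show imv: "Im (vel D (i, t)) = 0" if t: "a < t" "t < b" for t
  proof -
    have "((\<lambda>t. Im (curve D i t)) has_real_derivative 0) (at t)"
      by (rule has_field_derivative_transform_within_open[where f = "\<lambda>_. 0" and S = "{a<..<b}"])
        (use t im in auto)
    then show ?thesis using DERIV_unique[OF Im_deriv[OF i(1)]] by blast
  qed
  have nz: "Re (vel D (i, t)) \<noteq> 0" if "a < t" "t < b" for t
    using imv[OF that] vel_nonzero[OF i(1), of t] by (auto simp: complex_eq_iff)
  have re_end: "Re (curve D i t) = 1 \<or> Re (curve D i t) = - 1" if "t = a \<or> t = b" for t
  proof -
    have "\<bar>Re (curve D i t)\<bar> = 1" using end_norm[OF s that] im_end[OF that]
        by (simp add: cmod_eq_Re)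
    then show ?thesis by linarith
  qed
  \<comment> \<open>If both ends were equal, the mean value theorem would give a point of zero
    velocity; so the ends are opposite, and the velocity has the sign of the displacement.\<close>
  obtain z where z: "a < z" "z < b" "Re (curve D i b) - Re (curve D i a) = (b - a) * Re (vel D (i, z))"
    using MVT2[OF i(2), of "\<lambda>t. Re (curve D i t)"
        "\<lambda>t. Re (vel D (i, t))"] Re_deriv[OF i(1)] by auto
  have ba: "Re (curve D i a) = - Re (curve D i b)"
    using re_end[of a] re_end[of b] z i nz[OF z(1,2)] by auto
  have "2 * Re (curve D i b) = (b - a) * Re (vel D (i, z))" using z(3) ba by simp
  then have "sgn (2 * Re (curve D i b)) = sgn (Re (vel D (i, z)))" using i(2) by (simp add: sgn_mult)
  then have sz: "sgn (Re (vel D (i, z))) = Re (curve D i b)" using re_end[of b] by (auto simp: sgn_mult)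
  show "sgn (Re (vel D (i, t))) = Re (curve D i b)" if "a < t" "t < b" for t
  proof -
    have "continuous_on {a<..<b} (\<lambda>t. Re (vel D (i, t)))"
      using vel_cont[OF i(1)] by (intro continuous_intros)
    from sgn_eq_on_interval[OF this nz that z(1,2)] show ?thesis using sz by simp
  qed
  show "curve D i a = - curve D i b" using ba im_end by (simp add: complex_eq_iff)
  show "curve D i b = 1 \<or> curve D i b = - 1" using re_end[of b] im_end[of b]
      by (auto simp: complex_eq_iff)
  show "\<exists>t. a < t \<and> t < b \<and> curve D i t = of_real x" if x: "\<bar>x\<bar> < 1" for x
  proof -
    let ?f = "\<lambda>t. Re (curve D i t)"
    have conn: "connected (?f ` {a..b})"
      using curve_cont[OF i(1)] by (intro connected_continuous_image continuous_intros) auto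
    have mem: "?f a \<in> ?f ` {a..b}" "?f b \<in> ?f ` {a..b}" using i(2) by simp_all
    have "?f b = 1 \<and> ?f a = - 1 \<or> ?f b = - 1 \<and> ?f a = 1" using re_end[of b] ba by auto
    then have ends: "- 1 \<in> ?f ` {a..b}" "1 \<in> ?f ` {a..b}" using mem by (metis (no_types, lifting))+
    have "x \<in> ?f ` {a..b}" by (rule connectedD_interval[OF conn ends]) (use x in auto)
    then obtain t where t: "a \<le> t" "t \<le> b" "?f t = x" by auto
    have "t \<noteq> a" "t \<noteq> b" using t(3) x re_end[of t] by auto
    then show ?thesis using t im[of t] by (intro exI[of _ t]) (auto simp: complex_eq_iff)
  qed
qed

lemma strand_points_ne:
  assumes "(i, a, b) \<in> set S" "(j, c, d) \<in> set S" "(i, a, b) \<noteq> (j, c, d)" "a \<le> t"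
      "t \<le> b" "c \<le> u" "u \<le> d"
  shows "(i, t) \<noteq> (j, u)"
proof
  assume "(i, t) = (j, u)"
  then have "(i, t) \<in> closed_strand (i, a, b) \<inter> closed_strand (j, c, d)" using assms(4-7) by simp
  then show False using strands_disjoint[OF assms(1-3)] by blast
qed

lemma strands_double:
  assumes "(i, a, b) \<in> set S" "(j, c, d) \<in> set S" "(i, a, b) \<noteq> (j, c, d)" "a \<le> t"
      "t \<le> b" "c \<le> u" "u \<le> d"
    and eq: "curve D i t = curve D j u"
  shows "((i, t), (j, u)) \<in> inner_double_points D" "a < t" "t < b" "c < u" "u < d"
proof -
  have dp: "((i, t), (j, u)) \<in> double_points D"
    using assms strand_points_ne[OF assms(1-7)] strand_base
    by (auto simp: double_points_def params_eq pos_def)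
  then have "norm (curve D i t) \<noteq> 1" using not_on_circle by (fastforce simp: pos_def)
  then have lt: "norm (curve D i t) < 1" using closed_norm[OF assms(1,4,5)] by simp
  then show "((i, t), (j, u)) \<in> inner_double_points D" using dp
      by (simp add: inner_double_points_def pos_def)
  have "t \<noteq> a" "t \<noteq> b" "u \<noteq> c" "u \<noteq> d"
    using lt end_norm[OF assms(1), of t] end_norm[OF assms(2), of u] eq by auto
  then show "a < t" "t < b" "c < u" "u < d" using assms by auto
qed

text \<open>The strand on the diameter covers every real point of the closed disc, so any other
  strand reaching the real axis meets it. Such a meeting is a double point and therefore cannot be
  on the circle.\<close>

lemma hits_diameter:
  assumes s: "(i, a, b) \<in> set S" "(j, c, d) \<in> set S" "(i, a, b) \<noteq> (j, c, d)"
    and along: "along_diameter D (i, a, b)" and t: "c \<le> t" "t \<le> d" "Im (curve D j t) = 0"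
  shows "\<exists>u. a < u \<and> u < b \<and> ((i, u), (j, t)) \<in> inner_double_points D"
proof -
  have ab: "a < b" using strand_bounds[OF s(1)] by simp
  have "\<exists>u. a \<le> u \<and> u \<le> b \<and> curve D i u = curve D j t"
  proof (cases "norm (curve D j t) < 1")
    case True
    then have "\<bar>Re (curve D j t)\<bar> < 1" using t(3) by (simp add: cmod_eq_Re)
    then obtain u where "a < u" "u < b" "curve D i u = of_real (Re (curve D j t))"
      using diameter(5)[OF s(1) along] by blast
    then show ?thesis using t(3) by (intro exI[of _ u]) (simp add: complex_eq_iff)
  next
    case False
    then have "\<bar>Re (curve D j t)\<bar> = 1" using closed_norm[OF s(2) t(1,2)] t(3)
        by (simp add: cmod_eq_Re)
    then have "curve D j t = 1 \<or> curve D j t = - 1" using t(3) by (auto simp: complex_eq_iff)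
    then have "curve D i a = curve D j t \<or> curve D i b = curve D j t"
      using diameter(3,4)[OF s(1) along] by auto
    then show ?thesis using ab by (metis less_imp_le order_refl)
  qed
  then obtain u where "a \<le> u" "u \<le> b" "curve D i u = curve D j t" by blast
  then show ?thesis using strands_double[OF s _ _ t(1,2)] by blast
qed

lemma Im_cont: "j < ncomps D \<Longrightarrow> continuous_on A (\<lambda>t. Im (curve D j t))"
  using curve_cont by (intro continuous_intros)

text \<open>Since the overstrand moves horizontally, the determinant reduces to the product of its
  horizontal velocity and the vertical velocity of the understrand.\<close>

lemma diameter_crossing:
  assumes s: "(i, a, b) \<in> set S" and along: "along_diameter D (i, a, b)" and u: "a < u" "u < b"
    and dp: "((i, u), q) \<in> double_points D"
  shows "Im (vel D q) \<noteq> 0"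
    and "crossing_sign D ((i, u), q) = 1 \<longleftrightarrow> sgn (Im (vel D q)) = Re (curve D i b)"
    and "Im (pos D q) = 0"
proof -
  have v: "Im (vel D (i, u)) = 0" "sgn (Re (vel D (i, u))) = Re (curve D i b)"
    using diameter(1,2)[OF s along] u by auto
  have det: "cdet (vel D (i, u)) (vel D q) = Re (vel D (i, u)) * Im (vel D q)"
    using v(1) by (simp add: cdet_def)
  show nz: "Im (vel D q) \<noteq> 0" using crossing_det[OF dp] det by auto
  have "cdet (vel D (i, u)) (vel D q) > 0 \<longleftrightarrow> sgn (Re (vel D (i, u)))
      = sgn (Im (vel D q))"
    using nz crossing_det[OF dp] unfolding det by (auto simp: sgn_if zero_less_mult_iff)
  then show "crossing_sign D ((i, u), q) = 1 \<longleftrightarrow> sgn (Im (vel D q)) = Re (curve D i b)"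
    using v(2) by (auto simp: crossing_sign_def)
  have "pos D q = pos D (i, u)" using dp by (simp add: double_points_def)
  then show "Im (pos D q) = 0" using along u by (auto simp: along_diameter_def)
qed

text \<open>A strand that meets the axis once, and transversally, lies on opposite sides before and
  after. Everything is expressed by the final point at \<open>d\<close>, because that point lies on
  the circle and is not changed by a move.\<close>

lemma transverse_strand:
  assumes s: "(j, c, d) \<in> set S" and v: "c < v" "v < d" "Im (curve D j v) = 0"
      "Im (vel D (j, v)) \<noteq> 0"
    and only: "\<And>t. \<lbrakk>c \<le> t; t \<le> d; Im (curve D j t) = 0\<rbrakk> \<Longrightarrow> t
        = v"
  shows "sgn (Im (vel D (j, v))) = sgn (Im (curve D j d))"
    and "\<And>t. \<lbrakk>c \<le> t; t < v\<rbrakk> \<Longrightarrow> sgn (Im (curve D j t))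
        = - sgn (Im (curve D j d))"
    and "\<And>t. \<lbrakk>v < t; t \<le> d\<rbrakk> \<Longrightarrow> sgn (Im (curve D j t))
        = sgn (Im (curve D j d))"
proof -
  have j: "j < ncomps D" using strand_bounds[OF s] by simp
  have after: "sgn (Im (curve D j t)) = sgn (Im (vel D (j, v)))" if "v < t" "t \<le> d" for t
  proof (rule sgn_after_zero[OF Im_deriv[OF j] v(4,3) that(1) Im_cont[OF j]])
    show "Im (curve D j u) \<noteq> 0" if "v < u" "u \<le> t" for u
      using only[of u] that \<open>t \<le> d\<close> v by auto
  qed
  have before: "sgn (Im (curve D j t)) = - sgn (Im (vel D (j, v)))" if "c \<le> t" "t < v" for t
  proof (rule sgn_before_zero[OF Im_deriv[OF j] v(4,3) that(2) Im_cont[OF j]])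
    show "Im (curve D j u) \<noteq> 0" if "t \<le> u" "u < v" for u
      using only[of u] that \<open>c \<le> t\<close> v by auto
  qed
  show *: "sgn (Im (vel D (j, v))) = sgn (Im (curve D j d))" using after[of d] v by simp
  show "\<And>t. \<lbrakk>c \<le> t; t < v\<rbrakk> \<Longrightarrow> sgn (Im (curve D j t))
      = - sgn (Im (curve D j d))" by (rule before[unfolded *])
  show "\<And>t. \<lbrakk>v < t; t \<le> d\<rbrakk> \<Longrightarrow> sgn (Im (curve D j t))
      = sgn (Im (curve D j d))" by (rule after[unfolded *])
qed

end

context disc_diagram
begin

definition inner :: "(param \<times> param) set" where
  "inner = classical D \<inter> inner_double_points D"

lemma distinct_strands: "distinct S"
  unfolding distinct_conv_nth
proof (intro allI impI notI)
  fix x y assume xy: "x < length S" "y < length S" "x \<noteq> y" "S ! x = S ! y"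
  have sorted: "sorted_wrt (\<lambda>s s'. closed_strand s \<inter> closed_strand s' = {}) S"
    using disc by (simp add: disc_strands_def)
  have "closed_strand (S ! x) \<inter> closed_strand (S ! y) = {}"
    using sorted_wrt_nth_less[OF sorted, of x y] sorted_wrt_nth_less[OF sorted, of y x] xy
    by (cases "x < y") auto
  moreover have "closed_strand (S ! x) \<noteq> {}"
  proof -
    obtain j a b where s: "S ! x = (j, a, b)" by (cases "S ! x")
    then have "(j, a, b) \<in> set S" using xy(1) by (metis nth_mem)
    from strand_bounds[OF this] show ?thesis using s by auto
  qed
  ultimately show False using xy(4) by simp
qed

lemma inner_eq:
  assumes "X \<subseteq> classical D" "inner_double_points D = X \<union> X\<inverse>"
  shows "inner = X"
  using assms classical_asym unfolding inner_def by blast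

lemma inner_in_strands: "inner
    \<subseteq> (\<Union>s\<in>set S. open_strand s) \<times> (\<Union>s\<in>set S. open_strand s)"
proof -
  have "p \<in> (\<Union>s\<in>set S. open_strand s)
      \<and> q \<in> (\<Union>s\<in>set S. open_strand s)" if "(p, q) \<in> inner" for p q
    using that inside_iff[of p] inside_iff[of q] classical_base
    by (auto simp: inner_def inner_double_points_def double_points_def)
  then show ?thesis by auto
qed

text \<open>The signs under the highest strand and the orders along the lower ones are given in
  terms of the final points at \<open>b\<close>, \<open>d\<close> and \<open>f\<close>. As a move
  fixes these points, the data of the two diagrams can be compared formula by formula.\<close>

lemma triangle_data:
  assumes S: "S = [(i, a, b), (j, c, d), (l, e, f)]"
    and tri: "triangle D (i, a, b) (j, c, d) (l, e, f) mp lp"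
  obtains p p' v m w u where "mp = (j, m)" "lp = (l, u)"
    "a < p" "p < b" "a < p'" "p' < b" "c < v" "v < d" "c < m" "m < d" "e < w" "w < f" "e < u" "u < f"
    "inner = {((i, p), (j, v)), ((i, p'), (l, w)), ((j, m), (l, u))}"
    "crossing_sign D ((i, p), (j, v)) = 1 \<longleftrightarrow> sgn (Im (curve D j d)) = Re (curve D i b)"
    "crossing_sign D ((i, p'), (l, w)) = 1 \<longleftrightarrow> sgn (Im (curve D l f)) = Re (curve D i b)"
    "((j, m), (l, u)) \<in> double_points D"
    "\<And>s t. \<lbrakk>s \<in> {c..d}; t \<in> {e..f}; curve D j s = curve D l t\<rbrakk>
        \<Longrightarrow> s = m \<and> t = u"
    "Im (curve D j d) \<noteq> 0" "Im (curve D l f) \<noteq> 0"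
    "Im (pos D mp) < 0 \<Longrightarrow> v \<noteq> m \<and> w \<noteq> u \<and> (m < v
        \<longleftrightarrow> Im (curve D j d) > 0) \<and> (u < w \<longleftrightarrow> Im
            (curve D l f) > 0)"
    "Im (pos D mp) > 0 \<Longrightarrow> v \<noteq> m \<and> w \<noteq> u \<and> (m < v
        \<longleftrightarrow> \<not> Im (curve D j d) > 0) \<and> (u < w \<longleftrightarrow> \<not> Im
            (curve D l f) > 0)"
proof -
  have hi: "(i, a, b) \<in> set S" and mid: "(j, c, d) \<in> set S" and lo: "(l, e, f) \<in> set S"
      using S by auto
  have ne: "(i, a, b) \<noteq> (j, c, d)" "(i, a, b) \<noteq> (l, e, f)" "(j, c, d) \<noteq> (l, e, f)"
    using distinct_strands S by auto
  have along: "along_diameter D (i, a, b)" and mplp: "mp \<in> open_strand (j, c, d)"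
      "lp \<in> open_strand (l, e, f)"
    using tri by (auto simp: triangle_def)
  obtain pp pp' vp wp where pts: "{pp, pp'} \<subseteq> open_strand (i, a, b)"
      "vp \<in> open_strand (j, c, d)" "wp \<in> open_strand (l, e, f)"
    and cl: "{(pp, vp), (pp', wp), (mp, lp)} \<subseteq> classical D"
    and idp: "inner_double_points D = {(pp, vp), (vp, pp), (pp', wp), (wp, pp'), (mp, lp), (lp, mp)}"
    using tri unfolding triangle_def by blast
  obtain p p' v w m u where eq: "pp = (i, p)" "pp' = (i, p')" "vp = (j, v)" "wp = (l, w)" "mp = (j, m)"
      "lp = (l, u)"
    using pts mplp by auto
  have bd: "a < p" "p < b" "a < p'" "p' < b" "c < v" "v < d" "c < m" "m < d" "e < w" "w < f" "e < u" "u < f"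
    using pts mplp by (auto simp: eq)
  have inner: "inner = {((i, p), (j, v)), ((i, p'), (l, w)), ((j, m), (l, u))}"
    using cl idp unfolding eq by (intro inner_eq) auto
  have dbl: "((i, p), (j, v)) \<in> double_points D" "((i, p'), (l, w)) \<in> double_points D"
      "((j, m), (l, u)) \<in> double_points D"
    using cl classical_double unfolding eq by auto
  \<comment> \<open>Every zero of the imaginary part is a crossing with the highest strand, and the
    list of inner double points contains just one such crossing of the middle strand.\<close>
  have only_mid: "t = v" if t: "c \<le> t" "t \<le> d" "Im (curve D j t) = 0" for t
  proof -
    obtain q where q: "a < q" "q < b" "((i, q), (j, t)) \<in> inner_double_points D"
      using hits_diameter[OF hi mid ne(1) along t] by blast
    have "(i, q) \<noteq> (j, v)" "(i, q) \<noteq> (l, w)" "(i, q) \<noteq> (j, m)"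
        "(i, q) \<noteq> (l, u)" "(j, t) \<noteq> (l, w)" "(j, t) \<noteq> (l, u)"
      using q(1,2) t bd strand_points_ne[OF hi mid ne(1), of q] strand_points_ne[OF hi lo ne(2), of q]
        strand_points_ne[OF mid lo ne(3), of t] by simp_all
    then show "t = v" using q(3) unfolding idp eq by auto
  qed
  have only_lo: "t = w" if t: "e \<le> t" "t \<le> f" "Im (curve D l t) = 0" for t
  proof -
    obtain q where q: "a < q" "q < b" "((i, q), (l, t)) \<in> inner_double_points D"
      using hits_diameter[OF hi lo ne(2) along t] by blast
    have "(i, q) \<noteq> (j, v)" "(i, q) \<noteq> (l, w)" "(i, q) \<noteq> (j, m)"
        "(i, q) \<noteq> (l, u)" "(l, t) \<noteq> (j, v)" "(l, t) \<noteq> (j, m)"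
      using q(1,2) t bd strand_points_ne[OF hi mid ne(1), of q] strand_points_ne[OF hi lo ne(2), of q]
        strand_points_ne[OF lo mid ne(3)[symmetric], of t] by simp_all
    then show "t = w" using q(3) unfolding idp eq by auto
  qed
  have only: "s = m \<and> t = u" if "s \<in> {c..d}" "t \<in> {e..f}" "curve D j s = curve D l t" for s t
  proof -
    have st: "((j, s), (l, t)) \<in> inner_double_points D"
      using strands_double(1)[OF mid lo ne(3) _ _ _ _ that(3)] that(1,2) by simp
    have "(j, s) \<noteq> (i, p)" "(j, s) \<noteq> (i, p')" "(j, s) \<noteq> (l, w)"
        "(j, s) \<noteq> (l, u)" "(l, t) \<noteq> (i, p)"
      using that(1,2) bd strand_points_ne[OF mid hi ne(1)[symmetric], of s] strand_points_ne[OF lo hi ne(2)[symmetric], of t]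
        strand_points_ne[OF mid lo ne(3), of s] by simp_all
    then show ?thesis using st unfolding idp eq by auto
  qed
  note cr_mid = diameter_crossing[OF hi along bd(1,2) dbl(1)]
  note cr_lo = diameter_crossing[OF hi along bd(3,4) dbl(2)]
  have zero: "Im (curve D j v) = 0" "Im (curve D l w) = 0" using cr_mid(3) cr_lo(3)
      by (simp_all add: pos_def)
  note tr_mid = transverse_strand[OF mid bd(5,6) zero(1) cr_mid(1) only_mid]
  note tr_lo = transverse_strand[OF lo bd(9,10) zero(2) cr_lo(1) only_lo]
  have nz: "Im (curve D j d) \<noteq> 0" "Im (curve D l f) \<noteq> 0"
    using only_mid[of d] only_lo[of f] bd by auto
  have "curve D j m = curve D l u" using dbl(3) by (simp add: double_points_def pos_def)
  then have im: "Im (pos D mp) = Im (curve D j m)" "Im (pos D mp) = Im (curve D l u)"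
      by (simp_all add: eq pos_def)
  have pos_mid: "sgn (Im (pos D mp))
      = (if m < v then - sgn (Im (curve D j d)) else sgn (Im (curve D j d)))" if "m \<noteq> v"
  proof (cases "m < v")
    case True
    then show ?thesis unfolding im(1) if_P[OF True] using bd by (intro tr_mid(2)) simp_all
  next
    case False
    then show ?thesis unfolding im(1) if_not_P[OF False] using bd that by (intro tr_mid(3)) simp_all
  qed
  have pos_lo: "sgn (Im (pos D mp))
      = (if u < w then - sgn (Im (curve D l f)) else sgn (Im (curve D l f)))" if "u \<noteq> w"
  proof (cases "u < w")
    case True
    then show ?thesis unfolding im(2) if_P[OF True] using bd by (intro tr_lo(2)) simp_all
  next
    case False
    then show ?thesis unfolding im(2) if_not_P[OF False] using bd that by (intro tr_lo(3)) simp_all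
  qed
  have c1: "crossing_sign D ((i, p), (j, v)) = 1 \<longleftrightarrow> sgn (Im (curve D j d))
      = Re (curve D i b)"
    by (simp only: cr_mid(2) tr_mid(1))
  have c2: "crossing_sign D ((i, p'), (l, w)) = 1 \<longleftrightarrow> sgn (Im (curve D l f))
      = Re (curve D i b)"
    by (simp only: cr_lo(2) tr_lo(1))
  have c3: "v \<noteq> m \<and> w \<noteq> u \<and> (m < v \<longleftrightarrow> Im (curve D j d) > 0)
      \<and> (u < w \<longleftrightarrow> Im (curve D l f) > 0)"
    if neg: "Im (pos D mp) < 0"
  proof -
    have "Im (curve D j m) < 0" "Im (curve D l u) < 0" using neg by (simp_all only: im[symmetric])
    then have ne: "m \<noteq> v" "u \<noteq> w" using zero by auto
    show ?thesis using ne pos_mid[OF ne(1)] pos_lo[OF ne(2)] neg nz by (auto simp: sgn_if split: if_splits)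
  qed
  have c4: "v \<noteq> m \<and> w \<noteq> u \<and> (m < v
      \<longleftrightarrow> \<not> Im (curve D j d) > 0) \<and> (u < w \<longleftrightarrow> \<not> Im
          (curve D l f) > 0)"
    if pos: "Im (pos D mp) > 0"
  proof -
    have "Im (curve D j m) > 0" "Im (curve D l u) > 0" using pos by (simp_all only: im[symmetric])
    then have ne: "m \<noteq> v" "u \<noteq> w" using zero by auto
    show ?thesis using ne pos_mid[OF ne(1)] pos_lo[OF ne(2)] pos nz by (auto simp: sgn_if split: if_splits)
  qed
  show ?thesis
    by (rule that[where p = p and p' = p' and v = v and m = m and w = w and u = u,
          OF eq(5,6) bd inner c1 c2 dbl(3) only nz c3 c4])
qed

end

section \<open>Comparison of two diagrams that agree outside the disc\<close>

locale disc_move = disc_diagram D S for D S +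
  fixes D' :: diagram
  assumes link_diagram': "link_diagram D'" and agree: "agree_outside_disc D D'"
begin

lemma ncomps_eq: "ncomps D' = ncomps D"
  using agree by (simp add: agree_outside_disc_def)

lemma pos_agree: "\<lbrakk>p \<in> base (ncomps D); norm (pos D p) \<ge> 1\<rbrakk>
    \<Longrightarrow> pos D' p = pos D p"
  using agree unfolding agree_outside_disc_def params_eq by metis

lemma inside_agree: "p \<in> base (ncomps D) \<Longrightarrow> norm (pos D' p) < 1
    \<longleftrightarrow> norm (pos D p) < 1"
  using agree unfolding agree_outside_disc_def params_eq by metis

text \<open>A double point of \<open>D'\<close> on the circle would be a double point of
  \<open>D\<close> there, since the curves coincide on the circle and outside it.\<close>

lemma disc_diagram': "disc_diagram D' S"
proof -
  interpret D': generic_diagram D' by unfold_locales (rule link_diagram')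
  have "norm (pos D' p) \<noteq> 1" if pq: "(p, q) \<in> double_points D'" for p q
  proof
    assume one: "norm (pos D' p) = 1"
    have b: "p \<in> base (ncomps D)" "q \<in> base (ncomps D)" "p \<noteq> q" "pos D' p = pos D' q"
      using pq by (auto simp: double_points_def D'.params_eq ncomps_eq)
    then have "norm (pos D p) \<ge> 1" "norm (pos D q) \<ge> 1"
        using inside_agree[of p] inside_agree[of q] one by auto
    then have "pos D p = pos D' p" "pos D q = pos D' q" using pos_agree b by auto
    then have "(p, q) \<in> double_points D" "norm (pos D p) = 1" using b one
        by (auto simp: double_points_def params_eq)
    then show False using not_on_circle by blast
  qed
  moreover have "{p \<in> params D'. norm (pos D' p) < 1} = {p \<in> params D. norm (pos D p) < 1}"
    using inside_agree by (auto simp: D'.params_eq params_eq ncomps_eq)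
  moreover have "strand_in D' s = strand_in D s" for s by (cases s) (simp add: ncomps_eq)
  ultimately have "disc_strands D' S" using disc unfolding disc_strands_def by auto
  then show ?thesis by unfold_locales
qed

sublocale D': disc_diagram D' S by (rule disc_diagram')

lemma end_agree:
  assumes "(j, a, b) \<in> set S" "t = a \<or> t = b"
  shows "curve D' j t = curve D j t"
proof -
  have "a < b" using strand_bounds[OF assms(1)] by simp
  then have "(j, t) \<in> base (ncomps D)" using assms strand_base[OF assms(1), of t] by auto
  from pos_agree[OF this] show ?thesis using end_norm[OF assms] by (simp add: pos_def)
qed

definition outer :: "(param \<times> param) set" where
  "outer = {x \<in> classical D. norm (pos D (fst x)) \<ge> 1}"

lemma inner_double_iff: "x \<in> double_points D \<Longrightarrow> x \<in> inner_double_points D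
    \<longleftrightarrow> norm (pos D (fst x)) < 1"
  by (auto simp: inner_double_points_def)

lemma inner_double_iff': "x \<in> double_points D' \<Longrightarrow> x \<in> inner_double_points D'
    \<longleftrightarrow> norm (pos D' (fst x)) < 1"
  by (auto simp: inner_double_points_def)

lemma classical_split: "classical D = outer \<union> inner" "outer \<inter> inner = {}"
  using classical_double inner_double_iff unfolding outer_def inner_def by fastforce+

lemma outer_eq': "outer = {x \<in> classical D'. norm (pos D' (fst x)) \<ge> 1}"
proof -
  have "outer = {(p, q) \<in> classical D. norm (pos D p) \<ge> 1}" by (auto simp: outer_def)
  also have "\<dots> = {(p, q) \<in> classical D'. norm (pos D' p) \<ge> 1}" using agree
      by (simp add: agree_outside_disc_def)
  also have "\<dots> = {x \<in> classical D'. norm (pos D' (fst x)) \<ge> 1}" by auto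
  finally show ?thesis .
qed

lemma classical_split': "classical D' = outer \<union> D'.inner" "outer \<inter> D'.inner = {}"
  using D'.classical_double inner_double_iff' unfolding outer_eq' D'.inner_def by fastforce+

lemma outer_norm:
  assumes "(p, q) \<in> outer"
  shows "norm (pos D p) > 1" "norm (pos D q) > 1" "p \<in> base (ncomps D)" "q \<in> base (ncomps D)"
proof -
  have dp: "(p, q) \<in> double_points D" "norm (pos D p) \<ge> 1" using assms classical_double
      by (auto simp: outer_def)
  then show "norm (pos D p) > 1" using not_on_circle[OF dp(1)] by simp
  then show "norm (pos D q) > 1" using dp(1) by (simp add: double_points_def)
  show "p \<in> base (ncomps D)" "q \<in> base (ncomps D)" using dp(1)
      by (auto simp: double_points_def params_eq)
qed

text \<open>Lying strictly outside the disc is an open condition, so both curves coincide near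
  \<open>p\<close>. It holds at all outer crossings because no double point is on the
  circle.\<close>

lemma vel_outside:
  assumes p: "p \<in> base (ncomps D)" "norm (pos D p) > 1"
  shows "vel D p = vel D' p"
proof -
  obtain i t where it: "p = (i, t)" by (cases p)
  have i: "i < ncomps D" using p it by (auto simp: base_def)
  have "isCont (curve D i) t" using has_vector_derivative_continuous[OF curve_deriv[OF i]] .
  then have "isCont (\<lambda>u. norm (curve D i u)) t" by (intro continuous_intros)
  then have lim: "((\<lambda>u. norm (curve D i u)) \<longlongrightarrow> norm (curve D i t)) (nhds t)"
    using tendsto_at_iff_tendsto_nhds[of "\<lambda>u. norm (curve D i u)" t] by (simp add: continuous_at)
  have "norm (curve D i t) > 1" using p it by (simp add: pos_def)
  then have "\<forall>\<^sub>F u in nhds t. norm (curve D i u) > 1" by (rule order_tendstoD(1)[OF lim])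
  then have "\<forall>\<^sub>F u in nhds t. curve D i u = curve D' i u"
  proof eventually_elim
    case (elim u)
    have "(i, frac u) \<in> base (ncomps D)" using i by (simp add: base_def frac_lt_1)
    from pos_agree[OF this] show ?case using elim i by (simp add: pos_frac D'.pos_frac ncomps_eq)
  qed
  then show ?thesis unfolding it by (rule vel_eqI)
qed

lemma outer_sign: "x \<in> outer \<Longrightarrow> crossing_sign D' x = crossing_sign D x"
  using outer_norm vel_outside by (cases x) (metis crossing_sign_cong)

text \<open>Giving weight zero to crossings that are not self-crossings of component
  \<open>i\<close> lets the writhe split into sums over outer and inner crossings.\<close>

definition weight :: "diagram \<Rightarrow> nat \<Rightarrow> param \<times> param \<Rightarrow> int" where
  "weight E i x = (if fst (fst x) = i \<and> fst (snd x) = i then crossing_sign E x else 0)"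

lemma writhe_weight: "finite (classical E) \<Longrightarrow> writhe E i
    = (\<Sum>x\<in>classical E. weight E i x)"
  unfolding writhe_def weight_def by (simp add: sum.inter_filter)

lemma writhe_diff: "writhe D' i - (\<Sum>x\<in>D'.inner. weight D' i x)
    = writhe D i - (\<Sum>x\<in>inner. weight D i x)"
proof -
  have "(\<Sum>x\<in>outer. weight D' i x) = (\<Sum>x\<in>outer. weight D i x)"
    by (intro sum.cong) (simp_all add: weight_def outer_sign)
  moreover have "writhe D i = (\<Sum>x\<in>outer. weight D i x) + (\<Sum>x\<in>inner. weight D i x)"
    unfolding writhe_weight[OF finite_classical] using classical_split finite_classical
    by (metis finite_Un sum.union_disjoint)
  moreover have "writhe D' i = (\<Sum>x\<in>outer. weight D' i x) + (\<Sum>x\<in>D'.inner. weight D' i x)"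
    unfolding writhe_weight[OF D'.finite_classical] using classical_split' D'.finite_classical
    by (metis finite_Un sum.union_disjoint)
  ultimately show ?thesis by simp
qed

lemma outer_avoids:
  assumes "(p, q) \<in> outer" "s \<in> set S"
  shows "p \<notin> closed_strand s \<and> q \<notin> closed_strand s"
proof -
  obtain j a b where s: "s = (j, a, b)" by (cases s)
  have le: "norm (pos D r) \<le> 1" if "r \<in> closed_strand s" for r
    using that assms(2) closed_norm[of j a b] by (auto simp: s pos_def)
  show ?thesis
  proof (intro conjI notI)
    assume "p \<in> closed_strand s"
    from le[OF this] show False using outer_norm(1)[OF assms(1)] by simp
  next
    assume "q \<in> closed_strand s"
    from le[OF this] show False using outer_norm(2)[OF assms(1)] by simp
  qed
qed

end

section \<open>Invariance of the framed count under the moves\<close>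

context finite_rack
begin

lemma disc_move_tangle:
  assumes "disc_move D S D'"
  shows "tangle R (ncomps D) (set S) (disc_move.outer D)"
proof -
  interpret disc_move D S D' by fact
  show ?thesis
    using strand_bounds strands_disjoint outer_norm outer_avoids by unfold_locales auto
qed

text \<open>The kink is the only new classical crossing, and it raises the writhe of component
  \<open>i\<close> by its sign \<open>e\<close>, which is the change of twist that
  \<open>card_colorings_move1\<close> demands.\<close>

lemma framed_count_move1:
  assumes D: "link_diagram D" and D': "link_diagram D'" and move: "reidemeister1 D D'"
  shows "framed_count D m = framed_count D' m"
proof -
  obtain s p q where agree: "agree_outside_disc D D'" and s: "disc_strands D [s]" and empty:
      "inner_double_points D = {}"
    and pq: "(p, q) \<in> classical D'" and kink: "inner_double_points D' = {(p, q), (q, p)}"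
    using move unfolding reidemeister1_def by blast
  interpret disc_move D "[s]" D' by unfold_locales (use D D' s agree in auto)
  obtain i a b where s: "s = (i, a, b)" by (cases s)
  have i: "i < ncomps D" "0 < a" "a < b" "b < 1" using strand_bounds[of i a b] by (auto simp: s)
  have "inner = {}" using empty by (simp add: inner_def)
  have inner': "D'.inner = {(p, q)}" using pq kink by (intro D'.inner_eq) auto
  then have "p \<in> open_strand s" "q \<in> open_strand s" using D'.inner_in_strands by auto
  then obtain u v where uv: "p = (i, u)" "q = (i, v)" "a < u" "u < b" "a < v" "v < b" by (auto simp: s)
  have "p \<noteq> q" using pq D'.classical_double by (auto simp: double_points_def)
  then have "u \<noteq> v" using uv by simp
  define e where "e = crossing_sign D' ((i, u), (i, v))"
  have cl: "classical D = outer" using classical_split \<open>inner = {}\<close> by simp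
  have cl': "classical D' = insert ((i, u), (i, v)) (classical D)"
    using classical_split' inner' cl uv by simp
  have writhe: "writhe D' j = writhe D j + (if j = i then e else 0)" for j
    using writhe_diff[of j]
        by (auto simp: \<open>inner = {}\<close> inner' uv weight_def e_def split: if_splits)
  show ?thesis unfolding framed_count_def ncomps_eq
  proof (rule card_colorings_move1[OF classical_base cl' i(1,2) uv(3-6) i(4) \<open>u \<noteq> v\<close>])
    show "(i, t) \<notin> snd ` classical D" if t: "a < t" "t < b" for t
    proof
      assume "(i, t) \<in> snd ` classical D"
      then obtain r where "(r, (i, t)) \<in> outer" unfolding cl by auto
      then show False using outer_avoids[of r "(i, t)" s] t by (simp add: s)
    qed
    show "crossing_sign D' x = crossing_sign D x" if "x \<in> classical D" for x
      using that outer_sign by (simp add: cl)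
    show "e = crossing_sign D' ((i, u), (i, v))" by (rule e_def)
    show "e = 1 \<or> e = - 1" unfolding e_def by (rule D'.crossing_sign_cases)
    show "(\<lambda>j. m j + writhe D' j) = (\<lambda>j. m j + writhe D j)(i := m i + writhe D i + e)"
      by (auto simp: writhe)
  qed
qed

text \<open>Between its two crossings the understrand stays on one side of the diameter, so it
  leaves and returns with opposite vertical directions. The crossing signs are therefore opposite
  and cancel in the writhe.\<close>

lemma framed_count_move2:
  assumes D: "link_diagram D" and D': "link_diagram D'" and move: "reidemeister2 D D'"
  shows "framed_count D m = framed_count D' m"
proof -
  obtain ov un p p' q q' where agree: "agree_outside_disc D D'" and s: "disc_strands D [ov, un]"
    and along: "along_diameter D' ov" and empty: "inner_double_points D = {}"
    and pts: "{p, p'} \<subseteq> open_strand ov" "{q, q'} \<subseteq> open_strand un" "p \<noteq> p'"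
    and pq: "{(p, q), (p', q')} \<subseteq> classical D'"
    and idp: "inner_double_points D' = {(p, q), (q, p), (p', q'), (q', p')}"
    using move unfolding reidemeister2_def by (elim conjE exE) (rule that)
  interpret disc_move D "[ov, un]" D' by unfold_locales (use D D' s agree in auto)
  obtain i a b j c d where ovun: "ov = (i, a, b)" "un = (j, c, d)" by (metis prod_cases3)
  have o: "(i, a, b) \<in> set [ov, un]" and u: "(j, c, d) \<in> set [ov, un]" by (simp_all add: ovun)
  have ne: "(i, a, b) \<noteq> (j, c, d)" using distinct_strands ovun by auto
  have jn: "j < ncomps D'" using D'.strand_bounds[OF u] by simp
  have "q \<noteq> q'"
  proof
    assume "q = q'"
    then have "(q, p) \<in> double_points D'" "(q, p') \<in> double_points D'"
      using pq D'.classical_double D'.double_sym[of p q] D'.double_sym[of p' q'] by auto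
    then show False using D'.double_unique pts(3) by blast
  qed
  have inner: "inner = {}" using empty by (simp add: inner_def)
  \<comment> \<open>Stated for undercrossings in the order of travel; the two labelings of the
    crossings are reduced to this case at the end.\<close>
  have main: "framed_count D m = framed_count D' m"
    if inner': "D'.inner = {((i, x), (j, v)), ((i, y), (j, w))}" and xy: "a < x" "x < b" "a < y" "y < b"
      and vw: "c < v" "v < w" "w < d" for x y v w
  proof -
    have dbl: "((i, x), (j, v)) \<in> double_points D'" "((i, y), (j, w)) \<in> double_points D'"
      using inner' D'.classical_double by (auto simp: D'.inner_def)
    note cr_v = D'.diameter_crossing[OF o along[unfolded ovun] xy(1,2) dbl(1)]
    note cr_w = D'.diameter_crossing[OF o along[unfolded ovun] xy(3,4) dbl(2)]
    have zero: "Im (curve D' j v) = 0" "Im (curve D' j w) = 0" using cr_v(3) cr_w(3)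
        by (simp_all add: pos_def)
    have only: "Im (curve D' j t) \<noteq> 0" if t: "v < t" "t < w" for t
    proof
      assume 0: "Im (curve D' j t) = 0"
      have tcd: "c \<le> t" "t \<le> d" using t vw by auto
      obtain r where r: "a < r" "r < b" "((i, r), (j, t)) \<in> inner_double_points D'"
        using D'.hits_diameter[OF o u ne along[unfolded ovun] tcd 0] by blast
      have "inner_double_points D' \<subseteq> D'.inner \<union> D'.inner\<inverse>"
        using idp pq by (auto simp: D'.inner_def)
      moreover have "(i, r) \<noteq> (j, v)" "(i, r) \<noteq> (j, w)"
        using r xy vw D'.strand_points_ne[OF o u ne, of r] by simp_all
      ultimately have "t = v \<or> t = w" using r(3) unfolding inner' by auto
      then show False using t by simp
    qed
    \<comment> \<open>The sign at the midpoint is compared with the slope at \<open>v\<close> and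
      with the slope at \<open>w\<close>.\<close>
    define z where "z = (v + w) / 2"
    have z: "v < z" "z < w" using vw by (auto simp: z_def)
    have "sgn (Im (curve D' j z)) = sgn (Im (vel D' (j, v)))"
      using z zero cr_v(1) only by (intro sgn_after_zero[OF D'.Im_deriv[OF jn]] D'.Im_cont[OF jn]) auto
    moreover have "sgn (Im (curve D' j z)) = - sgn (Im (vel D' (j, w)))"
      using z zero cr_w(1) only by (intro sgn_before_zero[OF D'.Im_deriv[OF jn]] D'.Im_cont[OF jn]) auto
    ultimately have sgn: "sgn (Im (vel D' (j, w))) = - sgn (Im (vel D' (j, v)))" by simp
    have "Re (curve D' i b) = 1 \<or> Re (curve D' i b) = - 1"
      using D'.diameter(4)[OF o along[unfolded ovun]] by auto
    then have opp: "crossing_sign D' ((i, y), (j, w)) = 1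
        \<longleftrightarrow> crossing_sign D' ((i, x), (j, v)) \<noteq> 1"
      unfolding cr_v(2) cr_w(2) sgn using cr_v(1) by (auto simp: sgn_if)
    then have opp': "crossing_sign D' ((i, y), (j, w)) = - crossing_sign D' ((i, x), (j, v))"
      using D'.crossing_sign_cases[of "((i, y), (j, w))"] D'.crossing_sign_cases[of "((i, x), (j, v))"]
          by auto
    have "(\<Sum>x\<in>D'.inner. weight D' k x)
        = weight D' k ((i, x), (j, v)) + weight D' k ((i, y), (j, w))" for k
      using vw by (simp add: inner')
    then have "(\<Sum>x\<in>D'.inner. weight D' k x) = 0" for k
      unfolding weight_def fst_conv snd_conv opp' by simp
    then have writhe: "writhe D' k = writhe D k" for k
      using writhe_diff[of k] by (simp add: inner)
    interpret tangle R "ncomps D" "\<lambda>i. m i + writhe D i" "set [ov, un]" outer "crossing_sign D"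
      by (rule disc_move_tangle) unfold_locales
    have "filling {} (crossing_sign D)" unfolding filling_def by simp
    moreover have "filling D'.inner (crossing_sign D')"
      unfolding filling_def inside_def using D'.inner_in_strands outer_sign by simp
    ultimately have "card (colorings R (ncomps D) (outer \<union> {}) (crossing_sign D) (\<lambda>i. m i + writhe D i))
        = card (colorings R (ncomps D) (outer \<union> D'.inner) (crossing_sign D')
            (\<lambda>i. m i + writhe D i))"
      by (rule card_colorings_move2[OF _ ne _ _ inner' xy vw opp, rotated]) (simp add: ovun)
    then show ?thesis
      unfolding framed_count_def ncomps_eq writhe classical_split(1) classical_split'(1) inner by simp
  qed
  obtain x y v w where eq: "p = (i, x)" "p' = (i, y)" "q = (j, v)" "q' = (j, w)"
    and bd: "a < x" "x < b" "a < y" "y < b" "c < v" "v < d" "c < w" "w < d"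
    using pts(1,2) by (auto simp: ovun)
  have inner': "D'.inner = {(p, q), (p', q')}" using pq idp by (intro D'.inner_eq) auto
  consider "v < w" | "w < v" using \<open>q \<noteq> q'\<close> eq by force
  then show ?thesis
  proof cases
    case 1
    then show ?thesis using inner' bd by (intro main[of x v y w]) (auto simp: eq)
  next
    case 2
    then show ?thesis using inner' bd by (intro main[of y w x v]) (auto simp: eq)
  qed
qed

text \<open>All three signs persist: two are read off from fixed end points, the third comes from
  \<open>chord_crossing_sign\<close>. So the writhes agree, and passing to the other side of the
  diameter shows only in the negation of both order flags.\<close>

lemma framed_count_move3:
  assumes D: "link_diagram D" and D': "link_diagram D'" and move: "reidemeister3 D D'"
  shows "framed_count D k = framed_count D' k"
proof -
  obtain hi mid lo mp lp mp' lp' where agree: "agree_outside_disc D D'"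
    and tri: "triangle D hi mid lo mp lp" "Im (pos D mp) < 0"
    and tri': "triangle D' hi mid lo mp' lp'" "Im (pos D' mp') > 0"
    using move unfolding reidemeister3_def by blast
  have "disc_strands D [hi, mid, lo]" using tri(1) by (simp add: triangle_def)
  then interpret disc_move D "[hi, mid, lo]" D' by unfold_locales (use D D' agree in auto)
  obtain i a b j c d l e f where names: "hi = (i, a, b)" "mid = (j, c, d)" "lo = (l, e, f)"
    by (metis prod_cases3)
  have S: "[hi, mid, lo] = [(i, a, b), (j, c, d), (l, e, f)]" by (simp add: names)
  have hS: "(i, a, b) \<in> set [hi, mid, lo]" and mS: "(j, c, d) \<in> set [hi, mid, lo]" and lS:
      "(l, e, f) \<in> set [hi, mid, lo]"
    by (simp_all add: names)
  have ne: "hi \<noteq> mid" "hi \<noteq> lo" "mid \<noteq> lo" using distinct_strands by auto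
  obtain p p' v w m u where
    bd: "a < p" "p < b" "a < p'" "p' < b" "c < v" "v < d" "c < m" "m < d" "e < w" "w < f" "e < u" "u < f"
    and inner: "inner = {((i, p), (j, v)), ((i, p'), (l, w)), ((j, m), (l, u))}"
    and e1: "crossing_sign D ((i, p), (j, v)) = 1 \<longleftrightarrow> sgn (Im (curve D j d))
        = Re (curve D i b)"
    and e2: "crossing_sign D ((i, p'), (l, w)) = 1 \<longleftrightarrow> sgn (Im (curve D l f))
        = Re (curve D i b)"
    and dbl: "((j, m), (l, u)) \<in> double_points D"
    and only: "\<And>s t. \<lbrakk>s \<in> {c..d}; t \<in> {e..f}; curve D j s = curve D l t\<rbrakk>
        \<Longrightarrow> s = m \<and> t = u"
    and nz: "Im (curve D j d) \<noteq> 0" "Im (curve D l f) \<noteq> 0"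
    and order: "v \<noteq> m" "w \<noteq> u" "m < v \<longleftrightarrow> Im (curve D j d) > 0"
        "u < w \<longleftrightarrow> Im (curve D l f) > 0"
    by (rule triangle_data[OF S tri(1)[unfolded names]]) (use tri(2) in blast)
  obtain r r' v' w' m' u' where
    bd': "a < r" "r < b" "a < r'" "r' < b" "c < v'" "v' < d" "c < m'" "m' < d" "e < w'" "w' < f"
        "e < u'" "u' < f"
    and inner': "D'.inner = {((i, r), (j, v')), ((i, r'), (l, w')), ((j, m'), (l, u'))}"
    and e1': "crossing_sign D' ((i, r), (j, v')) = 1 \<longleftrightarrow> sgn (Im (curve D' j d))
        = Re (curve D' i b)"
    and e2': "crossing_sign D' ((i, r'), (l, w')) = 1 \<longleftrightarrow> sgn (Im (curve D' l f))
        = Re (curve D' i b)"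
    and dbl': "((j, m'), (l, u')) \<in> double_points D'"
    and only': "\<And>s t. \<lbrakk>s \<in> {c..d}; t \<in> {e..f}; curve D' j s = curve D' l t\<rbrakk>
        \<Longrightarrow> s = m' \<and> t = u'"
    and order': "v' \<noteq> m'" "w' \<noteq> u'" "m' < v'
        \<longleftrightarrow> \<not> Im (curve D' j d) > 0" "u' < w' \<longleftrightarrow> \<not> Im
            (curve D' l f) > 0"
    by (rule D'.triangle_data[OF S tri'(1)[unfolded names]]) (use tri'(2) in blast)
  have ends: "curve D' i b = curve D i b" "curve D' j c = curve D j c" "curve D' j d = curve D j d"
      "curve D' l e = curve D l e" "curve D' l f = curve D l f"
    using end_agree[OF hS] end_agree[OF mS] end_agree[OF lS] by simp_all
  have bounds: "i < ncomps D" "j < ncomps D" "l < ncomps D"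
    using strand_bounds[OF hS] strand_bounds[OF mS] strand_bounds[OF lS] by simp_all
  have bounds': "j < ncomps D'" "l < ncomps D'" using bounds by (simp_all add: ncomps_eq)
  have "cdet (vel D' (j, m')) (vel D' (l, u')) > 0
      \<longleftrightarrow> cdet (vel D (j, m)) (vel D (l, u)) > 0"
    by (rule chord_crossing_sign[OF bd(7,8,11,12) curve_cont[OF bounds(2)] curve_cont[OF bounds(3)] only _
          curve_deriv[OF bounds(2)] curve_deriv[OF bounds(3)] crossing_det[OF dbl]
          bd'(7,8,11,12) D'.curve_cont[OF bounds'(1)] D'.curve_cont[OF bounds'(2)] only' _
          D'.curve_deriv[OF bounds'(1)] D'.curve_deriv[OF bounds'(2)] D'.crossing_det[OF dbl']])
      (use dbl dbl' closed_norm[OF mS] closed_norm[OF lS] D'.closed_norm[OF mS] D'.closed_norm[OF lS] ends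
        end_norm[OF mS] end_norm[OF lS] in \<open>simp_all add: double_points_def pos_def\<close>)
  then have s3: "crossing_sign D' ((j, m'), (l, u')) = crossing_sign D ((j, m), (l, u))"
    by (simp add: crossing_sign_def)
  have s1: "crossing_sign D' ((i, r), (j, v')) = crossing_sign D ((i, p), (j, v))"
    using e1 e1' D'.crossing_sign_cases[of "((i, r), (j, v'))"] crossing_sign_cases[of "((i, p), (j, v))"]
    by (auto simp: ends)
  have s2: "crossing_sign D' ((i, r'), (l, w')) = crossing_sign D ((i, p'), (l, w))"
    using e2 e2' D'.crossing_sign_cases[of "((i, r'), (l, w'))"] crossing_sign_cases[of "((i, p'), (l, w))"]
    by (auto simp: ends)
  have mid_lo: "(j, t) \<noteq> (l, t')" if "c \<le> t" "t \<le> d" "e \<le> t'" "t' \<le> f" for t t'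
    using strand_points_ne[OF mS lS] that ne(3) names by blast
  have hi_mid: "(i, t) \<noteq> (j, t')" if "a \<le> t" "t \<le> b" "c \<le> t'" "t' \<le> d" for t t'
    using strand_points_ne[OF hS mS] that ne(1) names by blast
  have sum: "(\<Sum>x\<in>{((i, p), (j, v)), ((i, p'), (l, w)), ((j, m), (l, u))}. weight E h x)
      = weight E h ((i, p), (j, v)) + weight E h ((i, p'), (l, w)) + weight E h ((j, m), (l, u))"
    if "a < p" "p < b" "a < p'" "p' < b" "c < v" "v < d" "c < m" "m < d" "e < w" "w < f" "e < u" "u < f"
        "w \<noteq> u"
    for E h p p' v w m u
  proof -
    have ne1: "((i, p), (j, v)) \<noteq> ((i, p'), (l, w))" using mid_lo[of v w] that by simp
    have ne2: "((i, p), (j, v)) \<noteq> ((j, m), (l, u))" using mid_lo[of v u] that by simp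
    have ne3: "((i, p'), (l, w)) \<noteq> ((j, m), (l, u))" using that by simp
    have three: "x \<noteq> y \<Longrightarrow> x \<noteq> z \<Longrightarrow> y \<noteq> z
        \<Longrightarrow> sum g {x, y, z} = g x + g y + g z"
      for x y z :: "param \<times> param" and g :: "param \<times> param \<Rightarrow> int" by simp
    show ?thesis by (rule three[OF ne1 ne2 ne3])
  qed
  have "(\<Sum>x\<in>D'.inner. weight D' h x) = (\<Sum>x\<in>inner. weight D h x)" for h
    unfolding inner inner' sum[OF bd order(2)] sum[OF bd' order'(2)]
    unfolding weight_def fst_conv snd_conv s1 s2 s3 ..
  then have writhe: "writhe D' h = writhe D h" for h using writhe_diff[of h] by simp
  interpret tangle R "ncomps D" "\<lambda>i. k i + writhe D i" "set [hi, mid, lo]" outer "crossing_sign D"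
    by (rule disc_move_tangle) unfold_locales
  have fill: "filling inner (crossing_sign D)"
    unfolding filling_def inside_def using inner_in_strands by simp
  have fill': "filling D'.inner (crossing_sign D')"
    unfolding filling_def inside_def using D'.inner_in_strands outer_sign by simp
  let ?e1 = "crossing_sign D ((i, p), (j, v))" and ?e2 = "crossing_sign D ((i, p'), (l, w))"
    and ?e3 = "crossing_sign D ((j, m), (l, u))"
    and ?mf = "Im (curve D j d) > 0" and ?lf = "Im (curve D l f) > 0"
  have t: "triangle_filling inner (crossing_sign D) hi mid lo ?e1 ?e2 ?e3 ?mf ?lf"
    unfolding names by (rule triangle_fillingI[OF bd order(1,2) inner HOL.refl HOL.refl HOL.refl order(3,4)[symmetric]])
  have t': "triangle_filling D'.inner (crossing_sign D') hi mid lo ?e1 ?e2 ?e3 (\<not> ?mf) (\<not> ?lf)"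
    unfolding names ends(3,5)[symmetric]
    by (rule triangle_fillingI[OF bd' order'(1,2) inner' s1 s2 s3 order'(3,4)[symmetric]])
  have "along_diameter D (i, a, b)" using tri(1) by (simp add: triangle_def names)
  then have "Re (curve D i b) = 1 \<or> Re (curve D i b) = - 1" using diameter(4)[OF hS] by auto
  \<comment> \<open>Up to the direction of the highest strand, a sign tells whether a lower strand
    passes upwards or downwards. In \<open>D\<close> the crossing of the lower strands is below the
    diameter, so an upward strand meets it first; equal signs thus mean equal order flags.\<close>
  then have signs: "(?e1 = 1 \<longleftrightarrow> ?e2 = 1) \<longleftrightarrow> (?mf
      \<longleftrightarrow> ?lf)"
    unfolding e1 e2 using nz by (auto simp: sgn_if)
  have "card (colorings R (ncomps D) (outer \<union> inner) (crossing_sign D) (\<lambda>i. k i + writhe D i))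
      = card (colorings R (ncomps D) (outer \<union> D'.inner) (crossing_sign D')
          (\<lambda>i. k i + writhe D i))"
    by (rule card_colorings_move3[OF _ ne fill fill' t t' signs]) simp
  then show ?thesis
    unfolding framed_count_def ncomps_eq writhe classical_split(1) classical_split'(1) .
qed

lemma framed_count_diagram_move:
  assumes "diagram_move D D'"
  shows "ncomps D = ncomps D' \<and> framed_count D m = framed_count D' m"
proof
  show "ncomps D = ncomps D'"
    using assms unfolding diagram_move_def planar_isotopic_def reidemeister1_def reidemeister2_def
      reidemeister3_def detour_def agree_outside_disc_def by blast
  show "framed_count D m = framed_count D' m"
    using assms unfolding diagram_move_def
    by (blast intro: framed_count_planar_isotopy framed_count_move1 framed_count_move2 framed_count_move3
        framed_count_detour)
qed

lemma framed_count_ambient_isotopic: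
  assumes "ambient_isotopic D D'"
  shows "ncomps D = ncomps D' \<and> framed_count D m = framed_count D' m"
  using assms unfolding ambient_isotopic_def
proof (induction rule: equivclp_induct)
  case (step y z)
  then show ?case using framed_count_diagram_move[of y z m] framed_count_diagram_move[of z y m] by auto
qed simp

end

theorem corollary5:
  fixes T :: "'a rack" and N :: nat and D D' :: diagram
  assumes "rack T" and "finite (carrier T)" and "rack_rank T = N"
    and "link_diagram D" and "link_diagram D'"
    and "ambient_isotopic D D'"
    and "\<forall>i<ncomps D. [writhe D i = writhe D' i] (mod int N)"
  shows "card (rack_hom (fundamental_rack D) T) = card (rack_hom (fundamental_rack D') T)"
proof -
  interpret finite_rack T using assms(1,2) by (simp add: finite_rack_def finite_rack_axioms_def)
  interpret D: colored_diagram D T by unfold_locales (rule assms(4))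
  interpret D': colored_diagram D' T by unfold_locales (rule assms(5))
  define m where "m = (\<lambda>i. - writhe D i)"
  have n: "ncomps D = ncomps D'" and count: "framed_count D m = framed_count D' m"
    using framed_count_ambient_isotopic[OF assms(6)] by auto
  have "card (rack_hom (fundamental_rack D) T) = framed_count D m"
    by (simp add: D.card_fundamental_rack_hom D.card_arc_colorings framed_count_def m_def)
  also have "\<dots> = card (colorings T (ncomps D') (classical D') (crossing_sign D') (\<lambda>i. m i + writhe D' i))"
    using count by (simp add: framed_count_def)
  also have "\<dots> = card (colorings T (ncomps D') (classical D') (crossing_sign D') (\<lambda>_. 0))"
  proof (intro arg_cong[where f = card] colorings_cong D'.classical_base)
    show "[m i + writhe D' i = 0] (mod int (rack_rank T))" if "i < ncomps D'" for i
      using assms(3,7) that n by (simp add: m_def cong_iff_dvd_diff dvd_diff_commute)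
  qed simp
  also have "\<dots> = card (rack_hom (fundamental_rack D') T)"
    by (simp add: D'.card_fundamental_rack_hom D'.card_arc_colorings)
  finally show ?thesis .
qed

end
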